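(* Assume: (i) the process $\{(S_t,A_t,R_t)\}_{t\ge 0}$ generating the data is strictly stationary and exponentially $\beta$-mixing; (ii) for every $k$, $\widehat{Q}_k,\widehat{\tau}_k,\widehat{\omega}_k$ converge in $L_2$-norm to $Q^{\pi},\tau^{\pi},\omega^{\pi}$ at rates $(nT)^{-\alpha_1},(nT)^{-\alpha_2},(nT)^{-\alpha_3}$ respectively, for some (arbitrary) $\alpha_1,\alpha_2,\alpha_3>0$; (iii) $\widehat{Q}_k,\widehat{\tau}_k,\widehat{\omega}_k,\tau^{\pi},\omega^{\pi}$ are uniformly bounded almost surely. Let $m\ge1$ be a fixed integer satisfying $\alpha_1+(m-1)\alpha_2+\alpha_3>1/2$. Then the confidence interval $$\Bigl[\widehat{\eta}_{\mathrm{TR}}^{(m)}-z_{\alpha/2}(nT)^{-1/2}\widehat{\sigma}^{(m)},\ \widehat{\eta}_{\mathrm{TR}}^{(m)}+z_{\alpha/2}(nT)^{-1/2}\widehat{\sigma}^{(m)}\Bigr]$$ achieves nominal coverage: for every significance level $\alpha\in(0,1)$, as either $n\to\infty$ or $T\to\infty$, the probability that it contains $\eta^{\pi}$ converges to $1-\alpha$.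
   Context: Model. A Markov decision process has discrete state space $\mathcal{S}$, action space $\mathcal{A}$ (all probabilities below are mass functions), transition kernel $p$, reward function $r$, and discount factor $\gamma\in(0,1)$. A trajectory $\{(S_t,A_t,R_t)\}_{t\ge 0}$ of states, actions, rewards satisfies $\mathbb{P}(S_{t+1}=s\mid\{S_j,A_j,R_j\}_{0\le j\le t})=p(s;A_t,S_t)$ and $\mathbb{E}(R_t\mid S_t,A_t,\{S_j,A_j,R_j\}_{0\le j<t})=r(A_t,S_t)$. Rewards are uniformly bounded. The observed data are $n$ i.i.d. trajectories $\{(S_{i,t},A_{i,t},R_{i,t},S_{i,t+1})\}_{0\le t<T,1\le i\le n}$, generated under some behavior policy. Exponentially $\beta$-mixing means the $\beta$-mixing coefficients satisfy $\beta(q)=O(\rho^q)$ for some $\rho\in(0,1)$. Target. A fixed stationary target policy $\pi(a\mid s)$ and a prespecified reference distribution $\mathbb{G}$ on $\mathcal{S}$ are given. $Q^{\pi}(a,s)=\sum_{t\ge0}\gamma^t\mathbb{E}^{\pi}(R_t\mid A_0=a,S_0=s)$, $V^{\pi}(s)=\sum_{t\ge0}\gamma^t\mathbb{E}^{\pi}(R_t\mid S_0=s)$ ($\mathbb{E}^\pi$: expectation when actions follow $\pi$), and $\eta^{\pi}=\mathbb{E}_{s\sim\mathbb{G}}V^{\pi}(s)$. Density ratios. $p_\infty$ is the limiting distribution of $\{(A_t,S_t)\}_{t\ge0}$ in the data process. $$\omega^{\pi}(a,s)=\frac{(1-\gamma)\sum_{t\ge0}\gamma^tp_t^{\pi}(a,s)}{p_\infty(a,s)},\qquad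 \tau^{\pi}(a,s,a_0,s_0)=\frac{(1-\gamma)\{\mathcal{I}(a=a_0,s=s_0)+\sum_{t\ge1}\gamma^tp_t^{\pi}(a,s\mid a_0,s_0)\}}{p_\infty(a,s)},$$ where $p_t^{\pi}(a,s)$ is the probability of $(A_t,S_t)=(a,s)$ following $\pi$ with $S_0\sim\mathbb{G}$, $p_t^\pi(a,s\mid a_0,s_0)$ is the probability of $(A_t,S_t)=(a,s)$ following $\pi$ given $(A_0,S_0)=(a_0,s_0)$, and $\mathcal{I}$ is the indicator. These are understood as genuine density ratios (numerator zero wherever $p_\infty$ is zero). Estimator. Randomly divide $\{1,\dots,n\}$ into a fixed number $\mathbb{K}\ge2$ of disjoint nonempty subsets $\mathbb{I}_1,\dots,\mathbb{I}_{\mathbb{K}}$. For each $k$, $\widehat{Q}_k,\widehat{\tau}_k,\widehat{\omega}_k$ are estimators of $Q^{\pi},\tau^{\pi},\omega^{\pi}$ computed only from trajectories outside $\mathbb{I}_k$. For $i\in\mathbb{I}_k$, $0\le t<T$, and a function $Q(a,s)$, the individual debiasing operator is $$\mathcal{D}_k^{(i,t)}Q(a,s)=Q(a,s)+\frac{1}{1-\gamma}\widehat{\tau}_k(A_{i,t},S_{i,t},a,s)\{R_{i,t}+\gamma\mathbb{E}_{a'\sim\pi(\cdot\mid S_{i,t+1})}Q(a',S_{i,t+1})-Q(A_{i,t},S_{i,t})\}.$$ $\widehat{Q}_k^{(1)}=\widehat{Q}_k$, and for $m\ge2$, $\widehat{Q}_k^{(m)}$ is the average of $\mathcal{D}_k^{(i_1,t_1)}\cdots\mathcal{D}_k^{(i_{m-1},t_{m-1})}\widehat{Q}_k$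 over all ordered $(m-1)$-tuples of pairwise distinct indices $(i_1,t_1),\dots,(i_{m-1},t_{m-1})$ in $\{(i,t):i\in\mathbb{I}_k,0\le t<T\}$ (assume $|\mathbb{I}_k|T\ge m-1$). For $i\in\mathbb{I}_k$, $$\psi^{(m)}_{i,t}=\frac{1}{1-\gamma}\widehat{\omega}_k(A_{i,t},S_{i,t})\{R_{i,t}-\widehat{Q}^{(m)}_k(A_{i,t},S_{i,t})+\gamma\mathbb{E}_{a\sim\pi(\cdot\mid S_{i,t+1})}\widehat{Q}^{(m)}_k(a,S_{i,t+1})\}+\mathbb{E}_{s\sim\mathbb{G},a\sim\pi(\cdot\mid s)}\widehat{Q}^{(m)}_k(a,s),$$ and $\widehat{\eta}^{(m)}_{\mathrm{TR}}=(nT)^{-1}\sum_{i=1}^n\sum_{t=0}^{T-1}\psi^{(m)}_{i,t}$. $\{\widehat{\sigma}^{(m)}\}^2$ is the sample variance of $\{\psi^{(m)}_{i,t}\}_{1\le i\le n,0\le t<T}$, and $z_{\alpha}$ is the upper $\alpha$-th quantile of the standard normal distribution. $L_2$-norm convergence rates. $\widehat{Q}_k$ converges in $L_2$-norm to $Q^\pi$ at rate $(nT)^{-\alpha}$ if $\sqrt{\mathbb{E}_{(a,s)\sim p_\infty}\mathbb{E}|\widehat{Q}_k(a,s)-Q^{\pi}(a,s)|^2}=O\{(nT)^{-\alpha}\}$; likewise for $\widehat\omega_k$ and $\omega^\pi$; $\widehat{\tau}_k$ converges in $L_2$-norm to $\tau^{\pi}$ at rate $(nT)^{-\alpha}$ if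 $\sqrt{\mathbb{E}_{(a,s)\sim p_\infty}\mathbb{E}_{(a^*,s^* )\sim p_\infty}\mathbb{E}|\widehat{\tau}_k(a,s,a^*,s^* )-\tau^{\pi}(a,s,a^*,s^* )|^2}=O\{(nT)^{-\alpha}\}$, where the outer expectations are over independent draws and the inner one over the estimator's training data.
   Formalization: Adds that ω^π(A_0,S_0){R_0 − Q^π(A_0,S_0) + γE_{a∼π}Q^π(a,S_1)} is not almost surely zero (positive asymptotic variance); otherwise, e.g. with one state, one action, zero reward and exact estimators, the interval is {η^π} and coverage is 1. *)

theory Defs
  imports "HOL-Probability.Probability" "HOL-Library.Landau_Symbols"
begin

text \<open>
  Argument orders follow the notation: \<open>p a s\<close> is the law of the next state after taking action \<open>a\<close>
  in state \<open>s\<close>, \<open>r a s\<close> is the mean reward, \<open>pol s\<close> is the law of the action chosen in \<open>s\<close>, and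
  state-action pairs are written \<open>(a, s)\<close>.
\<close>

definition start_law :: "('s \<Rightarrow> 'a pmf) \<Rightarrow> 's pmf \<Rightarrow> ('a \<times> 's) pmf" where
  "start_law pol \<mu> = bind_pmf \<mu> (\<lambda>s. map_pmf (\<lambda>a. (a, s)) (pol s))"

primrec sa_law ::
  "('a \<Rightarrow> 's \<Rightarrow> 's pmf) \<Rightarrow> ('s \<Rightarrow> 'a pmf) \<Rightarrow> ('a \<times> 's) pmf \<Rightarrow> nat \<Rightarrow> ('a \<times> 's) pmf" where
  "sa_law p pol \<nu> 0 = \<nu>"
| "sa_law p pol \<nu> (Suc t) = bind_pmf (sa_law p pol \<nu> t) (\<lambda>(a, s). start_law pol (p a s))"

text \<open>
  The model prescribes the law of a reward only through its conditional mean \<open>r\<close> given the current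
  state-action pair, so the expectation of the reward at time \<open>t\<close> under \<open>pol\<close> is the expectation of
  \<open>r\<close> at the state-action pair at time \<open>t\<close>.
\<close>

definition exp_reward ::
  "('a \<Rightarrow> 's \<Rightarrow> 's pmf) \<Rightarrow> ('a \<Rightarrow> 's \<Rightarrow> real) \<Rightarrow> ('s \<Rightarrow> 'a pmf) \<Rightarrow> ('a \<times> 's) pmf \<Rightarrow> nat \<Rightarrow> real" where
  "exp_reward p r pol \<nu> t = measure_pmf.expectation (sa_law p pol \<nu> t) (\<lambda>(a, s). r a s)"

definition Q_fun ::
  "real \<Rightarrow> ('a \<Rightarrow> 's \<Rightarrow> 's pmf) \<Rightarrow> ('a \<Rightarrow> 's \<Rightarrow> real) \<Rightarrow> ('s \<Rightarrow> 'a pmf) \<Rightarrow> 'a \<Rightarrow> 's \<Rightarrow> real" where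
  "Q_fun \<gamma> p r pol a s = (\<Sum>t. \<gamma> ^ t * exp_reward p r pol (return_pmf (a, s)) t)"

definition V_fun ::
  "real \<Rightarrow> ('a \<Rightarrow> 's \<Rightarrow> 's pmf) \<Rightarrow> ('a \<Rightarrow> 's \<Rightarrow> real) \<Rightarrow> ('s \<Rightarrow> 'a pmf) \<Rightarrow> 's \<Rightarrow> real" where
  "V_fun \<gamma> p r pol s = (\<Sum>t. \<gamma> ^ t * exp_reward p r pol (start_law pol (return_pmf s)) t)"

definition policy_value ::
  "real \<Rightarrow> ('a \<Rightarrow> 's \<Rightarrow> 's pmf) \<Rightarrow> ('a \<Rightarrow> 's \<Rightarrow> real) \<Rightarrow> ('s \<Rightarrow> 'a pmf) \<Rightarrow> 's pmf \<Rightarrow> real" where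
  "policy_value \<gamma> p r pol G = measure_pmf.expectation G (V_fun \<gamma> p r pol)"

definition omega_num ::
  "real \<Rightarrow> ('a \<Rightarrow> 's \<Rightarrow> 's pmf) \<Rightarrow> ('s \<Rightarrow> 'a pmf) \<Rightarrow> 's pmf \<Rightarrow> 'a \<Rightarrow> 's \<Rightarrow> real" where
  "omega_num \<gamma> p pol G a s =
     (1 - \<gamma>) * (\<Sum>t. \<gamma> ^ t * pmf (sa_law p pol (start_law pol G) t) (a, s))"

definition tau_num ::
  "real \<Rightarrow> ('a \<Rightarrow> 's \<Rightarrow> 's pmf) \<Rightarrow> ('s \<Rightarrow> 'a pmf) \<Rightarrow> 'a \<Rightarrow> 's \<Rightarrow> 'a \<Rightarrow> 's \<Rightarrow> real" where
  "tau_num \<gamma> p pol a s a0 s0 =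
     (1 - \<gamma>) * (of_bool (a = a0 \<and> s = s0) +
       (\<Sum>t. \<gamma> ^ Suc t * pmf (sa_law p pol (return_pmf (a0, s0)) (Suc t)) (a, s)))"

definition omega_ratio ::
  "real \<Rightarrow> ('a \<Rightarrow> 's \<Rightarrow> 's pmf) \<Rightarrow> ('s \<Rightarrow> 'a pmf) \<Rightarrow> 's pmf \<Rightarrow> ('a \<times> 's) pmf \<Rightarrow> 'a \<Rightarrow> 's \<Rightarrow> real" where
  "omega_ratio \<gamma> p pol G pinf a s = omega_num \<gamma> p pol G a s / pmf pinf (a, s)"

definition tau_ratio ::
  "real \<Rightarrow> ('a \<Rightarrow> 's \<Rightarrow> 's pmf) \<Rightarrow> ('s \<Rightarrow> 'a pmf) \<Rightarrow> ('a \<times> 's) pmf \<Rightarrow>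
     'a \<Rightarrow> 's \<Rightarrow> 'a \<Rightarrow> 's \<Rightarrow> real" where
  "tau_ratio \<gamma> p pol pinf a s a0 s0 = tau_num \<gamma> p pol a s a0 s0 / pmf pinf (a, s)"

type_synonym ('s, 'a) obs = "'s \<times> 'a \<times> real"

definition obs_space :: "('s, 'a) obs measure" where
  "obs_space = count_space UNIV \<Otimes>\<^sub>M (count_space UNIV \<Otimes>\<^sub>M borel)"

definition sub_algebra :: "'w measure \<Rightarrow> (nat \<Rightarrow> 'w \<Rightarrow> ('s, 'a) obs) \<Rightarrow> nat set \<Rightarrow> 'w measure" where
  "sub_algebra M X J =
     vimage_algebra (space M) (\<lambda>w. \<lambda>j\<in>J. X j w) (PiM J (\<lambda>_. obs_space))"

text \<open>The information \<open>S\<^sub>t\<close>, \<open>A\<^sub>t\<close>, \<open>(S\<^sub>j, A\<^sub>j, R\<^sub>j)\<close> for \<open>j < t\<close> available just before \<open>R\<^sub>t\<close>.\<close>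

definition pre_reward_algebra ::
  "'w measure \<Rightarrow> (nat \<Rightarrow> 'w \<Rightarrow> ('s, 'a) obs) \<Rightarrow> nat \<Rightarrow> 'w measure" where
  "pre_reward_algebra M X t =
     vimage_algebra (space M) (\<lambda>w. (fst (X t w), fst (snd (X t w)), \<lambda>j\<in>{..<t}. X j w))
       (count_space UNIV \<Otimes>\<^sub>M (count_space UNIV \<Otimes>\<^sub>M PiM {..<t} (\<lambda>_. obs_space)))"

text \<open>
  The behavior policy is left arbitrary (it may depend on the whole past), so no condition
  is imposed on the conditional law of the actions.
\<close>

definition mdp_trajectory ::
  "'w measure \<Rightarrow> ('a \<Rightarrow> 's \<Rightarrow> 's pmf) \<Rightarrow> ('a \<Rightarrow> 's \<Rightarrow> real) \<Rightarrow>
     (nat \<Rightarrow> 'w \<Rightarrow> 's) \<Rightarrow> (nat \<Rightarrow> 'w \<Rightarrow> 'a) \<Rightarrow> (nat \<Rightarrow> 'w \<Rightarrow> real) \<Rightarrow> bool" where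
  "mdp_trajectory M p r S A R \<longleftrightarrow>
     (let X = (\<lambda>t w. (S t w, A t w, R t w)) in
      (\<forall>t. S t \<in> measurable M (count_space UNIV) \<and> A t \<in> measurable M (count_space UNIV)
           \<and> R t \<in> borel_measurable M) \<and>
      (\<forall>t s. AE w in M.
         real_cond_exp M (sub_algebra M X {..t}) (indicator {w \<in> space M. S (Suc t) w = s}) w
           = pmf (p (A t w) (S t w)) s) \<and>
      (\<forall>t. integrable M (R t) \<and>
         (AE w in M. real_cond_exp M (pre_reward_algebra M X t) (R t) w = r (A t w) (S t w))))"

definition strictly_stationary :: "'w measure \<Rightarrow> (nat \<Rightarrow> 'w \<Rightarrow> ('s, 'a) obs) \<Rightarrow> bool" where
  "strictly_stationary M X \<longleftrightarrow>
     (\<forall>h. distr M (PiM UNIV (\<lambda>_. obs_space)) (\<lambda>w t. X (t + h) w)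
        = distr M (PiM UNIV (\<lambda>_. obs_space)) (\<lambda>w t. X t w))"

text \<open>
  The beta-dependence of two sub-sigma-algebras, as a supremum over pairs of finite measurable
  partitions; the supremum is of real numbers in \<open>[0, 1]\<close>.
\<close>

definition beta_dep :: "'w measure \<Rightarrow> 'w measure \<Rightarrow> 'w measure \<Rightarrow> real" where
  "beta_dep M F H =
     (SUP (P, P') \<in> {P. finite P \<and> P \<subseteq> sets F \<and> partition_on (space M) P} \<times>
                    {P. finite P \<and> P \<subseteq> sets H \<and> partition_on (space M) P}.
        1 / 2 * (\<Sum>a\<in>P. \<Sum>b\<in>P'. \<bar>measure M (a \<inter> b) - measure M a * measure M b\<bar>))"

definition beta_mixing_coeff :: "'w measure \<Rightarrow> (nat \<Rightarrow> 'w \<Rightarrow> ('s, 'a) obs) \<Rightarrow> nat \<Rightarrow> real" where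
  "beta_mixing_coeff M X q =
     (SUP t. beta_dep M (sub_algebra M X {..t}) (sub_algebra M X {t + q..}))"

definition exp_beta_mixing :: "'w measure \<Rightarrow> (nat \<Rightarrow> 'w \<Rightarrow> ('s, 'a) obs) \<Rightarrow> bool" where
  "exp_beta_mixing M X \<longleftrightarrow>
     (\<exists>\<rho>. 0 < \<rho> \<and> \<rho> < 1 \<and> beta_mixing_coeff M X \<in> O(\<lambda>q. \<rho> ^ q))"

definition iid_trajectories :: "'w measure \<Rightarrow> (nat \<Rightarrow> nat \<Rightarrow> 'w \<Rightarrow> ('s, 'a) obs) \<Rightarrow> bool" where
  "iid_trajectories M X \<longleftrightarrow>
     prob_space.indep_vars M (\<lambda>_. PiM UNIV (\<lambda>_. obs_space)) (\<lambda>i w t. X i t w) UNIV \<and>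
     (\<forall>i. distr M (PiM UNIV (\<lambda>_. obs_space)) (\<lambda>w t. X i t w)
        = distr M (PiM UNIV (\<lambda>_. obs_space)) (\<lambda>w t. X 0 t w))"

type_synonym ('s, 'a) transition = "'s \<times> 'a \<times> real \<times> 's"

definition transition_space :: "('s, 'a) transition measure" where
  "transition_space =
     count_space UNIV \<Otimes>\<^sub>M (count_space UNIV \<Otimes>\<^sub>M (borel \<Otimes>\<^sub>M count_space UNIV))"

definition transitions ::
  "(nat \<Rightarrow> nat \<Rightarrow> 'w \<Rightarrow> 's) \<Rightarrow> (nat \<Rightarrow> nat \<Rightarrow> 'w \<Rightarrow> 'a) \<Rightarrow> (nat \<Rightarrow> nat \<Rightarrow> 'w \<Rightarrow> real) \<Rightarrow>
     'w \<Rightarrow> nat \<Rightarrow> nat \<Rightarrow> ('s, 'a) transition" where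
  "transitions S A R w i t = (S i t w, A i t w, R i t w, S i (Suc t) w)"

text \<open>
  Trajectories and folds are numbered from \<open>0\<close>; a division of \<open>{..<n}\<close> into \<open>K\<close> disjoint nonempty
  folds is a surjection \<open>f\<close> from \<open>{..<n}\<close> onto \<open>{..<K}\<close>.
\<close>

definition fold_assignments :: "nat \<Rightarrow> nat \<Rightarrow> (nat \<Rightarrow> nat) set" where
  "fold_assignments n K = {f \<in> {..<n} \<rightarrow>\<^sub>E {..<K}. f ` {..<n} = {..<K}}"

definition in_fold :: "nat \<Rightarrow> (nat \<Rightarrow> nat) \<Rightarrow> nat \<Rightarrow> nat set" where
  "in_fold n f k = {i. i < n \<and> f i = k}"

definition out_fold :: "nat \<Rightarrow> (nat \<Rightarrow> nat) \<Rightarrow> nat \<Rightarrow> nat set" where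
  "out_fold n f k = {i. i < n \<and> f i \<noteq> k}"

definition random_division ::
  "'w measure \<Rightarrow> (nat \<Rightarrow> nat \<Rightarrow> 'w \<Rightarrow> ('s, 'a) obs) \<Rightarrow> nat \<Rightarrow> nat \<Rightarrow> ('w \<Rightarrow> nat \<Rightarrow> nat) \<Rightarrow> bool" where
  "random_division M X n K f \<longleftrightarrow>
     f \<in> measurable M (count_space (fold_assignments n K)) \<and>
     prob_space.indep_set M
       (sets (vimage_algebra (space M) f (count_space (fold_assignments n K))))
       (sets (vimage_algebra (space M) (\<lambda>w i t. X i t w)
          (PiM UNIV (\<lambda>_. PiM UNIV (\<lambda>_. obs_space)))))"

text \<open>
  An estimation procedure \<open>est\<close> for the \<open>k\<close>-th fold maps the division and the transitions of the
  trajectories outside that fold (a function that is \<open>undefined\<close> on all other indices) to an estimate.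
\<close>

definition estimator_measurable ::
  "nat \<Rightarrow> nat \<Rightarrow> nat \<Rightarrow> nat \<Rightarrow>
     ((nat \<Rightarrow> nat) \<Rightarrow> (nat \<Rightarrow> nat \<Rightarrow> ('s, 'a) transition) \<Rightarrow> real) \<Rightarrow> bool" where
  "estimator_measurable n T K k est \<longleftrightarrow>
     (\<forall>f\<in>fold_assignments n K.
        est f \<in> borel_measurable (PiM (out_fold n f k) (\<lambda>_. PiM {..<T} (\<lambda>_. transition_space))))"

definition fitted ::
  "nat \<Rightarrow> nat \<Rightarrow> nat \<Rightarrow> ((nat \<Rightarrow> nat) \<Rightarrow> (nat \<Rightarrow> nat \<Rightarrow> ('s, 'a) transition) \<Rightarrow> 'b) \<Rightarrow>
     (nat \<Rightarrow> nat) \<Rightarrow> (nat \<Rightarrow> nat \<Rightarrow> ('s, 'a) transition) \<Rightarrow> 'b" where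
  "fitted n T k est f D = est f (\<lambda>i\<in>out_fold n f k. \<lambda>t\<in>{..<T}. D i t)"

text \<open>\<open>L\<^sub>2\<close>-errors of random functions \<open>h\<close>, where \<open>h w\<close> is the estimate at the sample point \<open>w\<close>.\<close>

definition L2_error ::
  "'w measure \<Rightarrow> ('a \<times> 's) pmf \<Rightarrow> ('w \<Rightarrow> 'a \<Rightarrow> 's \<Rightarrow> real) \<Rightarrow> ('a \<Rightarrow> 's \<Rightarrow> real) \<Rightarrow> real" where
  "L2_error M pinf h g =
     sqrt (measure_pmf.expectation pinf (\<lambda>(a, s).
       integral\<^sup>L M (\<lambda>w. \<bar>h w a s - g a s\<bar>\<^sup>2)))"

definition L2_error2 ::
  "'w measure \<Rightarrow> ('a \<times> 's) pmf \<Rightarrow> ('w \<Rightarrow> 'a \<Rightarrow> 's \<Rightarrow> 'a \<Rightarrow> 's \<Rightarrow> real) \<Rightarrow>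
     ('a \<Rightarrow> 's \<Rightarrow> 'a \<Rightarrow> 's \<Rightarrow> real) \<Rightarrow> real" where
  "L2_error2 M pinf h g =
     sqrt (measure_pmf.expectation pinf (\<lambda>(a, s). measure_pmf.expectation pinf (\<lambda>(a', s').
       integral\<^sup>L M (\<lambda>w. \<bar>h w a s a' s' - g a s a' s'\<bar>\<^sup>2))))"

definition debias ::
  "real \<Rightarrow> ('s \<Rightarrow> 'a pmf) \<Rightarrow> ('a \<Rightarrow> 's \<Rightarrow> 'a \<Rightarrow> 's \<Rightarrow> real) \<Rightarrow> ('s, 'a) transition \<Rightarrow>
     ('a \<Rightarrow> 's \<Rightarrow> real) \<Rightarrow> 'a \<Rightarrow> 's \<Rightarrow> real" where
  "debias \<gamma> pol \<tau> x Q a s =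
     (case x of (S, A, R, S') \<Rightarrow>
        Q a s + 1 / (1 - \<gamma>) * \<tau> A S a s *
          (R + \<gamma> * measure_pmf.expectation (pol S') (\<lambda>a'. Q a' S') - Q A S))"

definition index_tuples :: "nat set \<Rightarrow> nat \<Rightarrow> nat \<Rightarrow> (nat \<times> nat) list set" where
  "index_tuples I T l = {xs. length xs = l \<and> distinct xs \<and> set xs \<subseteq> I \<times> {..<T}}"

text \<open>
  For \<open>m = 1\<close> the only tuple is the empty one, so that the average is \<open>Q\<close> itself. The operator
  of the first index of a tuple is the outermost one.
\<close>

definition debiased_Q ::
  "real \<Rightarrow> ('s \<Rightarrow> 'a pmf) \<Rightarrow> nat set \<Rightarrow> nat \<Rightarrow> (nat \<Rightarrow> nat \<Rightarrow> ('s, 'a) transition) \<Rightarrow>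
     ('a \<Rightarrow> 's \<Rightarrow> 'a \<Rightarrow> 's \<Rightarrow> real) \<Rightarrow> ('a \<Rightarrow> 's \<Rightarrow> real) \<Rightarrow> nat \<Rightarrow> 'a \<Rightarrow> 's \<Rightarrow> real" where
  "debiased_Q \<gamma> pol I T D \<tau> Q m a s =
     (\<Sum>xs\<in>index_tuples I T (m - 1). foldr (\<lambda>(i, t). debias \<gamma> pol \<tau> (D i t)) xs Q a s)
       / real (card (index_tuples I T (m - 1)))"

definition psi_term ::
  "real \<Rightarrow> ('s \<Rightarrow> 'a pmf) \<Rightarrow> 's pmf \<Rightarrow> ('a \<Rightarrow> 's \<Rightarrow> real) \<Rightarrow> ('a \<Rightarrow> 's \<Rightarrow> real) \<Rightarrow>
     ('s, 'a) transition \<Rightarrow> real" where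
  "psi_term \<gamma> pol G \<omega> Q x =
     (case x of (S, A, R, S') \<Rightarrow>
        1 / (1 - \<gamma>) * \<omega> A S *
          (R - Q A S + \<gamma> * measure_pmf.expectation (pol S') (\<lambda>a. Q a S'))
        + measure_pmf.expectation G (\<lambda>s. measure_pmf.expectation (pol s) (\<lambda>a. Q a s)))"

text \<open>\<open>Q k\<close>, \<open>\<tau> k\<close> and \<open>\<omega> k\<close> are the (already fitted) estimates belonging to fold \<open>k\<close>.\<close>

definition psi ::
  "real \<Rightarrow> ('s \<Rightarrow> 'a pmf) \<Rightarrow> 's pmf \<Rightarrow> nat \<Rightarrow> nat \<Rightarrow> (nat \<Rightarrow> nat) \<Rightarrow>
     (nat \<Rightarrow> nat \<Rightarrow> ('s, 'a) transition) \<Rightarrow> (nat \<Rightarrow> 'a \<Rightarrow> 's \<Rightarrow> real) \<Rightarrow>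
     (nat \<Rightarrow> 'a \<Rightarrow> 's \<Rightarrow> 'a \<Rightarrow> 's \<Rightarrow> real) \<Rightarrow> (nat \<Rightarrow> 'a \<Rightarrow> 's \<Rightarrow> real) \<Rightarrow> nat \<Rightarrow> nat \<Rightarrow> nat \<Rightarrow> real" where
  "psi \<gamma> pol G n T f D Q \<tau> \<omega> m i t =
     (let k = f i in
      psi_term \<gamma> pol G (\<omega> k) (debiased_Q \<gamma> pol (in_fold n f k) T D (\<tau> k) (Q k) m) (D i t))"

definition sample_mean :: "nat \<Rightarrow> nat \<Rightarrow> (nat \<Rightarrow> nat \<Rightarrow> real) \<Rightarrow> real" where
  "sample_mean n T x = (\<Sum>i<n. \<Sum>t<T. x i t) / real (n * T)"

definition sample_var :: "nat \<Rightarrow> nat \<Rightarrow> (nat \<Rightarrow> nat \<Rightarrow> real) \<Rightarrow> real" where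
  "sample_var n T x = (\<Sum>i<n. \<Sum>t<T. (x i t - sample_mean n T x)\<^sup>2) / (real (n * T) - 1)"

definition upper_quantile :: "real \<Rightarrow> real" where
  "upper_quantile \<alpha> = (THE z. measure std_normal_distribution {z<..} = \<alpha>)"

definition conf_interval :: "real \<Rightarrow> nat \<Rightarrow> nat \<Rightarrow> (nat \<Rightarrow> nat \<Rightarrow> real) \<Rightarrow> real set" where
  "conf_interval \<alpha> n T x =
     (let h = upper_quantile (\<alpha> / 2) * real (n * T) powr (- 1 / 2) * sqrt (sample_var n T x)
      in {sample_mean n T x - h .. sample_mean n T x + h})"

end

theory Submission
  imports Defs
begin

text \<open>
  A bounded \<open>\<tau>\<close> forces \<open>pinf\<close> to have finite support \<open>F\<close>: the ratio at \<open>(a, s, a, s)\<close> is at least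
  \<open>(1 - \<gamma>) / pmf pinf (a, s)\<close>. Hence all functions involved are vectors indexed by \<open>F\<close>, and all data
  enter through fold averages of finitely many fixed features, which deviate from their means by
  \<open>O\<^sub>p(1 / sqrt N\<^sub>k)\<close> when the fold has \<open>N\<^sub>k\<close> transitions: for the features \<open>b\<close> by \<open>\<beta>\<close>-mixing, and
  for \<open>e\<close> because temporal differences at the true \<open>Q\<close>-function are martingale differences.

  A debiasing step maps the error of a \<open>Q\<close>-estimate to an affine function of it. Replacing the
  average over tuples of distinct indices by the one over all tuples costs \<open>O(1 / N\<^sub>k)\<close> and turns
  it into an iterate of the averaged affine map, whose linear part is
  \<open>O\<^sub>p(1 / sqrt N\<^sub>k + N powr - \<alpha>2)\<close> because \<open>c * \<tau>\<close> inverts the expected temporal-difference matrix.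
  So the error of the final \<open>Q\<close>-estimate is \<open>O\<^sub>p(1 / sqrt N\<^sub>k + N powr - (\<alpha>1 + (m - 1) * \<alpha>2))\<close>, and the
  last step multiplies it by \<open>O\<^sub>p(1 / sqrt N\<^sub>k + N powr - \<alpha>3)\<close>. Weighted with \<open>N\<^sub>k / N\<close>, the estimation
  errors are \<open>o\<^sub>p(1 / sqrt N)\<close>, and only the average of the scores \<open>y\<^sub>0 = c * \<omega> * e\<close> remains. The scores
  are bounded martingale differences, so McLeish's argument and Slutsky's theorem give the claim.
\<close>

subsection \<open>Occupancy measures and the Bellman equation\<close>

text \<open>The division is random and a fold may hold very few transitions, so N_k need not be
  comparable with N. Fold errors are therefore kept at the scale 1 / sqrt N_k until they are added
  up: a product of two of them is 1 / N_k, which the weight N_k / N turns into 1 / N whatever the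
  size of the fold. The design may grow in n, in T or in both, so the limit theorem is used in a
  form that asks only for the expectation of the products of 1 + i * u * y. This expectation is 1 by
  conditioning within a trajectory and by independence between trajectories. The estimates enter as
  coefficients of the feature averages, so bounds over the finite set \<open>F\<close> take the
  place of conditioning on the training folds. The condition on m comes from a single product: after
  scaling by sqrt N, the bias of order \<alpha>1 + (m - 1) * \<alpha>2 times the error of order
  \<alpha>3 has to vanish. Every other product carries a factor 1 / sqrt N_k that pays for the
  scaling.\<close>

lemma pmf_start_law: "pmf (start_law pol \<mu>) (a, s) = pmf \<mu> s * pmf (pol s) a"
proof -
  have "pmf (map_pmf (\<lambda>b. (b, s')) (pol s')) (a, s) = indicator {s} s' * pmf (pol s) a" for s'
  proof (cases "s' = s")
    case True
    then show ?thesis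
      using pmf_map_inj'[of "\<lambda>b. (b, s)" "pol s" a] by (simp add: inj_on_def)
  next
    case False
    then show ?thesis
      by (subst pmf_map_outside) auto
  qed
  then show ?thesis
    by (simp add: start_law_def pmf_bind measure_pmf_single)
qed

lemma set_start_law: "set_pmf (start_law pol \<mu>) = {(a, s). s \<in> set_pmf \<mu> \<and> a \<in> set_pmf (pol s)}"
  by (auto simp: start_law_def)

lemma sa_law_bind: "sa_law p pol \<nu> t = bind_pmf \<nu> (\<lambda>z. sa_law p pol (return_pmf z) t)"
  by (induction t) (simp_all add: bind_return_pmf' bind_assoc_pmf)

text \<open>The recursion of \<open>sa_law\<close> appends steps at the end, whereas the Bellman
  equation splits off the first one.\<close>

lemma sa_law_Suc_start:
  "sa_law p pol (return_pmf (a, s)) (Suc t) = sa_law p pol (start_law pol (p a s)) t"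
  by (induction t) (simp_all add: bind_return_pmf)

lemma expectation_finite_support:
  fixes h :: "'b \<Rightarrow> real"
  assumes "finite F" "set_pmf \<nu> \<subseteq> F"
  shows "measure_pmf.expectation \<nu> h = (\<Sum>z\<in>F. pmf \<nu> z * h z)"
  using assms by (subst integral_measure_pmf[of F]) (auto simp: ac_simps)

locale off_policy_evaluation =
  fixes \<gamma> :: real and p :: "'a \<Rightarrow> 's \<Rightarrow> 's pmf" and r :: "'a \<Rightarrow> 's \<Rightarrow> real"
    and pol :: "'s \<Rightarrow> 'a pmf" and G :: "'s pmf" and pinf :: "('a \<times> 's) pmf" and B :: real
  assumes discount: "0 < \<gamma>" "\<gamma> < 1"
    and reward_bound: "\<bar>r a s\<bar> \<le> B"
    and omega_abs_cont: "\<forall>a s. pmf pinf (a, s) = 0 \<longrightarrow> omega_num \<gamma> p pol G a s = 0"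
    and tau_abs_cont: "\<forall>(a0, s0)\<in>set_pmf pinf. \<forall>a s.
      pmf pinf (a, s) = 0 \<longrightarrow> tau_num \<gamma> p pol a s a0 s0 = 0"
    and ratio_bound: "\<forall>(a, s)\<in>set_pmf pinf. \<bar>omega_ratio \<gamma> p pol G pinf a s\<bar> \<le> B \<and>
         (\<forall>(a', s')\<in>set_pmf pinf. \<bar>tau_ratio \<gamma> p pol pinf a s a' s'\<bar> \<le> B)"
begin

abbreviation F :: "('a \<times> 's) set" where "F \<equiv> set_pmf pinf"

abbreviation c :: real where "c \<equiv> 1 / (1 - \<gamma>)"

definition step :: "'a \<times> 's \<Rightarrow> ('a \<times> 's) pmf" where
  "step z = start_law pol (p (fst z) (snd z))"

text \<open>The discounted occupancy measure without its normalization, of total mass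
  \<open>c\<close>; as a function of the starting point it is the resolvent of the state-action
  chain under the target policy.\<close>

definition occ :: "('a \<times> 's) pmf \<Rightarrow> 'a \<times> 's \<Rightarrow> real" where
  "occ \<nu> z = (\<Sum>t. \<gamma> ^ t * pmf (sa_law p pol \<nu> t) z)"

definition \<tau> :: "'a \<times> 's \<Rightarrow> 'a \<times> 's \<Rightarrow> real" where
  "\<tau> z z0 = tau_ratio \<gamma> p pol pinf (fst z) (snd z) (fst z0) (snd z0)"

definition \<omega> :: "'a \<times> 's \<Rightarrow> real" where
  "\<omega> z = omega_ratio \<gamma> p pol G pinf (fst z) (snd z)"

definition Qpi :: "'a \<times> 's \<Rightarrow> real" where
  "Qpi z = Q_fun \<gamma> p r pol (fst z) (snd z)"

definition start :: "('a \<times> 's) pmf" where "start = start_law pol G"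

lemma discount': "0 \<le> \<gamma>" "\<bar>\<gamma>\<bar> < 1" "0 < c" "(1 - \<gamma>) * c = 1"
  using discount by (auto simp: field_simps)

lemma summable_discounted: "\<bar>u\<bar> < 1 \<Longrightarrow> (\<And>t. \<bar>h t\<bar> \<le> C) \<Longrightarrow> summable (\<lambda>t. u ^ t * h t :: real)"
proof (rule summable_comparison_test'[of "\<lambda>t. \<bar>u\<bar> ^ t * C" 0])
  assume "\<bar>u\<bar> < 1"
  then show "summable (\<lambda>t. \<bar>u\<bar> ^ t * C)"
    by (intro summable_mult2 summable_geometric) auto
next
  assume "\<And>t. \<bar>h t\<bar> \<le> C"
  then show "norm (u ^ n * h n) \<le> \<bar>u\<bar> ^ n * C" for n
    by (auto simp: abs_mult power_abs intro!: mult_left_mono)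
qed

lemma summable_occ: "summable (\<lambda>t. \<gamma> ^ t * pmf (sa_law p pol \<nu> t) z)"
  using discount' by (intro summable_discounted[of _ _ 1]) (auto simp: pmf_le_1)

lemma omega_num_occ: "omega_num \<gamma> p pol G a s = (1 - \<gamma>) * occ start (a, s)"
  by (simp add: omega_num_def occ_def start_def)

lemma tau_num_occ: "tau_num \<gamma> p pol a s a0 s0 = (1 - \<gamma>) * occ (return_pmf (a0, s0)) (a, s)"
  unfolding tau_num_def occ_def
  by (subst suminf_split_head[OF summable_occ, symmetric, simplified algebra_simps])
     (auto simp: pmf_return suminf_split_head[OF summable_occ])

lemma occ_zero: "occ \<nu> z = 0 \<Longrightarrow> pmf (sa_law p pol \<nu> t) z = 0"
  using discount suminf_eq_zero_iff[OF summable_occ[of \<nu> z]] by (simp add: occ_def)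

text \<open>Absolute continuity makes \<open>occ\<close> vanish outside \<open>F\<close>. A series
  of nonnegative terms with positive weights that sums to zero vanishes term by term, so the target
  chain started in \<open>F\<close> never leaves \<open>F\<close>.\<close>

lemma support_closed: "z0 \<in> F \<Longrightarrow> set_pmf (sa_law p pol (return_pmf z0) t) \<subseteq> F"
  using tau_abs_cont discount
  by (cases z0) (fastforce simp: tau_num_occ set_pmf_iff dest: occ_zero[where t=t])

lemma support_start: "set_pmf (sa_law p pol start t) \<subseteq> F"
  using omega_abs_cont discount
  by (fastforce simp: omega_num_occ set_pmf_iff dest: occ_zero[where t=t])

lemma set_start: "set_pmf start \<subseteq> F"
  using support_start[of 0] by simp

lemma support_step: "z \<in> F \<Longrightarrow> set_pmf (sa_law p pol (step z) t) \<subseteq> F"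
  using support_closed[of z "Suc t"] by (cases z) (simp only: sa_law_Suc_start step_def fst_conv snd_conv)

lemma set_step: "z \<in> F \<Longrightarrow> set_pmf (step z) \<subseteq> F"
  using support_step[of z 0] by simp

lemma pinf_lower: "z \<in> F \<Longrightarrow> (1 - \<gamma>) \<le> B * pmf pinf z"
proof -
  assume z: "z \<in> F"
  then obtain a s where [simp]: "z = (a, s)" by (cases z)
  \<comment> \<open>The term at time 0 alone already gives the starting point the mass 1.\<close>
  have "\<gamma> ^ 0 * pmf (sa_law p pol (return_pmf z) 0) z \<le> occ (return_pmf z) z"
    unfolding occ_def using discount
    by (intro order.trans[OF _ sum_le_suminf[OF summable_occ, of "{0}"]]) auto
  then have "1 \<le> occ (return_pmf z) z" by (simp add: pmf_return)
  then have "(1 - \<gamma>) \<le> tau_num \<gamma> p pol a s a s"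
    using discount by (simp add: tau_num_occ)
  moreover have "tau_ratio \<gamma> p pol pinf a s a s \<le> B"
    using ratio_bound z by fastforce
  moreover have "0 < pmf pinf z" using z by (simp add: pmf_positive)
  ultimately show ?thesis
    by (simp add: tau_ratio_def field_simps)
qed

lemma B_pos: "0 < B"
proof -
  obtain z where z: "z \<in> F" using set_pmf_not_empty by fastforce
  have "0 < B * pmf pinf z" using pinf_lower[OF z] discount by linarith
  then show ?thesis using pmf_nonneg[of pinf z] by (simp add: zero_less_mult_iff)
qed

lemma finite_F: "finite F"
proof (rule ccontr)
  assume "infinite F"
  obtain N :: nat where N: "B / (1 - \<gamma>) < real N" using reals_Archimedean2 by blast
  obtain H where H: "finite H" "card H = N" "H \<subseteq> F"
    using infinite_arbitrarily_large[OF \<open>infinite F\<close>] by blast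
  have "real N * ((1 - \<gamma>) / B) \<le> (\<Sum>z\<in>H. pmf pinf z)"
    using H pinf_lower B_pos
    by (subst H(2)[symmetric], intro sum_bounded_below) (auto simp: field_simps)
  also have "\<dots> \<le> 1"
    using H(1) by (simp add: measure_measure_pmf_finite[symmetric])
  finally show False using N discount B_pos by (simp add: field_simps)
qed

text \<open>Telescoping: applying \<gamma> times the kernel \<open>step\<close> to
  \<open>occ\<close> shifts the series by one and leaves all of it except the term at time 0. In
  matrix form, \<open>occ\<close> is the initial law times the inverse of I - \<gamma> P. The
  support condition ensures that sums over \<open>F\<close> are full expectations.\<close>

lemma occ_inverse:
  assumes "\<And>t. set_pmf (sa_law p pol \<nu> t) \<subseteq> F"
  shows "(\<Sum>z'\<in>F. occ \<nu> z' * (of_bool (z' = z) - \<gamma> * pmf (step z') z)) = pmf \<nu> z"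
proof -
  let ?l = "\<lambda>t. pmf (sa_law p pol \<nu> t)"
  have step: "(\<Sum>z'\<in>F. ?l t z' * pmf (step z') z) = ?l (Suc t) z" for t
    using expectation_finite_support[OF finite_F assms, of t "\<lambda>z'. pmf (step z') z"]
    by (simp add: pmf_bind step_def case_prod_unfold)
  have "(\<Sum>z'\<in>F. occ \<nu> z' * (\<gamma> * pmf (step z') z)) = (\<Sum>z'\<in>F. \<Sum>t. \<gamma> ^ Suc t * (?l t z' * pmf (step z') z))"
    unfolding occ_def
    by (intro sum.cong refl, subst suminf_mult2[OF summable_occ]) (simp add: ac_simps)
  also have "\<dots> = (\<Sum>t. \<Sum>z'\<in>F. \<gamma> ^ Suc t * (?l t z' * pmf (step z') z))"
  proof (rule suminf_sum[symmetric])
    fix z'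
    show "summable (\<lambda>t. \<gamma> ^ Suc t * (?l t z' * pmf (step z') z))"
      using summable_mult2[OF summable_mult[OF summable_occ[of \<nu> z'], of \<gamma>], of "pmf (step z') z"]
      by (simp add: ac_simps)
  qed
  also have "\<dots> = (\<Sum>t. \<gamma> ^ Suc t * ?l (Suc t) z)"
    by (simp only: sum_distrib_left[symmetric] step)
  also have "\<dots> = occ \<nu> z - pmf \<nu> z"
    unfolding occ_def using suminf_split_head[OF summable_occ[of \<nu> z]] by simp
  finally have "(\<Sum>z'\<in>F. occ \<nu> z' * (\<gamma> * pmf (step z') z)) = occ \<nu> z - pmf \<nu> z" .
  moreover have "(\<Sum>z'\<in>F. occ \<nu> z' * of_bool (z' = z)) = occ \<nu> z"
  proof (cases "z \<in> F")
    case True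
    then show ?thesis
      using finite_F by (simp add: of_bool_def if_distrib cong: if_cong)
  next
    case False
    then have "?l t z = 0" for t using assms[of t] by (auto simp: set_pmf_iff)
    then have "occ \<nu> z = 0" by (simp add: occ_def)
    then show ?thesis using False by (auto intro!: sum.neutral simp del: occ_def)
  qed
  ultimately show ?thesis
    by (simp add: right_diff_distrib sum_subtractf)
qed

text \<open>The expected temporal-difference matrix, which is the mean of the feature \<open>b\<close> below.\<close>

definition Bm :: "'a \<times> 's \<Rightarrow> 'a \<times> 's \<Rightarrow> real" where
  "Bm z' z'' = pmf pinf z' * (of_bool (z' = z'') - \<gamma> * pmf (step z') z'')"

text \<open>In \<open>c * \<tau> z' z * pmf pinf z'\<close> the normalizing constant and the
  stationary mass cancel, and the occupancy of z' from z remains. The claim is then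
  \<open>occ_inverse\<close> for the point mass at z.\<close>

lemma tau_Bm: "z \<in> F \<Longrightarrow> c * (\<Sum>z'\<in>F. \<tau> z' z * Bm z' z'') = of_bool (z = z'')"
proof -
  assume z: "z \<in> F"
  have "c * (\<tau> z' z * Bm z' z'') = occ (return_pmf z) z' * (of_bool (z' = z'') - \<gamma> * pmf (step z') z'')"
    if "z' \<in> F" for z'
    using that discount by (simp add: \<tau>_def tau_ratio_def tau_num_occ Bm_def set_pmf_iff)
  then have "c * (\<Sum>z'\<in>F. \<tau> z' z * Bm z' z'')
      = (\<Sum>z'\<in>F. occ (return_pmf z) z' * (of_bool (z' = z'') - \<gamma> * pmf (step z') z''))"
    unfolding sum_distrib_left by (intro sum.cong) auto
  also have "\<dots> = of_bool (z = z'')"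
    by (subst occ_inverse[OF support_closed[OF z]]) (auto simp: pmf_return)
  finally show ?thesis .
qed

text \<open>The same cancellation for the chain started from the reference distribution. It is the
  source of double robustness: with the true weights the error of a Q-estimate has coefficient zero
  in the mean of the final estimate.\<close>

lemma omega_Bm: "c * (\<Sum>z'\<in>F. \<omega> z' * Bm z' z'') = pmf start z''"
proof -
  have "c * (\<omega> z' * Bm z' z'') = occ start z' * (of_bool (z' = z'') - \<gamma> * pmf (step z') z'')"
    if "z' \<in> F" for z'
    using that discount by (simp add: \<omega>_def omega_ratio_def omega_num_occ Bm_def set_pmf_iff)
  then have "c * (\<Sum>z'\<in>F. \<omega> z' * Bm z' z'')
      = (\<Sum>z'\<in>F. occ start z' * (of_bool (z' = z'') - \<gamma> * pmf (step z') z''))"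
    unfolding sum_distrib_left by (intro sum.cong) auto
  also have "\<dots> = pmf start z''"
    by (rule occ_inverse[OF support_start])
  finally show ?thesis .
qed

section \<open>Discounted rewards, the Bellman equation and the policy value\<close>

lemma exp_reward_bound: "\<bar>exp_reward p r pol \<nu> t\<bar> \<le> B"
proof -
  have "\<bar>exp_reward p r pol \<nu> t\<bar> \<le> measure_pmf.expectation (sa_law p pol \<nu> t) (\<lambda>(a, s). \<bar>r a s\<bar>)"
    unfolding exp_reward_def case_prod_unfold by (rule integral_abs_bound)
  also have "\<dots> \<le> B"
    using reward_bound
    by (intro measure_pmf.integral_le_const measure_pmf.integrable_const_bound[where B=B])
       (auto simp: case_prod_unfold)
  finally show ?thesis .
qed

lemma summable_exp_reward: "summable (\<lambda>t. \<gamma> ^ t * exp_reward p r pol \<nu> t)"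
  using discount' by (intro summable_discounted[OF _ exp_reward_bound])

lemma discounted_reward_bind:
  assumes "set_pmf \<nu> \<subseteq> F"
  shows "(\<Sum>t. \<gamma> ^ t * exp_reward p r pol \<nu> t) = (\<Sum>z\<in>F. pmf \<nu> z * Qpi z)"
proof -
  have "exp_reward p r pol \<nu> t = (\<Sum>z\<in>F. pmf \<nu> z * exp_reward p r pol (return_pmf z) t)" for t
    unfolding exp_reward_def
    by (subst sa_law_bind, subst pmf_expectation_bind[OF finite_F _ assms])
       (auto intro: finite_subset[OF support_closed finite_F])
  then have "(\<Sum>t. \<gamma> ^ t * exp_reward p r pol \<nu> t)
      = (\<Sum>t. \<Sum>z\<in>F. pmf \<nu> z * (\<gamma> ^ t * exp_reward p r pol (return_pmf z) t))"
    by (simp add: sum_distrib_left ac_simps)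
  also have "\<dots> = (\<Sum>z\<in>F. \<Sum>t. pmf \<nu> z * (\<gamma> ^ t * exp_reward p r pol (return_pmf z) t))"
    by (rule suminf_sum) (intro summable_mult summable_exp_reward)
  also have "\<dots> = (\<Sum>z\<in>F. pmf \<nu> z * Qpi z)"
    by (simp add: suminf_mult[OF summable_exp_reward] Qpi_def Q_fun_def)
  finally show ?thesis .
qed

lemma Bellman:
  assumes "z \<in> F"
  shows "Qpi z = r (fst z) (snd z) + \<gamma> * (\<Sum>z'\<in>F. pmf (step z) z' * Qpi z')"
proof -
  obtain a s where [simp]: "z = (a, s)" by (cases z)
  have "exp_reward p r pol (return_pmf z) (Suc t) = exp_reward p r pol (step z) t" for t
    by (simp only: exp_reward_def sa_law_Suc_start step_def \<open>z = (a, s)\<close> fst_conv snd_conv)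
  then have "Qpi z = exp_reward p r pol (return_pmf z) 0 + (\<Sum>t. \<gamma> * (\<gamma> ^ t * exp_reward p r pol (step z) t))"
    using suminf_split_head[OF summable_exp_reward[of "return_pmf z"]]
    by (simp add: Qpi_def Q_fun_def ac_simps)
  also have "\<dots> = r a s + \<gamma> * (\<Sum>t. \<gamma> ^ t * exp_reward p r pol (step z) t)"
    by (simp only: suminf_mult[OF summable_exp_reward]) (simp add: exp_reward_def)
  also have "(\<Sum>t. \<gamma> ^ t * exp_reward p r pol (step z) t) = (\<Sum>z'\<in>F. pmf (step z) z' * Qpi z')"
    using assms by (intro discounted_reward_bind set_step) simp
  finally show ?thesis by simp
qed

lemma Qpi_bound: "\<bar>Qpi z\<bar> \<le> c * B"
proof -
  let ?f = "\<lambda>t. \<gamma> ^ t * exp_reward p r pol (return_pmf (fst z, snd z)) t"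
  have le: "norm (?f t) \<le> \<gamma> ^ t * B" for t
    using exp_reward_bound discount' by (auto simp: abs_mult intro!: mult_mono)
  have sB: "summable (\<lambda>t. \<gamma> ^ t * B)"
    using discount' by (intro summable_mult2 summable_geometric) auto
  have sn: "summable (\<lambda>t. norm (?f t))"
    using le by (intro summable_comparison_test'[OF sB]) auto
  have "\<bar>Qpi z\<bar> \<le> (\<Sum>t. norm (?f t))"
    using summable_norm[OF sn] by (simp add: Qpi_def Q_fun_def)
  also have "\<dots> \<le> (\<Sum>t. \<gamma> ^ t * B)"
    by (intro suminf_le le sn sB)
  also have "\<dots> = c * B"
    using discount' by (subst suminf_mult2[symmetric]) (auto simp: suminf_geometric)
  finally show ?thesis .
qed

text \<open>Nested expectations over a state and a policy action are turned into finite sums over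
  \<open>F\<close>, the form in which Q-functions act as vectors. It serves the reference
  distribution as well as the point mass at an observed next state.\<close>

lemma expectation_policy:
  assumes "\<And>s a. s \<in> set_pmf \<mu> \<Longrightarrow> a \<in> set_pmf (pol s) \<Longrightarrow> (a, s) \<in> F"
  shows "measure_pmf.expectation \<mu> (\<lambda>s. measure_pmf.expectation (pol s) (\<lambda>a. h a s))
     = (\<Sum>z\<in>F. pmf (start_law pol \<mu>) z * h (fst z) (snd z) :: real)"
proof -
  have [simp]: "finite F" by (rule finite_F)
  have one: "measure_pmf.expectation (pol s) (\<lambda>a. h a s)
      = (\<Sum>z\<in>F. of_bool (snd z = s) * pmf (pol s) (fst z) * h (fst z) (snd z))" if "s \<in> set_pmf \<mu>" for s
  proof -
    have "measure_pmf.expectation (pol s) (\<lambda>a. h a s)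
       = measure_pmf.expectation (map_pmf (\<lambda>a. (a, s)) (pol s)) (\<lambda>z. h (fst z) (snd z))"
      by simp
    also have "\<dots> = (\<Sum>z\<in>F. pmf (map_pmf (\<lambda>a. (a, s)) (pol s)) z * h (fst z) (snd z))"
      using assms that by (intro expectation_finite_support) auto
    also have "map_pmf (\<lambda>a. (a, s)) (pol s) = start_law pol (return_pmf s)"
      by (simp add: start_law_def bind_return_pmf)
    finally show ?thesis
      by (auto simp: pmf_start_law intro!: sum.cong)
  qed
  have sub: "set_pmf \<mu> \<subseteq> snd ` F"
  proof
    fix s assume "s \<in> set_pmf \<mu>"
    moreover obtain a where "a \<in> set_pmf (pol s)" using set_pmf_not_empty by fastforce
    ultimately show "s \<in> snd ` F" using assms by force
  qed
  have "measure_pmf.expectation \<mu> (\<lambda>s. measure_pmf.expectation (pol s) (\<lambda>a. h a s))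
    = measure_pmf.expectation \<mu> (\<lambda>s. \<Sum>z\<in>F. of_bool (snd z = s) * pmf (pol s) (fst z) * h (fst z) (snd z))"
    by (intro integral_cong_AE) (auto simp: AE_measure_pmf_iff one)
  also have "\<dots> = (\<Sum>s\<in>snd ` F. pmf \<mu> s * (\<Sum>z\<in>F. of_bool (snd z = s) * pmf (pol s) (fst z) * h (fst z) (snd z)))"
    by (intro expectation_finite_support sub) simp
  also have "\<dots> = (\<Sum>z\<in>F. \<Sum>s\<in>snd ` F. of_bool (snd z = s) * (pmf \<mu> s * pmf (pol s) (fst z) * h (fst z) (snd z)))"
    unfolding sum_distrib_left by (subst sum.swap) (simp add: ac_simps)
  also have "\<dots> = (\<Sum>z\<in>F. pmf \<mu> (snd z) * pmf (pol (snd z)) (fst z) * h (fst z) (snd z))"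
    by (intro sum.cong refl) (simp add: of_bool_def if_distrib[of "\<lambda>x. x * _"] cong: if_cong)
  also have "\<dots> = (\<Sum>z\<in>F. pmf (start_law pol \<mu>) z * h (fst z) (snd z))"
    by (intro sum.cong refl) (auto simp: pmf_start_law)
  finally show ?thesis .
qed

lemma policy_value_eq: "policy_value \<gamma> p r pol G = (\<Sum>z\<in>F. pmf start z * Qpi z)"
proof -
  have V: "V_fun \<gamma> p r pol s = measure_pmf.expectation (pol s) (\<lambda>a. Q_fun \<gamma> p r pol a s)"
    if "s \<in> set_pmf G" for s
  proof -
    have s: "set_pmf (start_law pol (return_pmf s)) \<subseteq> F"
      using set_start that by (auto simp: start_def set_start_law)
    have "V_fun \<gamma> p r pol s = (\<Sum>z\<in>F. pmf (start_law pol (return_pmf s)) z * Qpi z)"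
      unfolding V_fun_def by (rule discounted_reward_bind[OF s])
    also have "\<dots> = measure_pmf.expectation (return_pmf s) (\<lambda>s. measure_pmf.expectation (pol s) (\<lambda>a. Q_fun \<gamma> p r pol a s))"
      unfolding Qpi_def using s by (subst expectation_policy) (auto simp: set_start_law)
    finally show ?thesis by simp
  qed
  have "policy_value \<gamma> p r pol G
     = measure_pmf.expectation G (\<lambda>s. measure_pmf.expectation (pol s) (\<lambda>a. Q_fun \<gamma> p r pol a s))"
    unfolding policy_value_def by (intro integral_cong_AE) (auto simp: AE_measure_pmf_iff V)
  also have "\<dots> = (\<Sum>z\<in>F. pmf start z * Qpi z)"
    unfolding start_def Qpi_def using set_start
    by (intro expectation_policy) (auto simp: start_def set_start_law)
  finally show ?thesis .
qed

end

subsection \<open>Averages over tuples of affine error maps\<close>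

text \<open>A birthday bound. One more entry multiplies the number of distinct tuples by N - l, and
  the increase from l^2 to (l + 1)^2 exceeds the loss l.\<close>

lemma card_distinct_lists_ge:
  fixes A :: "'b set"
  assumes "finite A" "A \<noteq> {}" "l \<le> card A"
  shows "(1 - (real l)\<^sup>2 / real (card A)) * real (card A) ^ l
    \<le> real (card {xs. length xs = l \<and> distinct xs \<and> set xs \<subseteq> A})"
  using assms(3)
proof (induction l)
  case 0
  have "{xs. length xs = 0 \<and> distinct xs \<and> set xs \<subseteq> A} = {[]}" by auto
  then show ?case by simp
next
  case (Suc l)
  let ?N = "card A" and ?D = "\<lambda>l. {xs. length xs = l \<and> distinct xs \<and> set xs \<subseteq> A}"
  have N: "0 < real ?N" using assms by (simp add: card_gt_0_iff)
  have "card (?D (Suc l)) = (?N - l) * card (?D l)"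
    using Suc.prems assms(1)
    by (simp add: card_lists_distinct_length_eq prod.atLeast_Suc_atMost Suc_diff_Suc)
  then have card: "real (card (?D (Suc l))) = (real ?N - real l) * real (card (?D l))"
    using Suc.prems by (simp add: of_nat_diff)
  have "(1 - (real (Suc l))\<^sup>2 / real ?N) * real ?N ^ Suc l
     = (real ?N - (real (Suc l))\<^sup>2) * real ?N ^ l"
    using N by (simp add: field_simps)
  also have "\<dots> \<le> ((real ?N - real l) * (1 - (real l)\<^sup>2 / real ?N)) * real ?N ^ l"
  proof (rule mult_right_mono)
    define y where "y = (real l)\<^sup>2 / real ?N"
    have "real ?N * y = (real l)\<^sup>2" "0 \<le> real l * y" using N by (auto simp: y_def)
    then show "real ?N - (real (Suc l))\<^sup>2 \<le> (real ?N - real l) * (1 - (real l)\<^sup>2 / real ?N)"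
      unfolding y_def[symmetric] by (simp add: power2_eq_square algebra_simps)
  qed simp
  also have "\<dots> = (real ?N - real l) * ((1 - (real l)\<^sup>2 / real ?N) * real ?N ^ l)"
    by simp
  also have "\<dots> \<le> (real ?N - real l) * real (card (?D l))"
    using Suc by (intro mult_left_mono) auto
  finally show ?case unfolding card .
qed

text \<open>Leaving out A - D and changing the normalization each cost H * (1 - d / a), whence the
  factor 2.\<close>

lemma average_subset:
  fixes h :: "'b \<Rightarrow> real"
  assumes "finite A" "D \<subseteq> A" "D \<noteq> {}" "\<And>x. x \<in> A \<Longrightarrow> \<bar>h x\<bar> \<le> H"
  shows "\<bar>sum h D / real (card D) - sum h A / real (card A)\<bar> \<le> 2 * H * (1 - real (card D) / real (card A))"
proof -
  have fD: "finite D" using assms finite_subset by blast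
  define d a where "d = real (card D)" and "a = real (card A)"
  have d: "0 < d" using fD assms by (simp add: d_def card_gt_0_iff)
  have da: "d \<le> a" using assms by (simp add: d_def a_def card_mono)
  have 1: "\<bar>sum h D\<bar> \<le> d * H"
    using sum_bounded_above[of D "\<lambda>x. \<bar>h x\<bar>" H] assms
    by (auto simp: d_def intro: order.trans[OF sum_abs])
  have "\<bar>sum h (A - D)\<bar> \<le> real (card (A - D)) * H"
    using sum_bounded_above[of "A - D" "\<lambda>x. \<bar>h x\<bar>" H] assms
    by (auto intro: order.trans[OF sum_abs])
  also have "real (card (A - D)) = a - d"
    using assms fD by (simp add: card_Diff_subset d_def a_def card_mono of_nat_diff)
  finally have 2: "\<bar>sum h (A - D)\<bar> \<le> (a - d) * H" .
  have "sum h A = sum h (A - D) + sum h D"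
    using assms by (intro sum.subset_diff) auto
  then have eq: "sum h D / d - sum h A / a = sum h D * (1 / d - 1 / a) - sum h (A - D) / a"
    by (simp add: field_simps add_divide_distrib)
  have "\<bar>sum h D * (1 / d - 1 / a)\<bar> \<le> d * H * (1 / d - 1 / a)"
    using 1 d da by (auto simp: abs_mult frac_le intro!: mult_mono)
  moreover have "\<bar>sum h (A - D) / a\<bar> \<le> (a - d) * H / a"
    using 2 d da by (auto simp: divide_right_mono)
  ultimately have "\<bar>sum h D / d - sum h A / a\<bar> \<le> d * H * (1 / d - 1 / a) + (a - d) * H / a"
    unfolding eq by linarith
  also have "\<dots> = 2 * H * (1 - d / a)"
    using d da by (simp add: field_simps)
  finally show ?thesis by (simp add: d_def a_def)
qed

lemma average_distinct_lists:
  fixes h :: "'b list \<Rightarrow> real"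
  assumes "finite A" "A \<noteq> {}" "l \<le> card A"
    and H: "\<And>xs. length xs = l \<Longrightarrow> set xs \<subseteq> A \<Longrightarrow> \<bar>h xs\<bar> \<le> H"
  defines "D \<equiv> {xs. length xs = l \<and> distinct xs \<and> set xs \<subseteq> A}"
  shows "\<bar>sum h D / real (card D) - sum h {xs. set xs \<subseteq> A \<and> length xs = l} / real (card A) ^ l\<bar>
      \<le> 2 * H * (real l)\<^sup>2 / real (card A)"
proof -
  let ?A = "{xs. set xs \<subseteq> A \<and> length xs = l}"
  have cA: "card ?A = card A ^ l" using assms by (simp add: card_lists_length_eq)
  have fA: "finite ?A" using assms by (simp add: finite_lists_length_eq)
  obtain ys where ys: "set ys = A" "distinct ys" using finite_distinct_list[OF assms(1)] by blast
  have "take l ys \<in> D"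
    using ys assms(3) by (auto simp: D_def distinct_card[symmetric] dest: in_set_takeD)
  then have D: "D \<noteq> {}" by blast
  have H0: "0 \<le> H" using H[of "take l ys"] \<open>take l ys \<in> D\<close> by (auto simp: D_def)
  have N: "0 < real (card A) ^ l" using assms by (simp add: card_gt_0_iff)
  have "\<bar>sum h D / real (card D) - sum h ?A / real (card ?A)\<bar> \<le> 2 * H * (1 - real (card D) / real (card ?A))"
    using fA D H by (intro average_subset) (auto simp: D_def)
  also have "\<dots> \<le> 2 * H * ((real l)\<^sup>2 / real (card A))"
    using card_distinct_lists_ge[OF assms(1-3)] N H0
    by (intro mult_left_mono) (auto simp: cA D_def field_simps)
  finally show ?thesis by (simp add: cA)
qed

text \<open>
  One debiasing step acts on the error \<open>g\<close> of a \<open>Q\<close>-estimate as an affine map; \<open>b\<close> and \<open>e\<close>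
  are features of the transition.
\<close>

definition err_step :: "real \<Rightarrow> 'z set \<Rightarrow> ('z \<Rightarrow> 'z \<Rightarrow> real) \<Rightarrow> ('z \<Rightarrow> 'z \<Rightarrow> real) \<Rightarrow> ('z \<Rightarrow> real) \<Rightarrow>
    ('z \<Rightarrow> real) \<Rightarrow> 'z \<Rightarrow> real" where
  "err_step c F \<tau> b e g z = g z + c * (\<Sum>z'\<in>F. \<tau> z' z * (e z' - (\<Sum>z''\<in>F. b z' z'' * g z'')))"

text \<open>For fixed features a step is affine in the error it acts on, so it commutes with
  averages of errors.\<close>

lemma err_step_average_error:
  assumes "finite X" "X \<noteq> {}"
  shows "(\<Sum>x\<in>X. err_step c F \<tau> b e (h x) z) / real (card X)
     = err_step c F \<tau> b e (\<lambda>z. (\<Sum>x\<in>X. h x z) / real (card X)) z"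
proof -
  define N where "N = real (card X)"
  have N: "N \<noteq> 0" "(\<Sum>x\<in>X. u) = N * u" for u
    using assms by (auto simp: N_def)
  have swap: "(\<Sum>x\<in>X. \<Sum>z''\<in>F. b z' z'' * h x z'') = (\<Sum>z''\<in>F. b z' z'' * (\<Sum>x\<in>X. h x z''))" for z'
    by (subst sum.swap) (simp add: sum_distrib_left)
  have "(\<Sum>x\<in>X. err_step c F \<tau> b e (h x) z)
     = (\<Sum>x\<in>X. h x z) + c * (\<Sum>z'\<in>F. \<tau> z' z * (N * e z' - (\<Sum>z''\<in>F. b z' z'' * (\<Sum>x\<in>X. h x z''))))"
    unfolding err_step_def sum.distrib sum_distrib_left[symmetric]
    by (subst sum.swap) (simp only: sum_distrib_left[symmetric] sum_subtractf N swap)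
  also have "\<dots> = N * err_step c F \<tau> b e (\<lambda>z. (\<Sum>x\<in>X. h x z) / N) z"
  proof -
    have "\<tau> z' z * (e z' - (\<Sum>z''\<in>F. b z' z'' * ((\<Sum>x\<in>X. h x z'') / N)))
       = (\<tau> z' z * (N * e z' - (\<Sum>z''\<in>F. b z' z'' * (\<Sum>x\<in>X. h x z'')))) / N" for z'
      using N(1) by (simp add: sum_divide_distrib[symmetric] diff_divide_distrib right_diff_distrib)
    then show ?thesis
      unfolding err_step_def using N(1) by (simp add: sum_divide_distrib[symmetric] distrib_left)
  qed
  finally show ?thesis using N by (simp add: N_def)
qed

text \<open>For a fixed error the step is affine in the pair of features jointly.\<close>

lemma err_step_average_features:
  assumes "finite X" "X \<noteq> {}"
  shows "(\<Sum>x\<in>X. err_step c F \<tau> (b x) (e x) g z) / real (card X)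
     = err_step c F \<tau> (\<lambda>z' z''. (\<Sum>x\<in>X. b x z' z'') / real (card X)) (\<lambda>z'. (\<Sum>x\<in>X. e x z') / real (card X)) g z"
proof -
  define N where "N = real (card X)"
  have N: "N \<noteq> 0" "(\<Sum>x\<in>X. u) = N * u" for u
    using assms by (auto simp: N_def)
  have swap: "(\<Sum>x\<in>X. \<Sum>z''\<in>F. b x z' z'' * g z'') = (\<Sum>z''\<in>F. (\<Sum>x\<in>X. b x z' z'') * g z'')" for z'
    by (subst sum.swap) (simp add: sum_distrib_right)
  have "(\<Sum>x\<in>X. err_step c F \<tau> (b x) (e x) g z)
     = N * g z + c * (\<Sum>z'\<in>F. \<tau> z' z * ((\<Sum>x\<in>X. e x z') - (\<Sum>z''\<in>F. (\<Sum>x\<in>X. b x z' z'') * g z'')))"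
    unfolding err_step_def sum.distrib sum_distrib_left[symmetric]
    by (subst sum.swap) (simp only: sum_distrib_left[symmetric] sum_subtractf N swap)
  also have "\<dots> = N * err_step c F \<tau> (\<lambda>z' z''. (\<Sum>x\<in>X. b x z' z'') / N) (\<lambda>z'. (\<Sum>x\<in>X. e x z') / N) g z"
  proof -
    have "\<tau> z' z * ((\<Sum>x\<in>X. e x z') / N - (\<Sum>z''\<in>F. (\<Sum>x\<in>X. b x z' z'') / N * g z''))
       = (\<tau> z' z * ((\<Sum>x\<in>X. e x z') - (\<Sum>z''\<in>F. (\<Sum>x\<in>X. b x z' z'') * g z''))) / N" for z'
      using N(1) by (simp add: sum_divide_distrib[symmetric] diff_divide_distrib right_diff_distrib)
    then show ?thesis
      unfolding err_step_def using N(1) by (simp add: sum_divide_distrib[symmetric] distrib_left)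
  qed
  finally show ?thesis using N by (simp add: N_def)
qed

text \<open>With repetitions allowed, the outermost entry ranges over X independently of the others.
  The average over the other entries passes through the outermost step, and the average over the
  outermost entry then averages its features. For distinct entries this factorization fails, which
  is why the two averages are compared first.\<close>

lemma average_all_lists:
  assumes "finite X" "X \<noteq> {}"
  shows "(\<Sum>xs | set xs \<subseteq> X \<and> length xs = l. foldr (\<lambda>x. err_step c F \<tau> (b x) (e x)) xs g z) / real (card X) ^ l
     = (err_step c F \<tau> (\<lambda>z' z''. (\<Sum>x\<in>X. b x z' z'') / real (card X))
          (\<lambda>z'. (\<Sum>x\<in>X. e x z') / real (card X)) ^^ l) g z"
proof (induction l arbitrary: z)
  case 0
  have "{xs. set xs \<subseteq> X \<and> length xs = 0} = {[]}" by auto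
  then show ?case by simp
next
  case (Suc l)
  let ?L = "{xs. set xs \<subseteq> X \<and> length xs = l}"
  let ?f = "\<lambda>xs. foldr (\<lambda>x. err_step c F \<tau> (b x) (e x)) xs g"
  let ?E = "err_step c F \<tau> (\<lambda>z' z''. (\<Sum>x\<in>X. b x z' z'') / real (card X)) (\<lambda>z'. (\<Sum>x\<in>X. e x z') / real (card X))"
  have fL: "finite ?L" and cL: "card ?L = card X ^ l"
    using assms by (auto simp: finite_lists_length_eq card_lists_length_eq)
  have L: "?L \<noteq> {}"
    using cL fL assms by (metis card.empty card_gt_0_iff power_eq_0_iff less_irrefl)
  have "(\<Sum>xs | set xs \<subseteq> X \<and> length xs = Suc l. ?f xs z)
    = (\<Sum>(xs, x)\<in>?L \<times> X. err_step c F \<tau> (b x) (e x) (?f xs) z)"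
    unfolding lists_length_Suc_eq
    by (subst sum.reindex) (auto simp: inj_on_def case_prod_unfold)
  also have "\<dots> = (\<Sum>x\<in>X. \<Sum>xs\<in>?L. err_step c F \<tau> (b x) (e x) (?f xs) z)"
    by (simp add: sum.cartesian_product[symmetric] sum.swap[of _ ?L X])
  finally have "(\<Sum>xs | set xs \<subseteq> X \<and> length xs = Suc l. ?f xs z) / real (card X) ^ Suc l
    = (\<Sum>x\<in>X. (\<Sum>xs\<in>?L. err_step c F \<tau> (b x) (e x) (?f xs) z) / real (card ?L)) / real (card X)"
    by (simp add: cL sum_divide_distrib[symmetric])
  also have "\<dots> = (\<Sum>x\<in>X. err_step c F \<tau> (b x) (e x) ((?E ^^ l) g) z) / real (card X)"
    unfolding err_step_average_error[OF fL L] Suc.IH[symmetric] by (simp add: cL)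
  also have "\<dots> = ?E ((?E ^^ l) g) z"
    by (rule err_step_average_features[OF assms])
  finally show ?case by simp
qed

lemma abs_sum_le:
  fixes k :: "'b \<Rightarrow> real"
  assumes "\<And>x. x \<in> F \<Longrightarrow> \<bar>k x\<bar> \<le> v"
  shows "\<bar>\<Sum>x\<in>F. k x\<bar> \<le> real (card F) * v"
  using sum_bounded_above[of F "\<lambda>x. \<bar>k x\<bar>" v] assms by (auto intro: order.trans[OF sum_abs])

section \<open>Deterministic bounds for iterated debiasing steps\<close>

lemma err_step_bound:
  assumes "finite F" "0 \<le> c" "0 \<le> C" "0 \<le> u"
    and "\<And>z z'. z \<in> F \<Longrightarrow> z' \<in> F \<Longrightarrow> \<bar>\<tau> z z'\<bar> \<le> C" "\<And>z z'. z \<in> F \<Longrightarrow> z' \<in> F \<Longrightarrow> \<bar>b z z'\<bar> \<le> C"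
    and "\<And>z. z \<in> F \<Longrightarrow> \<bar>e z\<bar> \<le> C" "\<And>z. z \<in> F \<Longrightarrow> \<bar>g z\<bar> \<le> u" "z \<in> F"
  shows "\<bar>err_step c F \<tau> b e g z\<bar> \<le> u + c * (real (card F) * (C * (C + real (card F) * (C * u))))"
proof -
  have bg: "\<bar>\<Sum>z''\<in>F. b z' z'' * g z''\<bar> \<le> real (card F) * (C * u)" if "z' \<in> F" for z'
    using assms that by (intro abs_sum_le) (auto simp: abs_mult intro!: mult_mono)
  have "\<bar>e z' - (\<Sum>z''\<in>F. b z' z'' * g z'')\<bar> \<le> C + real (card F) * (C * u)" if "z' \<in> F" for z'
    using bg[OF that] assms(7)[OF that] by linarith
  then have "\<bar>\<Sum>z'\<in>F. \<tau> z' z * (e z' - (\<Sum>z''\<in>F. b z' z'' * g z''))\<bar>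
      \<le> real (card F) * (C * (C + real (card F) * (C * u)))"
    using assms by (intro abs_sum_le) (auto simp: abs_mult intro!: mult_mono)
  then have "\<bar>c * (\<Sum>z'\<in>F. \<tau> z' z * (e z' - (\<Sum>z''\<in>F. b z' z'' * g z'')))\<bar>
      \<le> c * (real (card F) * (C * (C + real (card F) * (C * u))))"
    using assms(2) by (simp add: abs_mult mult_left_mono)
  then show ?thesis
    unfolding err_step_def using assms(8,9) by (meson abs_triangle_ineq add_mono order.trans)
qed

text \<open>A crude size of l steps, with d standing for \<open>card F\<close>, that uses no
  cancellation. It only has to multiply the cost O(1 / N) of replacing distinct tuples by all
  tuples.\<close>

definition step_bound :: "real \<Rightarrow> real \<Rightarrow> real \<Rightarrow> nat \<Rightarrow> real" where
  "step_bound c d C l = ((\<lambda>u. u + c * (d * (C * (C + d * (C * u))))) ^^ l) C"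

lemma step_bound_nonneg: "0 \<le> c \<Longrightarrow> 0 \<le> C \<Longrightarrow> 0 \<le> d \<Longrightarrow> 0 \<le> step_bound c d C l"
  by (induction l) (auto simp: step_bound_def)

lemma foldr_err_step_bound:
  assumes "finite F" "0 \<le> c" "0 \<le> C"
    and "\<And>z z'. z \<in> F \<Longrightarrow> z' \<in> F \<Longrightarrow> \<bar>\<tau> z z'\<bar> \<le> C"
    and "\<And>x z z'. x \<in> X \<Longrightarrow> z \<in> F \<Longrightarrow> z' \<in> F \<Longrightarrow> \<bar>b x z z'\<bar> \<le> C"
    and "\<And>x z. x \<in> X \<Longrightarrow> z \<in> F \<Longrightarrow> \<bar>e x z\<bar> \<le> C"
    and "\<And>z. z \<in> F \<Longrightarrow> \<bar>g z\<bar> \<le> C" "z \<in> F" "set xs \<subseteq> X"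
  shows "\<bar>foldr (\<lambda>x. err_step c F \<tau> (b x) (e x)) xs g z\<bar> \<le> step_bound c (real (card F)) C (length xs)"
  using assms(8,9)
proof (induction xs arbitrary: z)
  case Nil
  then show ?case using assms(7) by (simp add: step_bound_def)
next
  case (Cons x xs)
  have "\<bar>err_step c F \<tau> (b x) (e x) (foldr (\<lambda>x. err_step c F \<tau> (b x) (e x)) xs g) z\<bar>
     \<le> step_bound c (real (card F)) C (length xs) +
       c * (real (card F) * (C * (C + real (card F) * (C * step_bound c (real (card F)) C (length xs)))))"
    using Cons assms by (intro err_step_bound) (auto intro!: step_bound_nonneg)
  then show ?case by (simp add: step_bound_def)
qed

lemma product_perturbation:
  fixes x y u v :: real
  assumes "\<bar>u - x\<bar> \<le> C * t" "\<bar>v - y\<bar> \<le> C * a" "\<bar>y\<bar> \<le> C" "\<bar>u\<bar> \<le> C" "0 \<le> C"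
  shows "\<bar>x * y - u * v\<bar> \<le> C * C * (a + t)"
proof -
  have "x * y - u * v = - ((u - x) * y) - u * (v - y)" by (simp add: algebra_simps)
  moreover have "\<bar>(u - x) * y\<bar> \<le> (C * t) * C" "\<bar>u * (v - y)\<bar> \<le> C * (C * a)"
    using assms order.trans[OF abs_ge_zero assms(1)] by (auto simp only: abs_mult intro!: mult_mono)
  ultimately show ?thesis by (simp add: algebra_simps)
qed

text \<open>Since c times the true ratio inverts \<open>b0\<close>, the incoming error g can itself
  be written as c times the sum of \<open>\<tau>0 * b0 * g\<close>. The step becomes c times the sum
  of \<open>(\<tau>0 * b0 - \<tau> * b) * g\<close> plus the contribution of e, and the bracket is
  of the size of the two estimation errors a and t.\<close>

lemma err_step_contraction:
  assumes "finite F" "0 \<le> c" "0 \<le> C"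
    and inv: "\<And>z z''. z \<in> F \<Longrightarrow> c * (\<Sum>z'\<in>F. \<tau>0 z' z * b0 z' z'') = of_bool (z = z'')"
    and "\<And>z z'. z \<in> F \<Longrightarrow> z' \<in> F \<Longrightarrow> \<bar>\<tau> z z'\<bar> \<le> C" "\<And>z z'. z \<in> F \<Longrightarrow> z' \<in> F \<Longrightarrow> \<bar>b0 z z'\<bar> \<le> C"
    and "\<And>z z'. z \<in> F \<Longrightarrow> z' \<in> F \<Longrightarrow> \<bar>\<tau> z z' - \<tau>0 z z'\<bar> \<le> C * t"
    and "\<And>z z'. z \<in> F \<Longrightarrow> z' \<in> F \<Longrightarrow> \<bar>b z z' - b0 z z'\<bar> \<le> C * a"
    and "\<And>z. z \<in> F \<Longrightarrow> \<bar>e z\<bar> \<le> C * a" "\<And>z. z \<in> F \<Longrightarrow> \<bar>g z\<bar> \<le> u" "z \<in> F"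
  shows "\<bar>err_step c F \<tau> b e g z\<bar>
    \<le> c * (real (card F) * (real (card F) * (C * C))) * ((a + t) * u) + c * (real (card F) * (C * C)) * a"
proof -
  let ?d = "real (card F)"
  have "g z = (\<Sum>z''\<in>F. c * (\<Sum>z'\<in>F. \<tau>0 z' z * b0 z' z'') * g z'')"
    using assms(1,11) by (subst sum.cong[OF refl, OF arg_cong2[where f="(*)", OF inv refl]])
      (auto simp: of_bool_def if_distrib[of "\<lambda>x. x * _"] cong: if_cong)
  also have "\<dots> = c * (\<Sum>z'\<in>F. \<Sum>z''\<in>F. \<tau>0 z' z * b0 z' z'' * g z'')"
    by (subst sum.swap) (simp add: sum_distrib_left sum_distrib_right ac_simps)
  finally have g: "g z = c * (\<Sum>z'\<in>F. \<Sum>z''\<in>F. \<tau>0 z' z * b0 z' z'' * g z'')" .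
  have "err_step c F \<tau> b e g z = c * (\<Sum>z'\<in>F. \<Sum>z''\<in>F. (\<tau>0 z' z * b0 z' z'' - \<tau> z' z * b z' z'') * g z'')
     + c * (\<Sum>z'\<in>F. \<tau> z' z * e z')"
    unfolding err_step_def
    by (subst g) (simp add: left_diff_distrib right_diff_distrib sum_subtractf sum_distrib_left ac_simps)
  also have "\<bar>\<dots>\<bar> \<le> c * (?d * (?d * (C * C * (a + t) * u))) + c * (?d * (C * (C * a)))"
  proof -
    have "\<bar>\<tau>0 z' z * b0 z' z'' - \<tau> z' z * b z' z''\<bar> \<le> C * C * (a + t)" if "z' \<in> F" "z'' \<in> F" for z' z''
      using that assms by (intro product_perturbation) auto
    moreover from this[OF \<open>z \<in> F\<close> \<open>z \<in> F\<close>] have "0 \<le> C * C * (a + t)" by linarith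
    ultimately have "\<bar>\<Sum>z'\<in>F. \<Sum>z''\<in>F. (\<tau>0 z' z * b0 z' z'' - \<tau> z' z * b z' z'') * g z''\<bar>
        \<le> ?d * (?d * (C * C * (a + t) * u))"
      using assms(10) by (intro abs_sum_le) (auto simp only: abs_mult intro!: mult_mono)
    moreover have "\<bar>\<Sum>z'\<in>F. \<tau> z' z * e z'\<bar> \<le> ?d * (C * (C * a))"
      using assms by (intro abs_sum_le) (auto simp: abs_mult intro!: mult_mono)
    ultimately show ?thesis
      using assms(2) by (intro order.trans[OF abs_triangle_ineq] add_mono) (auto simp: abs_mult mult_left_mono)
  qed
  finally show ?thesis by (simp add: ac_simps)
qed

text \<open>The constants of the recursion in \<open>err_step_iterate\<close>. The 3 counts the
  products a * a, a * q * t^l and t * a in (a + t) * (a + q * t^l), each at most a.\<close>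

primrec iterate_bound :: "real \<Rightarrow> real \<Rightarrow> real \<Rightarrow> nat \<Rightarrow> real" where
  "iterate_bound c d C 0 = C"
| "iterate_bound c d C (Suc l) = 3 * (c * (d * (d * (C * C)))) * iterate_bound c d C l + c * (d * (C * C))"

lemma iterate_bound_nonneg: "0 \<le> c \<Longrightarrow> 0 \<le> C \<Longrightarrow> 0 \<le> d \<Longrightarrow> 0 \<le> iterate_bound c d C l"
  by (induction l) auto

text \<open>Every step multiplies the initial error by t up to constants, but it creates noise of
  size a afresh. Hence q * t^l keeps decreasing with l while a stays.\<close>

lemma err_step_iterate:
  assumes "finite F" "0 \<le> c" "0 \<le> C"
    and inv: "\<And>z z''. z \<in> F \<Longrightarrow> c * (\<Sum>z'\<in>F. \<tau>0 z' z * b0 z' z'') = of_bool (z = z'')"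
    and "\<And>z z'. z \<in> F \<Longrightarrow> z' \<in> F \<Longrightarrow> \<bar>\<tau> z z'\<bar> \<le> C" "\<And>z z'. z \<in> F \<Longrightarrow> z' \<in> F \<Longrightarrow> \<bar>b0 z z'\<bar> \<le> C"
    and "\<And>z z'. z \<in> F \<Longrightarrow> z' \<in> F \<Longrightarrow> \<bar>\<tau> z z' - \<tau>0 z z'\<bar> \<le> C * t"
    and "\<And>z z'. z \<in> F \<Longrightarrow> z' \<in> F \<Longrightarrow> \<bar>b z z' - b0 z z'\<bar> \<le> C * a"
    and "\<And>z. z \<in> F \<Longrightarrow> \<bar>e z\<bar> \<le> C * a" "\<And>z. z \<in> F \<Longrightarrow> \<bar>g z\<bar> \<le> C * q" "z \<in> F"
    and a: "0 \<le> a" "a \<le> 1" and t: "0 \<le> t" "t \<le> 1" and q: "0 \<le> q" "q \<le> 1"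
  shows "\<bar>(err_step c F \<tau> b e ^^ l) g z\<bar> \<le> iterate_bound c (real (card F)) C l * (a + q * t ^ l)"
  using assms(11)
proof (induction l arbitrary: z)
  case 0
  then show ?case using assms(10)[of z] mult_nonneg_nonneg[OF assms(3) a(1)] by (simp add: distrib_left)
next
  case (Suc l)
  let ?d = "real (card F)" and ?K = "iterate_bound c (real (card F)) C l"
  have K: "0 \<le> ?K" using assms by (intro iterate_bound_nonneg) auto
  have "\<bar>(err_step c F \<tau> b e ^^ Suc l) g z\<bar>
    \<le> c * (?d * (?d * (C * C))) * ((a + t) * (?K * (a + q * t ^ l))) + c * (?d * (C * C)) * a"
    unfolding funpow.simps comp_apply by (rule err_step_contraction[OF assms(1-9) Suc.IH Suc.prems])
  also have "\<dots> \<le> c * (?d * (?d * (C * C))) * (?K * (3 * a + q * t ^ Suc l)) + c * (?d * (C * C)) * a"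
  proof (intro add_right_mono mult_left_mono)
    have tl: "0 \<le> t ^ l" "t ^ l \<le> 1" using t by (auto simp: power_le_one)
    then have "q * t ^ l \<le> 1" "0 \<le> q * t ^ l" using q by (auto intro: mult_le_one)
    then have "a * a \<le> a" "a * (q * t ^ l) \<le> a" "t * a \<le> a"
      using a t by (auto intro: mult_left_le mult_left_le_one_le)
    then have "(a + t) * (a + q * t ^ l) \<le> 3 * a + q * t ^ Suc l"
      by (simp add: algebra_simps)
    then have "?K * ((a + t) * (a + q * t ^ l)) \<le> ?K * (3 * a + q * t ^ Suc l)"
      using K by (intro mult_left_mono)
    then show "(a + t) * (?K * (a + q * t ^ l)) \<le> ?K * (3 * a + q * t ^ Suc l)"
      by (simp add: ac_simps)
  qed (use assms in auto)
  also have "\<dots> \<le> c * (?d * (?d * (C * C))) * (?K * (3 * (a + q * t ^ Suc l))) + c * (?d * (C * C)) * (a + q * t ^ Suc l)"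
    using assms K by (intro add_mono mult_left_mono) auto
  also have "\<dots> = iterate_bound c ?d C (Suc l) * (a + q * t ^ Suc l)"
    by (simp add: algebra_simps)
  finally show ?case .
qed

text \<open>The second summand is the price of averaging over distinct indices only.\<close>

definition fold_bound :: "real \<Rightarrow> real \<Rightarrow> real \<Rightarrow> nat \<Rightarrow> real" where
  "fold_bound c d C l = iterate_bound c d C l + 2 * step_bound c d C l * (real l)\<^sup>2"

lemma distinct_average_bound:
  assumes "finite X" "X \<noteq> {}" "l \<le> card X"
  assumes "finite F" "0 \<le> c" "0 \<le> C"
    and inv: "\<And>z z''. z \<in> F \<Longrightarrow> c * (\<Sum>z'\<in>F. \<tau>0 z' z * b0 z' z'') = of_bool (z = z'')"
    and "\<And>z z'. z \<in> F \<Longrightarrow> z' \<in> F \<Longrightarrow> \<bar>\<tau> z z'\<bar> \<le> C" "\<And>z z'. z \<in> F \<Longrightarrow> z' \<in> F \<Longrightarrow> \<bar>b0 z z'\<bar> \<le> C"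
    and "\<And>x z z'. x \<in> X \<Longrightarrow> z \<in> F \<Longrightarrow> z' \<in> F \<Longrightarrow> \<bar>b x z z'\<bar> \<le> C"
    and "\<And>x z. x \<in> X \<Longrightarrow> z \<in> F \<Longrightarrow> \<bar>e x z\<bar> \<le> C"
    and "\<And>z z'. z \<in> F \<Longrightarrow> z' \<in> F \<Longrightarrow> \<bar>\<tau> z z' - \<tau>0 z z'\<bar> \<le> C * t"
    and "\<And>z z'. z \<in> F \<Longrightarrow> z' \<in> F \<Longrightarrow> \<bar>(\<Sum>x\<in>X. b x z z') / real (card X) - b0 z z'\<bar> \<le> C * a"
    and "\<And>z. z \<in> F \<Longrightarrow> \<bar>(\<Sum>x\<in>X. e x z) / real (card X)\<bar> \<le> C * a"
    and g: "\<And>z. z \<in> F \<Longrightarrow> \<bar>g z\<bar> \<le> C * q" and "z \<in> F"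
    and a: "a = 1 / sqrt (real (card X))" and t: "0 \<le> t" "t \<le> 1" and q: "0 \<le> q" "q \<le> 1"
  shows "\<bar>(\<Sum>xs | length xs = l \<and> distinct xs \<and> set xs \<subseteq> X. foldr (\<lambda>x. err_step c F \<tau> (b x) (e x)) xs g z)
      / real (card {xs. length xs = l \<and> distinct xs \<and> set xs \<subseteq> X})\<bar>
    \<le> fold_bound c (real (card F)) C l * (a + q * t ^ l)"
proof -
  let ?h = "\<lambda>xs. foldr (\<lambda>x. err_step c F \<tau> (b x) (e x)) xs g z"
  let ?d = "real (card F)"
  have N: "1 \<le> real (card X)" using assms by (simp add: Suc_leI card_gt_0_iff)
  have a1: "0 \<le> a" "a \<le> 1" using N by (auto simp: a)
  have gC: "\<bar>g z\<bar> \<le> C" if "z \<in> F" for z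
    using g[OF that] mult_left_mono[OF q(2) \<open>0 \<le> C\<close>] by simp
  have S: "0 \<le> step_bound c ?d C l" using assms by (intro step_bound_nonneg) auto
  have "\<bar>(\<Sum>xs | length xs = l \<and> distinct xs \<and> set xs \<subseteq> X. ?h xs)
      / real (card {xs. length xs = l \<and> distinct xs \<and> set xs \<subseteq> X})
      - (\<Sum>xs | set xs \<subseteq> X \<and> length xs = l. ?h xs) / real (card X) ^ l\<bar>
     \<le> 2 * step_bound c ?d C l * (real l)\<^sup>2 / real (card X)"
  proof (rule average_distinct_lists[OF assms(1-3)])
    show "\<bar>?h xs\<bar> \<le> step_bound c ?d C l" if "length xs = l" "set xs \<subseteq> X" for xs
      using foldr_err_step_bound[of F c C \<tau> X b e g z xs] assms gC that by auto
  qed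
  \<comment> \<open>The cost of distinctness is of order 1 / N, that is a * a, and is absorbed by
    a.\<close>
  also have "\<dots> = 2 * step_bound c ?d C l * (real l)\<^sup>2 * (a * a)"
    using N by (simp add: a)
  also have "\<dots> \<le> 2 * step_bound c ?d C l * (real l)\<^sup>2 * (a + q * t ^ l)"
    using a1 S q t mult_left_le[of a a] by (intro mult_left_mono) (auto intro: add_increasing2)
  finally have 1: "\<bar>(\<Sum>xs | length xs = l \<and> distinct xs \<and> set xs \<subseteq> X. ?h xs)
      / real (card {xs. length xs = l \<and> distinct xs \<and> set xs \<subseteq> X})
      - (\<Sum>xs | set xs \<subseteq> X \<and> length xs = l. ?h xs) / real (card X) ^ l\<bar>
     \<le> 2 * step_bound c ?d C l * (real l)\<^sup>2 * (a + q * t ^ l)" .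
  have "\<bar>(\<Sum>xs | set xs \<subseteq> X \<and> length xs = l. ?h xs) / real (card X) ^ l\<bar>
     \<le> iterate_bound c ?d C l * (a + q * t ^ l)"
    unfolding average_all_lists[OF assms(1,2)]
    by (rule err_step_iterate[OF assms(4-9) assms(12-16) a1 t q])
  with 1 show ?thesis unfolding fold_bound_def distrib_right by linarith
qed

subsection \<open>Covariances under beta-mixing\<close>

context prob_space
begin

lemma sum_partition_Int:
  assumes "finite P" "P \<subseteq> sets M" "partition_on (space M) P" "b \<in> sets M"
  shows "(\<Sum>a\<in>P. prob (a \<inter> b)) = prob b"
proof -
  have "(\<Sum>a\<in>P. prob (a \<inter> b)) = prob (\<Union>a\<in>P. a \<inter> b)"
    using assms disjointD[of P]
    by (intro finite_measure_finite_Union[symmetric])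
       (fastforce simp: disjoint_family_on_def partition_on_def)+
  also have "(\<Union>a\<in>P. a \<inter> b) = b"
    using assms sets.sets_into_space by (auto simp: partition_on_def)
  finally show ?thesis .
qed

text \<open>The supremum of reals in \<open>beta_dep\<close> dominates its members only because they
  are bounded. The bound holds since both the joint probabilities and the products sum to 1.\<close>

lemma beta_dep_sum_le:
  assumes "finite P" "P \<subseteq> sets M" "partition_on (space M) P"
    and "finite P'" "P' \<subseteq> sets M" "partition_on (space M) P'"
  shows "1 / 2 * (\<Sum>a\<in>P. \<Sum>b\<in>P'. \<bar>prob (a \<inter> b) - prob a * prob b\<bar>) \<le> 1"
proof -
  have one: "(\<Sum>a\<in>Q. prob a) = 1" if "finite Q" "Q \<subseteq> sets M" "partition_on (space M) Q" for Q
  proof -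
    have "a \<inter> space M = a" if "a \<in> Q" for a using \<open>Q \<subseteq> sets M\<close> that sets.sets_into_space by blast
    then show ?thesis
      using sum_partition_Int[OF that, of "space M"] by (simp add: prob_space)
  qed
  have "(\<Sum>a\<in>P. \<Sum>b\<in>P'. \<bar>prob (a \<inter> b) - prob a * prob b\<bar>)
      \<le> (\<Sum>a\<in>P. \<Sum>b\<in>P'. prob (a \<inter> b) + prob a * prob b)"
    by (intro sum_mono order.trans[OF abs_triangle_ineq4]) auto
  also have "\<dots> = (\<Sum>b\<in>P'. \<Sum>a\<in>P. prob (a \<inter> b)) + (\<Sum>a\<in>P. prob a) * (\<Sum>b\<in>P'. prob b)"
    by (simp add: sum.distrib sum_product sum.swap[of "\<lambda>a b. prob (a \<inter> b)" P' P])
  also have "(\<Sum>b\<in>P'. \<Sum>a\<in>P. prob (a \<inter> b)) = (\<Sum>b\<in>P'. prob b)"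
    using assms by (intro sum.cong refl sum_partition_Int) auto
  finally show ?thesis using one assms by simp
qed

lemma beta_dep_upper:
  assumes "sets F \<subseteq> sets M" "sets H \<subseteq> sets M"
    and "finite P" "P \<subseteq> sets F" "partition_on (space M) P"
    and "finite P'" "P' \<subseteq> sets H" "partition_on (space M) P'"
  shows "1 / 2 * (\<Sum>a\<in>P. \<Sum>b\<in>P'. \<bar>prob (a \<inter> b) - prob a * prob b\<bar>) \<le> beta_dep M F H"
proof -
  have "bdd_above ((\<lambda>(P, P'). 1 / 2 * (\<Sum>a\<in>P. \<Sum>b\<in>P'. \<bar>prob (a \<inter> b) - prob a * prob b\<bar>)) `
    ({P. finite P \<and> P \<subseteq> sets F \<and> partition_on (space M) P} \<times>
                    {P. finite P \<and> P \<subseteq> sets H \<and> partition_on (space M) P}))"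
    using assms(1,2)
    by (intro bdd_aboveI2[where M=1]) (auto simp only: case_prod_conv intro!: beta_dep_sum_le)
  from cSUP_upper[OF _ this, of "(P, P')"] show ?thesis
    unfolding beta_dep_def using assms by auto
qed

lemma beta_dep_le_1:
  assumes "sets F \<subseteq> sets M" "sets H \<subseteq> sets M" "space M \<in> sets F" "space M \<in> sets H"
  shows "beta_dep M F H \<le> 1"
  unfolding beta_dep_def
proof (rule cSUP_least)
  \<comment> \<open>The trivial partition shows that the supremum is taken over a nonempty
    set.\<close>
  have "partition_on (space M) {space M}" using not_empty by (simp add: partition_on_def disjoint_def)
  then have "({space M}, {space M}) \<in> {P. finite P \<and> P \<subseteq> sets F \<and> partition_on (space M) P} \<times>
                    {P. finite P \<and> P \<subseteq> sets H \<and> partition_on (space M) P}"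
    using assms by auto
  then show "{P. finite P \<and> P \<subseteq> sets F \<and> partition_on (space M) P} \<times>
                    {P. finite P \<and> P \<subseteq> sets H \<and> partition_on (space M) P} \<noteq> {}" by blast
qed (use assms in \<open>auto simp only: case_prod_conv intro!: beta_dep_sum_le\<close>)

text \<open>The level sets of f and g are admissible partitions. The covariance is the sum of the
  mixing differences weighted by products of values, each at most B^2; the factor 2 undoes the 1 / 2
  in \<open>beta_dep\<close>.\<close>

lemma covariance_beta_simple:
  fixes f g :: "'a \<Rightarrow> real"
  assumes F: "sets F \<subseteq> sets M" "space F = space M" and H: "sets H \<subseteq> sets M" "space H = space M"
    and f: "f \<in> borel_measurable F" "finite (f ` space M)" "\<And>w. \<bar>f w\<bar> \<le> B"
    and g: "g \<in> borel_measurable H" "finite (g ` space M)" "\<And>w. \<bar>g w\<bar> \<le> B"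
  shows "\<bar>expectation (\<lambda>w. f w * g w) - expectation f * expectation g\<bar> \<le> 2 * B\<^sup>2 * beta_dep M F H"
proof -
  define A where "A x = f -` {x} \<inter> space M" for x
  define D where "D y = g -` {y} \<inter> space M" for y
  let ?X = "f ` space M" and ?Y = "g ` space M"
  have AF: "A x \<in> sets F" for x
    using measurable_sets[OF f(1), of "{x}"] F(2) by (simp add: A_def)
  have DH: "D y \<in> sets H" for y
    using measurable_sets[OF g(1), of "{y}"] H(2) by (simp add: D_def)
  have [measurable, simp]: "A x \<in> sets M" "D y \<in> sets M" for x y
    using AF DH F H by auto
  have [simp]: "integrable M (indicat_real (A x))" "integrable M (indicat_real (D y))" for x y
    by (auto intro!: integrable_real_indicator simp: emeasure_eq_measure)
  have int: "integrable M (\<lambda>w. x * y * indicator (A x \<inter> D y) w)" for x y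
    by (intro integrable_mult_right integrable_real_indicator) (auto simp: emeasure_eq_measure)
  have part: "partition_on (space M) (A ` ?X)" "partition_on (space M) (D ` ?Y)"
    by (auto simp: partition_on_def disjoint_def A_def D_def)
  have inj: "inj_on A ?X" "inj_on D ?Y"
    by (auto simp: inj_on_def A_def D_def)
  have fA: "f w = (\<Sum>x\<in>?X. x * indicator (A x) w)" if "w \<in> space M" for w
  proof -
    have "(\<Sum>x\<in>?X. x * indicator (A x) w) = (\<Sum>x\<in>?X. if f w = x then x else 0)"
      using that by (intro sum.cong) (auto simp: A_def indicator_def)
    then show ?thesis using that f(2) by simp
  qed
  have gD: "g w = (\<Sum>y\<in>?Y. y * indicator (D y) w)" if "w \<in> space M" for w
  proof -
    have "(\<Sum>x\<in>?Y. x * indicator (D x) w) = (\<Sum>x\<in>?Y. if g w = x then x else 0)"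
      using that by (intro sum.cong) (auto simp: D_def indicator_def)
    then show ?thesis using that g(2) by simp
  qed
  have Ef: "expectation f = (\<Sum>x\<in>?X. x * prob (A x))"
    by (subst Bochner_Integration.integral_cong[OF refl fA], assumption, subst Bochner_Integration.integral_sum) auto
  have Eg: "expectation g = (\<Sum>y\<in>?Y. y * prob (D y))"
    by (subst Bochner_Integration.integral_cong[OF refl gD], assumption, subst Bochner_Integration.integral_sum) auto
  have "expectation (\<lambda>w. f w * g w)
     = expectation (\<lambda>w. \<Sum>x\<in>?X. \<Sum>y\<in>?Y. x * y * indicator (A x \<inter> D y) w)"
    by (intro Bochner_Integration.integral_cong refl, subst fA, simp, subst gD, simp)
       (simp only: sum_product indicator_inter_arith ac_simps)
  also have "\<dots> = (\<Sum>x\<in>?X. \<Sum>y\<in>?Y. expectation (\<lambda>w. x * y * indicator (A x \<inter> D y) w))"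
    by (subst Bochner_Integration.integral_sum, rule Bochner_Integration.integrable_sum, rule int,
        intro sum.cong refl Bochner_Integration.integral_sum int)
  also have "\<dots> = (\<Sum>x\<in>?X. \<Sum>y\<in>?Y. x * y * prob (A x \<inter> D y))"
    by (intro sum.cong refl, subst integral_mult_right_zero) simp
  finally have "expectation (\<lambda>w. f w * g w) - expectation f * expectation g
     = (\<Sum>x\<in>?X. \<Sum>y\<in>?Y. x * y * (prob (A x \<inter> D y) - prob (A x) * prob (D y)))"
    by (simp add: Ef Eg sum_product sum_subtractf right_diff_distrib ac_simps)
  also have "\<bar>\<dots>\<bar> \<le> (\<Sum>x\<in>?X. \<Sum>y\<in>?Y. \<bar>x * y * (prob (A x \<inter> D y) - prob (A x) * prob (D y))\<bar>)"
    by (intro order.trans[OF sum_abs] sum_mono sum_abs)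
  also have "\<dots> \<le> (\<Sum>x\<in>?X. \<Sum>y\<in>?Y. B\<^sup>2 * \<bar>prob (A x \<inter> D y) - prob (A x) * prob (D y)\<bar>)"
    using f(3) g(3) order.trans[OF abs_ge_zero f(3)]
    by (intro sum_mono) (auto simp: abs_mult power2_eq_square intro!: mult_mono)
  also have "\<dots> = 2 * B\<^sup>2 * (1 / 2 * (\<Sum>a\<in>A ` ?X. \<Sum>b\<in>D ` ?Y. \<bar>prob (a \<inter> b) - prob a * prob b\<bar>))"
    by (simp add: sum.reindex inj sum_distrib_left)
  also have "\<dots> \<le> 2 * B\<^sup>2 * beta_dep M F H"
    using f g AF DH part F H by (intro mult_left_mono beta_dep_upper) auto
  finally show ?thesis .
qed

text \<open>Rounding down to multiples of 1 / (k + 1) gives functions of finite range that are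
  measurable for the same sub-sigma-algebras, to which the simple case applies. Rounding may enlarge
  the bound to B + 1, and dominated convergence removes it in the limit.\<close>

lemma covariance_beta:
  fixes f g :: "'a \<Rightarrow> real"
  assumes F: "sets F \<subseteq> sets M" "space F = space M" and H: "sets H \<subseteq> sets M" "space H = space M"
    and f: "f \<in> borel_measurable F" "\<And>w. \<bar>f w\<bar> \<le> B"
    and g: "g \<in> borel_measurable H" "\<And>w. \<bar>g w\<bar> \<le> B"
  shows "\<bar>expectation (\<lambda>w. f w * g w) - expectation f * expectation g\<bar> \<le> 2 * (B + 1)\<^sup>2 * beta_dep M F H"
proof -
  define d where "d k x = real_of_int \<lfloor>x * real (Suc k)\<rfloor> / real (Suc k)" for k and x :: real
  have err: "\<bar>d k x - x\<bar> \<le> inverse (real (Suc k))" for k x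
  proof -
    have "d k x - x = (real_of_int \<lfloor>x * real (Suc k)\<rfloor> - x * real (Suc k)) / real (Suc k)"
      by (simp add: d_def field_simps)
    also have "\<bar>\<dots>\<bar> \<le> 1 / real (Suc k)"
      unfolding abs_divide by (intro frac_le) (auto, linarith)
    finally show ?thesis by (simp add: inverse_eq_divide)
  qed
  have lim: "(\<lambda>k. d k x) \<longlonglongrightarrow> x" for x
    by (rule LIM_zero_cancel, rule Lim_null_comparison[OF _ LIMSEQ_inverse_real_of_nat])
       (use err in \<open>auto intro!: always_eventually\<close>)
  have bd: "\<bar>d k x\<bar> \<le> B + 1" if "\<bar>x\<bar> \<le> B" for k x
  proof -
    have "inverse (real (Suc k)) \<le> 1" by (simp add: field_simps)
    then show ?thesis using err[of k x] that by linarith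
  qed
  have fin: "finite ((\<lambda>w. d k (h w)) ` space M)" if "\<And>w. \<bar>h w\<bar> \<le> B" for h :: "'a \<Rightarrow> real" and k
  proof (rule finite_subset)
    show "(\<lambda>w. d k (h w)) ` space M \<subseteq>
      (\<lambda>i. real_of_int i / real (Suc k)) ` {\<lfloor>- B * real (Suc k)\<rfloor>..\<lfloor>B * real (Suc k)\<rfloor>}"
    proof (rule image_subsetI, unfold d_def, rule imageI)
      fix w
      have "- B \<le> h w" "h w \<le> B" using that[of w] by auto
      then show "\<lfloor>h w * real (Suc k)\<rfloor> \<in> {\<lfloor>- B * real (Suc k)\<rfloor>..\<lfloor>B * real (Suc k)\<rfloor>}"
        using mult_right_mono[of "- B" "h w" "real (Suc k)"] mult_right_mono[of "h w" B "real (Suc k)"]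
        by (auto simp del: of_nat_Suc intro!: floor_mono)
    qed
  qed simp
  have dm: "d k \<in> borel_measurable borel" for k unfolding d_def by measurable
  have fM: "f \<in> borel_measurable M" "g \<in> borel_measurable M"
    using f g F H by (auto simp: measurable_def)
  note [measurable] = fM dm
  have B0: "0 \<le> B" using f(2) order.trans[OF abs_ge_zero] by blast
  have 1: "\<bar>expectation (\<lambda>w. d k (f w) * d k (g w)) - expectation (\<lambda>w. d k (f w)) * expectation (\<lambda>w. d k (g w))\<bar>
     \<le> 2 * (B + 1)\<^sup>2 * beta_dep M F H" for k
    using fin f g bd
    by (intro covariance_beta_simple[OF F H] measurable_compose[OF f(1) dm] measurable_compose[OF g(1) dm]) auto
  have "(\<lambda>k. expectation (\<lambda>w. d k (f w) * d k (g w))) \<longlonglongrightarrow> expectation (\<lambda>w. f w * g w)"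
    using f(2) g(2) bd B0
    by (intro integral_dominated_convergence[where w="\<lambda>_. (B + 1) * (B + 1)"])
       (auto intro!: tendsto_mult lim mult_mono simp: abs_mult)
  moreover have "(\<lambda>k. expectation (\<lambda>w. d k (f w))) \<longlonglongrightarrow> expectation f"
    using f(2) bd by (intro integral_dominated_convergence[where w="\<lambda>_. B + 1"]) (auto intro!: lim)
  moreover have "(\<lambda>k. expectation (\<lambda>w. d k (g w))) \<longlonglongrightarrow> expectation g"
    using g(2) bd by (intro integral_dominated_convergence[where w="\<lambda>_. B + 1"]) (auto intro!: lim)
  ultimately have "(\<lambda>k. \<bar>expectation (\<lambda>w. d k (f w) * d k (g w)) - expectation (\<lambda>w. d k (f w)) * expectation (\<lambda>w. d k (g w))\<bar>)
      \<longlonglongrightarrow> \<bar>expectation (\<lambda>w. f w * g w) - expectation f * expectation g\<bar>"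
    by (intro tendsto_rabs tendsto_diff tendsto_mult)
  then show ?thesis
    by (rule LIMSEQ_le_const2) (use 1 in auto)
qed

end

section \<open>Mixing coefficients of a process\<close>

lemma sets_sub_algebra:
  assumes "\<And>j. j \<in> J \<Longrightarrow> X j \<in> measurable M obs_space"
  shows "sets (sub_algebra M X J) \<subseteq> sets M"
  unfolding sub_algebra_def using assms by (intro sets_image_in_sets) measurable

lemma space_sub_algebra [simp]: "space (sub_algebra M X J) = space M"
  by (simp add: sub_algebra_def)

lemma measurable_sub_algebra:
  assumes "j \<in> J" "\<And>j. X j \<in> measurable M obs_space"
  shows "X j \<in> measurable (sub_algebra M X J) obs_space"
proof -
  have "(\<lambda>w. \<lambda>j\<in>J. X j w) \<in> measurable (sub_algebra M X J) (PiM J (\<lambda>_. obs_space))"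
    unfolding sub_algebra_def using assms(2)
    by (intro measurable_vimage_algebra1) (auto intro: measurable_space[OF assms(2)] simp: space_PiM)
  from measurable_compose[OF this measurable_component_singleton[OF assms(1)]]
  show ?thesis using assms(1) by simp
qed

lemma (in prob_space) beta_mixing_upper:
  assumes "\<And>j. X j \<in> measurable M obs_space"
  shows "beta_dep M (sub_algebra M X {..t}) (sub_algebra M X {t + q..}) \<le> beta_mixing_coeff M X q"
    and "beta_mixing_coeff M X q \<le> 1"
proof -
  have top: "space M \<in> sets (sub_algebra M X J)" for J
    using sets.top[of "sub_algebra M X J"] by simp
  have le: "beta_dep M (sub_algebra M X {..t}) (sub_algebra M X {t + q..}) \<le> 1" for t
    using sets_sub_algebra[of _ X M] assms top by (intro beta_dep_le_1) auto
  show "beta_dep M (sub_algebra M X {..t}) (sub_algebra M X {t + q..}) \<le> beta_mixing_coeff M X q"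
    unfolding beta_mixing_coeff_def using le by (intro cSUP_upper bdd_aboveI2[where M=1]) auto
  show "beta_mixing_coeff M X q \<le> 1"
    unfolding beta_mixing_coeff_def using le by (intro cSUP_least) auto
qed

text \<open>The O-bound holds only from some q0 on. As all coefficients are at most 1, the constant
  1 / \<rho>^q0 takes care of the earlier ones.\<close>

lemma (in prob_space) exp_beta_mixing_bound:
  assumes "\<And>j. X j \<in> measurable M obs_space" "exp_beta_mixing M X"
  obtains \<rho> C where "0 < \<rho>" "\<rho> < 1" "0 < C" "\<And>q. beta_mixing_coeff M X q \<le> C * \<rho> ^ q"
proof -
  obtain \<rho> where \<rho>: "0 < \<rho>" "\<rho> < 1" and O: "beta_mixing_coeff M X \<in> O(\<lambda>q. \<rho> ^ q)"
    using assms(2) by (auto simp: exp_beta_mixing_def)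
  obtain c where c: "0 < c" and ev: "\<forall>\<^sub>F q in at_top. norm (beta_mixing_coeff M X q) \<le> c * norm (\<rho> ^ q)"
    using landau_o.bigE[OF O] by auto
  obtain q0 where q0: "\<And>q. q0 \<le> q \<Longrightarrow> \<bar>beta_mixing_coeff M X q\<bar> \<le> c * \<bar>\<rho> ^ q\<bar>"
    using ev by (auto simp: eventually_at_top_linorder)
  have "beta_mixing_coeff M X q \<le> (c + 1 / \<rho> ^ q0) * \<rho> ^ q" for q
  proof (cases "q0 \<le> q")
    case True
    have "beta_mixing_coeff M X q \<le> c * \<rho> ^ q" using q0[OF True] \<rho> by auto
    also have "\<dots> \<le> (c + 1 / \<rho> ^ q0) * \<rho> ^ q" using \<rho> by (intro mult_right_mono) auto
    finally show ?thesis .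
  next
    case False
    have "\<rho> ^ q0 \<le> \<rho> ^ q" using False \<rho> by (intro power_decreasing) auto
    then have "1 \<le> (1 / \<rho> ^ q0) * \<rho> ^ q" using \<rho> by (simp add: field_simps)
    also have "\<dots> \<le> (c + 1 / \<rho> ^ q0) * \<rho> ^ q" using \<rho> c by (intro mult_right_mono) auto
    finally show ?thesis using beta_mixing_upper(2)[where X=X and q=q] assms(1) by force
  qed
  moreover have "0 < c + 1 / \<rho> ^ q0" using c \<rho> by (intro add_pos_pos) auto
  ultimately show ?thesis using that \<rho> by blast
qed

subsection \<open>McLeish's central limit theorem\<close>

text \<open>Both functions have the Taylor polynomial 1 + i x - x^2 / 2, so they differ only by a
  cubic term. The factor 1 + i x is the one whose products have expectation 1 for martingale
  differences.\<close>

lemma iexp_mcleish: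
  assumes "\<bar>x\<bar> \<le> 1"
  shows "cmod (iexp x - (1 + \<i> * of_real x) * of_real (exp (- x\<^sup>2 / 2))) \<le> 2 * \<bar>x\<bar> ^ 3"
proof -
  define y where "y = x\<^sup>2 / 2"
  define d where "d = exp (- y) - 1 + y"
  have y: "0 \<le> y" by (simp add: y_def)
  have "0 \<le> d" using exp_ge_add_one_self[of "- y"] by (simp add: d_def)
  moreover have "d \<le> y\<^sup>2"
  proof -
    have "exp (- y) \<le> 1 / (1 + y)"
      using exp_ge_add_one_self[of y] y by (simp add: exp_minus inverse_eq_divide frac_le)
    also have "\<dots> \<le> 1 - y + y\<^sup>2"
    proof -
      have "(1 - y + y\<^sup>2) * (1 + y) = 1 + y ^ 3" by (simp add: algebra_simps power2_eq_square power3_eq_cube)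
      then show ?thesis using y by (simp add: divide_le_eq)
    qed
    finally show ?thesis by (simp add: d_def)
  qed
  moreover have "y\<^sup>2 \<le> \<bar>x\<bar> ^ 3 / 4"
    using assms power_decreasing[of 3 4 "\<bar>x\<bar>"] by (simp add: y_def power_divide)
  ultimately have d: "\<bar>d\<bar> \<le> \<bar>x\<bar> ^ 3 / 4" by linarith
  have eq: "(1 + \<i> * of_real x) * of_real (exp (- x\<^sup>2 / 2))
     = (1 + \<i> * of_real x - of_real (x\<^sup>2 / 2)) + ((1 + \<i> * of_real x) * of_real d - \<i> * of_real (x ^ 3 / 2))"
    by (simp add: complex_eq_iff d_def y_def algebra_simps power2_eq_square power3_eq_cube)
  have "cmod (1 + \<i> * of_real x) \<le> 2"
    using norm_triangle_ineq[of 1 "\<i> * of_real x"] assms by (simp add: norm_mult)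
  then have "cmod ((1 + \<i> * of_real x) * of_real d) \<le> 2 * (\<bar>x\<bar> ^ 3 / 4)"
    unfolding norm_mult[of _ "of_real d"] norm_of_real using d by (intro mult_mono) auto
  moreover have "cmod (\<i> * of_real (x ^ 3 / 2)) = \<bar>x\<bar> ^ 3 / 2"
    by (simp add: norm_mult norm_divide norm_power)
  moreover have "cmod (iexp x - (1 + \<i> * of_real x - of_real (x\<^sup>2 / 2))) \<le> \<bar>x\<bar> ^ 3 / 6"
    using iexp_approx1[of x 2] by (simp add: eval_nat_numeral fact_numeral power_mult_distrib algebra_simps)
  moreover have dec: "iexp x - (1 + \<i> * of_real x) * of_real (exp (- x\<^sup>2 / 2))
    = (iexp x - (1 + \<i> * of_real x - of_real (x\<^sup>2 / 2))) - ((1 + \<i> * of_real x) * of_real d - \<i> * of_real (x ^ 3 / 2))"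
    unfolding eq by simp
  ultimately show ?thesis
    using norm_triangle_ineq4[of "iexp x - (1 + \<i> * of_real x - of_real (x\<^sup>2 / 2))" "(1 + \<i> * of_real x) * of_real d - \<i> * of_real (x ^ 3 / 2)"]
      norm_triangle_ineq4[of "(1 + \<i> * of_real x) * of_real d" "\<i> * of_real (x ^ 3 / 2)"]
      zero_le_power[OF abs_ge_zero[of x], of 3]
    unfolding dec by linarith
qed

lemma norm_one_plus_imaginary: "cmod (1 + \<i> * of_real x) \<le> exp (x\<^sup>2 / 2)"
proof -
  have "cmod (1 + \<i> * of_real x) = sqrt (1 + x\<^sup>2)" by (simp add: cmod_def)
  also have "\<dots> \<le> sqrt (exp (x\<^sup>2))" using exp_ge_add_one_self by simp
  also have "sqrt (exp (x\<^sup>2)) = exp (x\<^sup>2 / 2)"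
    by (rule real_sqrt_unique) (auto simp: exp_double[symmetric])
  finally show ?thesis .
qed

text \<open>First the products of the factors from \<open>iexp_mcleish\<close>, all of norm at most
  1, are compared factor by factor. Then the random quadratic variation in the exponential is
  replaced by the constant s, at a Lipschitz cost times the size of the remaining product.
  Afterwards the product is multiplied by a constant only, so its expectation can be used.\<close>

lemma mcleish_bound:
  fixes y :: "'o \<Rightarrow> real"
  assumes "finite I" "\<And>i. i \<in> I \<Longrightarrow> \<bar>u * y i\<bar> \<le> b" "b \<le> 1" "0 \<le> s"
  shows "cmod (iexp (u * (\<Sum>i\<in>I. y i)) - (\<Prod>i\<in>I. 1 + \<i> * of_real (u * y i)) * of_real (exp (- s / 2)))
     \<le> real (card I) * (2 * b ^ 3) + exp (u\<^sup>2 * (\<Sum>i\<in>I. (y i)\<^sup>2) / 2) * (\<bar>u\<^sup>2 * (\<Sum>i\<in>I. (y i)\<^sup>2) - s\<bar> / 2)"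
proof -
  let ?P = "\<Prod>i\<in>I. 1 + \<i> * of_real (u * y i)"
  let ?v = "u\<^sup>2 * (\<Sum>i\<in>I. (y i)\<^sup>2)"
  let ?a = "\<lambda>i. iexp (u * y i)" and ?b = "\<lambda>i. (1 + \<i> * of_real (u * y i)) * of_real (exp (- (u * y i)\<^sup>2 / 2))"
  have v: "?v = (\<Sum>i\<in>I. (u * y i)\<^sup>2)" by (simp add: sum_distrib_left power_mult_distrib)
  have 1: "iexp (u * (\<Sum>i\<in>I. y i)) = (\<Prod>i\<in>I. ?a i)"
    by (simp add: exp_sum[OF assms(1), symmetric] sum_distrib_left)
  have 2: "?P * of_real (exp (- ?v / 2)) = (\<Prod>i\<in>I. ?b i)"
  proof -
    have "exp (- ?v / 2) = (\<Prod>i\<in>I. exp (- (u * y i)\<^sup>2 / 2))"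
      by (simp add: exp_sum[OF assms(1), symmetric] v sum_negf sum_divide_distrib)
    then show ?thesis by (simp only: of_real_prod prod.distrib)
  qed
  have b1: "cmod (?b i) \<le> 1" for i
  proof -
    have "cmod (?b i) \<le> exp ((u * y i)\<^sup>2 / 2) * exp (- (u * y i)\<^sup>2 / 2)"
      unfolding norm_mult[of _ "of_real _"] using norm_one_plus_imaginary[of "u * y i"]
      by (intro mult_mono) auto
    then show ?thesis by (simp add: exp_minus)
  qed
  have "cmod ((\<Prod>i\<in>I. ?a i) - (\<Prod>i\<in>I. ?b i)) \<le> (\<Sum>i\<in>I. cmod (?a i - ?b i))"
    using b1 by (intro norm_prod_diff) auto
  also have "\<dots> \<le> (\<Sum>i\<in>I. 2 * b ^ 3)"
  proof (rule sum_mono)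
    fix i assume i: "i \<in> I"
    have "cmod (?a i - ?b i) \<le> 2 * \<bar>u * y i\<bar> ^ 3"
      using assms(2)[OF i] assms(3) by (intro iexp_mcleish) linarith
    also have "\<dots> \<le> 2 * b ^ 3" using assms(2)[OF i] by (intro mult_left_mono power_mono) auto
    finally show "cmod (?a i - ?b i) \<le> 2 * b ^ 3" .
  qed
  finally have A: "cmod (iexp (u * (\<Sum>i\<in>I. y i)) - ?P * of_real (exp (- ?v / 2))) \<le> real (card I) * (2 * b ^ 3)"
    unfolding 1 2 by simp
  have P: "cmod ?P \<le> exp (?v / 2)"
  proof -
    have "cmod ?P \<le> (\<Prod>i\<in>I. exp ((u * y i)\<^sup>2 / 2))"
      unfolding prod_norm[symmetric] by (intro prod_mono conjI norm_ge_zero norm_one_plus_imaginary)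
    also have "\<dots> = exp (?v / 2)"
      by (simp add: exp_sum[OF assms(1), symmetric] v sum_divide_distrib)
    finally show ?thesis .
  qed
  have lip: "\<bar>exp (- x) - exp (- z)\<bar> \<le> \<bar>x - z\<bar>" if "0 \<le> x" "0 \<le> z" for x z :: real
  proof -
    have *: "\<bar>exp (- x) - exp (- z)\<bar> \<le> z - x" if "0 \<le> x" "x \<le> z" for x z :: real
    proof -
      have "exp (- x) - exp (- z) = exp (- x) * (1 - exp (- (z - x)))"
        by (simp add: right_diff_distrib exp_add[symmetric])
      also have "\<dots> \<le> 1 * (z - x)"
      proof (rule mult_mono)
        show "1 - exp (- (z - x)) \<le> z - x" using exp_ge_add_one_self[of "- (z - x)"] by linarith
      qed (use that in auto)
      finally show ?thesis using that by simp
    qed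
    show ?thesis using *[of x z] *[of z x] that by (cases "x \<le> z") (auto simp: abs_minus_commute)
  qed
  have "0 \<le> ?v" by (simp add: sum_nonneg)
  then have e: "\<bar>exp (- ?v / 2) - exp (- s / 2)\<bar> \<le> \<bar>?v - s\<bar> / 2"
    using lip[of "?v / 2" "s / 2"] assms(4) by (simp add: abs_if field_simps split: if_splits)
  have "?P * of_real (exp (- ?v / 2)) - ?P * of_real (exp (- s / 2))
    = ?P * of_real (exp (- ?v / 2) - exp (- s / 2))" by (simp add: right_diff_distrib)
  then have "cmod (?P * of_real (exp (- ?v / 2)) - ?P * of_real (exp (- s / 2))) \<le> exp (?v / 2) * (\<bar>?v - s\<bar> / 2)"
    using P e by (auto simp only: norm_mult norm_of_real intro!: mult_mono exp_ge_zero)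
  from norm_triangle_mono[OF A this] show ?thesis by simp
qed

text \<open>
  McLeish's form of the martingale central limit theorem for bounded arrays: the martingale
  property enters only through the expectation of the products.
\<close>

theorem (in prob_space) mcleish_clt:
  fixes Y :: "'o \<Rightarrow> 'a \<Rightarrow> real" and I :: "nat \<Rightarrow> 'o set"
  assumes fin: "\<And>j. finite (I j)" and [measurable]: "\<And>i. Y i \<in> borel_measurable M"
    and bound: "\<And>i w. \<bar>Y i w\<bar> \<le> C" and \<sigma>: "0 < \<sigma>"
    and card: "filterlim (\<lambda>j. real (card (I j))) at_top sequentially"
    and prod: "\<And>j u. expectation (\<lambda>w. \<Prod>i\<in>I j. 1 + \<i> * of_real (u * Y i w)) = 1"
    and var: "(\<lambda>j. expectation (\<lambda>w. \<bar>(\<Sum>i\<in>I j. (Y i w)\<^sup>2) / real (card (I j)) - \<sigma>\<^sup>2\<bar>)) \<longlonglongrightarrow> 0"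
  shows "weak_conv_m (\<lambda>j. distr M borel (\<lambda>w. (\<Sum>i\<in>I j. Y i w) / (\<sigma> * sqrt (real (card (I j))))))
    std_normal_distribution"
proof (rule levy_continuity)
  show "real_distribution (distr M borel (\<lambda>w. (\<Sum>i\<in>I j. Y i w) / (\<sigma> * sqrt (real (card (I j))))))" for j
    by (intro real_distribution_distr) measurable
  show "real_distribution std_normal_distribution" by (rule real_dist_normal_dist)
  fix t :: real
  define N where "N j = real (card (I j))" for j
  define u where "u j = t / (\<sigma> * sqrt (N j))" for j
  define b where "b j = \<bar>u j\<bar> * C" for j
  define V where "V j w = (\<Sum>i\<in>I j. (Y i w)\<^sup>2) / N j" for j w
  define P where "P j w = (\<Prod>i\<in>I j. 1 + \<i> * of_real (u j * Y i w))" for j w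
  define K where "K = exp (t\<^sup>2 * C\<^sup>2 / \<sigma>\<^sup>2 / 2)"
  define f where "f j w = iexp (u j * (\<Sum>i\<in>I j. Y i w))" for j w
  have C: "0 \<le> C" using bound order.trans[OF abs_ge_zero] by blast
  have [measurable]: "V j \<in> borel_measurable M" "P j \<in> borel_measurable M" "f j \<in> borel_measurable M" for j
    unfolding V_def P_def f_def by measurable
  have uV: "(u j)\<^sup>2 * (\<Sum>i\<in>I j. (Y i w)\<^sup>2) = t\<^sup>2 / \<sigma>\<^sup>2 * V j w" if "0 < N j" for j w
    using that \<sigma> by (simp add: u_def V_def power_divide power_mult_distrib)
  have V: "0 \<le> V j w" "V j w \<le> C\<^sup>2" for j w
  proof -
    show "0 \<le> V j w" by (simp add: V_def N_def sum_nonneg)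
    have "(Y i w)\<^sup>2 \<le> C\<^sup>2" for i using bound[of i w] C by (simp add: abs_le_square_iff[symmetric])
    then have "(\<Sum>i\<in>I j. (Y i w)\<^sup>2) \<le> N j * C\<^sup>2" unfolding N_def by (intro sum_bounded_above)
    then show "V j w \<le> C\<^sup>2"
      by (cases "N j = 0") (auto simp: V_def N_def divide_le_eq ac_simps)
  qed
  have char: "char (distr M borel (\<lambda>w. (\<Sum>i\<in>I j. Y i w) / (\<sigma> * sqrt (real (card (I j)))))) t
      = expectation (f j)" for j
    unfolding char_def f_def u_def N_def by (subst integral_distr) auto
  have ev: "\<forall>\<^sub>F j in sequentially. 0 < N j \<and> b j \<le> 1"
  proof -
    have "\<forall>\<^sub>F j in sequentially. (\<bar>t\<bar> * C / \<sigma>)\<^sup>2 + 1 \<le> N j"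
      using card by (simp add: filterlim_at_top N_def)
    then show ?thesis
    proof eventually_elim
      case (elim j)
      have "0 < N j" using elim by (smt (verit) zero_le_power2)
      moreover have "\<bar>t\<bar> * C / \<sigma> \<le> sqrt (N j)"
        using elim by (intro real_le_rsqrt) auto
      ultimately show ?case using \<sigma>
        by (simp add: b_def u_def abs_mult field_simps)
    qed
  qed
  have fin_int: "integrable M h" if "h \<in> borel_measurable M" "\<And>w. cmod (h w) \<le> k" for h :: "'a \<Rightarrow> complex" and k
    using that by (intro integrable_const_bound[where B=k]) auto
  have main: "cmod (expectation (f j) - of_real (exp (- t\<^sup>2 / 2)))
      \<le> N j * (2 * b j ^ 3) + K * (t\<^sup>2 / \<sigma>\<^sup>2 / 2) * expectation (\<lambda>w. \<bar>V j w - \<sigma>\<^sup>2\<bar>)"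
    if N: "0 < N j" and b: "b j \<le> 1" for j
  proof -
    have pw: "cmod (f j w - P j w * of_real (exp (- t\<^sup>2 / 2)))
       \<le> N j * (2 * b j ^ 3) + K * (t\<^sup>2 / \<sigma>\<^sup>2 / 2) * \<bar>V j w - \<sigma>\<^sup>2\<bar>" for w
    proof -
      have "cmod (f j w - P j w * of_real (exp (- t\<^sup>2 / 2)))
         \<le> N j * (2 * b j ^ 3) + exp (t\<^sup>2 / \<sigma>\<^sup>2 * V j w / 2) * (\<bar>t\<^sup>2 / \<sigma>\<^sup>2 * V j w - t\<^sup>2\<bar> / 2)"
        unfolding f_def P_def N_def uV[OF N, symmetric]
        using bound b by (intro mcleish_bound fin) (auto simp: abs_mult b_def intro!: mult_left_mono)
      moreover have "exp (t\<^sup>2 / \<sigma>\<^sup>2 * V j w / 2) \<le> K"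
        using mult_left_mono[OF V(2)[of j w], of "t\<^sup>2 / \<sigma>\<^sup>2 / 2"] by (simp add: K_def)
      moreover have "\<bar>t\<^sup>2 / \<sigma>\<^sup>2 * V j w - t\<^sup>2\<bar> / 2 = t\<^sup>2 / \<sigma>\<^sup>2 / 2 * \<bar>V j w - \<sigma>\<^sup>2\<bar>"
      proof -
        have "t\<^sup>2 / \<sigma>\<^sup>2 * V j w - t\<^sup>2 = t\<^sup>2 / \<sigma>\<^sup>2 * (V j w - \<sigma>\<^sup>2)" using \<sigma> by (simp add: field_simps)
        then show ?thesis by (simp add: abs_mult)
      qed
      ultimately show ?thesis
        using mult_right_mono[of "exp (t\<^sup>2 / \<sigma>\<^sup>2 * V j w / 2)" K "t\<^sup>2 / \<sigma>\<^sup>2 / 2 * \<bar>V j w - \<sigma>\<^sup>2\<bar>"]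
        by (simp add: ac_simps)
    qed
    have Pb: "cmod (P j w) \<le> exp (t\<^sup>2 / \<sigma>\<^sup>2 * C\<^sup>2 / 2)" for w
    proof -
      have "cmod (P j w) \<le> (\<Prod>i\<in>I j. exp ((u j * Y i w)\<^sup>2 / 2))"
        unfolding P_def prod_norm[symmetric] by (intro prod_mono conjI norm_ge_zero norm_one_plus_imaginary)
      also have "\<dots> = exp (t\<^sup>2 / \<sigma>\<^sup>2 * V j w / 2)"
        by (simp only: exp_sum[OF fin, symmetric] uV[OF N, symmetric] sum_divide_distrib sum_distrib_left power_mult_distrib)
      also have "\<dots> \<le> exp (t\<^sup>2 / \<sigma>\<^sup>2 * C\<^sup>2 / 2)"
        using mult_left_mono[OF V(2)[of j w], of "t\<^sup>2 / \<sigma>\<^sup>2 / 2"] by simp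
      finally show ?thesis .
    qed
    have EP: "expectation (P j) = 1" unfolding P_def by (rule prod)
    have iP: "integrable M (P j)" using Pb by (intro fin_int) auto
    have if': "integrable M (f j)" by (intro fin_int[of _ 1]) (auto simp: f_def)
    have iV: "integrable M (\<lambda>w. \<bar>V j w - \<sigma>\<^sup>2\<bar>)"
    proof (intro integrable_const_bound[where B="C\<^sup>2 + \<sigma>\<^sup>2"] AE_I2)
      show "norm \<bar>V j w - \<sigma>\<^sup>2\<bar> \<le> C\<^sup>2 + \<sigma>\<^sup>2" for w
        using V[of j w] zero_le_power2[of \<sigma>] unfolding real_norm_def abs_idempotent by linarith
    qed simp
    \<comment> \<open>Because \<open>P j\<close> has expectation 1, the Gaussian factor may be
      written as an expectation, and the pointwise bound applies under the integral.\<close>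
    have "expectation (f j) - of_real (exp (- t\<^sup>2 / 2)) = expectation (\<lambda>w. f j w - P j w * of_real (exp (- t\<^sup>2 / 2)))"
      using iP if' EP by simp
    also have "cmod \<dots> \<le> expectation (\<lambda>w. cmod (f j w - P j w * of_real (exp (- t\<^sup>2 / 2))))"
      by (rule integral_norm_bound)
    also have "\<dots> \<le> expectation (\<lambda>w. N j * (2 * b j ^ 3) + K * (t\<^sup>2 / \<sigma>\<^sup>2 / 2) * \<bar>V j w - \<sigma>\<^sup>2\<bar>)"
      using pw iP if' iV by (intro integral_mono) auto
    also have "\<dots> = N j * (2 * b j ^ 3) + K * (t\<^sup>2 / \<sigma>\<^sup>2 / 2) * expectation (\<lambda>w. \<bar>V j w - \<sigma>\<^sup>2\<bar>)"
      using iV by (simp add: prob_space)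
    finally show ?thesis .
  qed
  have "(\<lambda>j. N j * (2 * b j ^ 3) + K * (t\<^sup>2 / \<sigma>\<^sup>2 / 2) * expectation (\<lambda>w. \<bar>V j w - \<sigma>\<^sup>2\<bar>)) \<longlonglongrightarrow> 0 + K * (t\<^sup>2 / \<sigma>\<^sup>2 / 2) * 0"
  proof (intro tendsto_add tendsto_mult tendsto_const)
    show "(\<lambda>j. expectation (\<lambda>w. \<bar>V j w - \<sigma>\<^sup>2\<bar>)) \<longlonglongrightarrow> 0" using var by (simp add: V_def N_def)
    have "filterlim (\<lambda>j. sqrt (N j)) at_top sequentially"
      using card unfolding N_def by (rule filterlim_compose[OF sqrt_at_top])
    then have "(\<lambda>j. 2 * (\<bar>t\<bar> * C / \<sigma>) ^ 3 / sqrt (N j)) \<longlonglongrightarrow> 0"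
      by (rule real_tendsto_divide_at_top[OF tendsto_const])
    \<comment> \<open>The bound b on a single summand is of order 1 / sqrt N, so N cubic errors add
      up to order 1 / sqrt N.\<close>
    moreover have "\<forall>\<^sub>F j in sequentially. 2 * (\<bar>t\<bar> * C / \<sigma>) ^ 3 / sqrt (N j) = N j * (2 * b j ^ 3)"
      using ev
    proof eventually_elim
      case (elim j)
      define r where "r = sqrt (N j)"
      have r: "N j = r * r" "0 < r" using elim by (auto simp: r_def)
      show ?case
        unfolding b_def u_def r_def[symmetric] using r \<sigma>
        by (simp add: r(1) abs_mult power_divide power_mult_distrib field_simps power3_eq_cube)
    qed
    ultimately show "(\<lambda>j. N j * (2 * b j ^ 3)) \<longlonglongrightarrow> 0"
      by (rule Lim_transform_eventually)
  qed
  then have lim: "(\<lambda>j. N j * (2 * b j ^ 3) + K * (t\<^sup>2 / \<sigma>\<^sup>2 / 2) * expectation (\<lambda>w. \<bar>V j w - \<sigma>\<^sup>2\<bar>)) \<longlonglongrightarrow> 0"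
    by simp
  have "(\<lambda>j. expectation (f j)) \<longlonglongrightarrow> of_real (exp (- t\<^sup>2 / 2))"
    by (rule LIM_zero_cancel, rule Lim_null_comparison[OF _ lim])
       (rule eventually_mono[OF ev], rule main, auto)
  then show "(\<lambda>j. char (distr M borel (\<lambda>w. (\<Sum>i\<in>I j. Y i w) / (\<sigma> * sqrt (real (card (I j)))))) t)
      \<longlonglongrightarrow> char std_normal_distribution t"
    unfolding char char_std_normal_distribution by simp
qed

subsection \<open>Normal quantiles and a Slutsky theorem\<close>

lemma std_normal_reflect:
  assumes [measurable]: "A \<in> sets borel"
  shows "measure std_normal_distribution (uminus -` A) = measure std_normal_distribution A"
proof -
  have m: "uminus -` A \<in> sets borel"
    using measurable_sets[OF borel_measurable_uminus[OF measurable_ident] assms] by simp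
  have "emeasure std_normal_distribution A = (\<integral>\<^sup>+x. ennreal (std_normal_density (0 + -1 * x)) * indicator A (0 + -1 * x) \<partial>lborel)"
    by (subst emeasure_density, simp, simp, subst nn_integral_real_affine[where c="-1" and t=0]) auto
  also have "\<dots> = emeasure std_normal_distribution (uminus -` A)"
    by (subst emeasure_density, simp)
       (use m in \<open>auto intro!: nn_integral_cong simp: indicator_def std_normal_density_def\<close>)
  finally show ?thesis by (simp add: measure_def)
qed

lemma std_normal_singleton: "measure std_normal_distribution {x} = 0"
proof -
  have "emeasure std_normal_distribution {x} = 0"
    by (subst emeasure_density) (auto intro!: nn_integral_0_iff_AE[THEN iffD2] AE_I[where N="{x}"]
      simp: indicator_def split: if_splits)
  then show ?thesis by (simp add: measure_def)
qed

lemma std_normal_interval_pos: "x < y \<Longrightarrow> 0 < measure std_normal_distribution {x<..y}"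
proof -
  assume xy: "x < y"
  interpret real_distribution std_normal_distribution by (rule real_dist_normal_dist)
  have "emeasure std_normal_distribution {x<..y} \<noteq> 0"
  proof
    assume "emeasure std_normal_distribution {x<..y} = 0"
    then have "AE z in lborel. ennreal (std_normal_density z) * indicator {x<..y} z = 0"
      by (subst (asm) emeasure_density) (auto simp: nn_integral_0_iff_AE)
    then have "AE z in lborel. z \<notin> {x<..y}"
    proof eventually_elim
      case (elim z)
      then show ?case using normal_density_pos[of 1 0 z] by (auto simp: indicator_def split: if_splits)
    qed
    then have "emeasure lborel {x<..y} = 0"
      by (subst AE_iff_measurable[symmetric, where P="\<lambda>z. z \<notin> {x<..y}"]) auto
    then show False using xy by simp
  qed
  then show ?thesis by (simp add: emeasure_eq_measure zero_less_measure_iff)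
qed

text \<open>The description in \<open>upper_quantile\<close> denotes a number because the normal
  distribution function is continuous, having no atoms, and strictly increasing, having a positive
  density.\<close>

lemma upper_quantile:
  assumes "0 < p" "p < 1"
  shows "measure std_normal_distribution {upper_quantile p<..} = p"
proof -
  interpret N: real_distribution std_normal_distribution by (rule real_dist_normal_dist)
  have tail: "measure std_normal_distribution {z<..} = 1 - cdf std_normal_distribution z" for z
  proof -
    have "{z<..} = space std_normal_distribution - {..z}" by auto
    then show ?thesis using N.prob_compl[of "{..z}"] by (simp add: cdf_def)
  qed
  have cont: "continuous_on UNIV (cdf std_normal_distribution)"
    by (simp add: continuous_on_eq_continuous_within N.isCont_cdf std_normal_singleton)
  obtain a where a: "cdf std_normal_distribution a < 1 - p"
    using order_tendstoD(2)[OF N.cdf_lim_at_bot, of "1 - p"] assms by (auto simp: eventually_at_bot_linorder)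
  obtain b where b: "1 - p < cdf std_normal_distribution b"
    using order_tendstoD(1)[OF N.cdf_lim_at_top_prob, of "1 - p"] assms by (auto simp: eventually_at_top_linorder)
  have "a \<le> b" using a b N.cdf_nondecreasing[of b a] by linarith
  then obtain z where z: "cdf std_normal_distribution z = 1 - p"
    using IVT'[of "cdf std_normal_distribution" a "1 - p" b] a b continuous_on_subset[OF cont] by auto
  have mono: "cdf std_normal_distribution x < cdf std_normal_distribution y" if "x < y" for x y
    using N.cdf_diff_eq[OF that] std_normal_interval_pos[OF that] by simp
  have "\<exists>!z. measure std_normal_distribution {z<..} = p"
    using z mono by (intro ex1I[of _ z]) (auto simp: tail, metis linorder_neqE_linordered_idom less_irrefl diff_diff_eq2 diff_add_cancel add_diff_cancel_left')
  then show ?thesis unfolding upper_quantile_def by (rule theI')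
qed

lemma upper_quantile_interval:
  assumes "0 < \<alpha>" "\<alpha> < 1"
  defines "z \<equiv> upper_quantile (\<alpha> / 2)"
  shows "0 \<le> z" "measure std_normal_distribution {- z..z} = 1 - \<alpha>"
proof -
  interpret N: real_distribution std_normal_distribution by (rule real_dist_normal_dist)
  have up: "measure std_normal_distribution {z<..} = \<alpha> / 2"
    unfolding z_def using assms by (intro upper_quantile) auto
  have "uminus -` {z<..} = {..<- z}" by auto
  then have lo: "measure std_normal_distribution {..<- z} = \<alpha> / 2"
    using std_normal_reflect[of "{z<..}"] up by simp
  show "0 \<le> z"
  proof (rule ccontr)
    assume "\<not> 0 \<le> z"
    \<comment> \<open>For a negative quantile the two tails would cover the line, although their
      masses add up to \<alpha> < 1.\<close>
    have "1 = measure std_normal_distribution ({z<..} \<union> {..<- z})"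
    proof -
      have "{z<..} \<union> {..<- z} = space std_normal_distribution"
        using \<open>\<not> 0 \<le> z\<close> by (auto simp: set_eq_iff)
      then show ?thesis using N.prob_space by simp
    qed
    also have "\<dots> \<le> \<alpha>"
      using measure_Un_le[of "{z<..}" std_normal_distribution "{..<- z}"] up lo by simp
    finally show False using assms by simp
  qed
  have "measure std_normal_distribution ({z<..} \<union> {..<- z}) = \<alpha>"
    using up lo \<open>0 \<le> z\<close> by (subst N.finite_measure_Union) auto
  moreover have "{- z..z} = space std_normal_distribution - ({z<..} \<union> {..<- z})" by auto
  ultimately show "measure std_normal_distribution {- z..z} = 1 - \<alpha>"
    using N.prob_compl[of "{z<..} \<union> {..<- z}"] by simp
qed

lemma std_normal_interval_continuous:
  "isCont (\<lambda>x. measure std_normal_distribution {- x..x}) z" if "0 < z"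
proof -
  interpret N: real_distribution std_normal_distribution by (rule real_dist_normal_dist)
  have eq: "measure std_normal_distribution {- x..x} = cdf std_normal_distribution x - cdf std_normal_distribution (- x)"
    if "0 < x" for x
  proof -
    have "{- x..x} = {- x<..x} \<union> {- x}" using that by auto
    then have "measure std_normal_distribution {- x..x} = measure std_normal_distribution {- x<..x}"
      using N.finite_measure_Union[of "{- x<..x}" "{- x}"] by (simp add: std_normal_singleton)
    then show ?thesis using N.cdf_diff_eq[of "- x" x] that by simp
  qed
  have c: "isCont (cdf std_normal_distribution) x" for x
    by (simp add: N.isCont_cdf std_normal_singleton)
  have "isCont (\<lambda>x. cdf std_normal_distribution x - cdf std_normal_distribution (- x)) z"
    by (intro continuous_intros isCont_o2[OF _ c] c)
  moreover have "\<forall>\<^sub>F x in nhds z. measure std_normal_distribution {- x..x}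
      = cdf std_normal_distribution x - cdf std_normal_distribution (- x)"
    using eventually_nhds_in_open[of "{0<..}" z] that by (auto elim!: eventually_mono simp: eq)
  ultimately show ?thesis by (subst isCont_cong)
qed

lemma std_normal_frontier: "emeasure std_normal_distribution (frontier {- x..x}) = 0"
proof -
  interpret N: real_distribution std_normal_distribution by (rule real_dist_normal_dist)
  have "frontier {- x..x} \<subseteq> {- x} \<union> {x}" by (auto simp: frontier_def)
  then have "measure std_normal_distribution (frontier {- x..x}) \<le> measure std_normal_distribution ({- x} \<union> {x})"
    by (intro N.finite_measure_mono) auto
  also have "\<dots> \<le> 0" using measure_Un_le[of "{- x}" std_normal_distribution "{x}"] by (simp add: std_normal_singleton)
  finally show ?thesis by (simp add: N.emeasure_eq_measure measure_le_0_iff)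
qed

text \<open>
  Slutsky's theorem for two-sided intervals. The exceptional events \<open>E\<close> replace convergence in
  probability, so that neither \<open>Y\<close> nor \<open>s\<close> has to be measurable.
\<close>

theorem (in prob_space) slutsky_interval:
  fixes A Y s :: "nat \<Rightarrow> 'a \<Rightarrow> real"
  assumes [measurable]: "\<And>j. A j \<in> borel_measurable M"
    and conv: "weak_conv_m (\<lambda>j. distr M borel (\<lambda>w. A j w / \<sigma>)) std_normal_distribution"
    and \<sigma>: "0 < \<sigma>" and z: "0 < z"
    and small: "\<And>e. 0 < e \<Longrightarrow> \<forall>\<^sub>F j in sequentially. \<exists>E\<in>sets M. prob E \<le> e \<and>
        (\<forall>w\<in>space M - E. \<bar>Y j w\<bar> \<le> e \<and> \<bar>s j w - \<sigma>\<bar> \<le> e)"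
    and Ev: "\<And>j. {w \<in> space M. \<bar>A j w + Y j w\<bar> \<le> z * s j w} \<in> sets M"
  shows "(\<lambda>j. prob {w \<in> space M. \<bar>A j w + Y j w\<bar> \<le> z * s j w}) \<longlonglongrightarrow> measure std_normal_distribution {- z..z}"
proof -
  let ?H = "\<lambda>x. measure std_normal_distribution {- x..x}"
  have lim: "(\<lambda>j. prob {w \<in> space M. \<bar>A j w\<bar> \<le> x * \<sigma>}) \<longlonglongrightarrow> ?H x" for x
  proof -
    have "(\<lambda>j. measure (distr M borel (\<lambda>w. A j w / \<sigma>)) {- x..x}) \<longlonglongrightarrow> ?H x"
      by (rule weak_conv_imp_continuity_set_conv[OF _ real_dist_normal_dist conv _ std_normal_frontier])
         (auto intro!: real_distribution_distr)
    moreover have "measure (distr M borel (\<lambda>w. A j w / \<sigma>)) {- x..x} = prob {w \<in> space M. \<bar>A j w\<bar> \<le> x * \<sigma>}" for j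
    proof (subst measure_distr)
      show "prob ((\<lambda>w. A j w / \<sigma>) -` {- x..x} \<inter> space M) = prob {w \<in> space M. \<bar>A j w\<bar> \<le> x * \<sigma>}"
        using \<sigma> by (intro arg_cong[where f=prob]) (auto simp: field_simps abs_le_iff)
    qed auto
    ultimately show ?thesis by simp
  qed
  show ?thesis
  proof (rule tendstoI)
    fix \<delta> :: real assume \<delta>: "0 < \<delta>"
    from std_normal_interval_continuous[OF z]
    obtain d where d: "0 < d" "\<And>x. \<bar>x - z\<bar> < d \<Longrightarrow> \<bar>?H x - ?H z\<bar> < \<delta> / 3"
      unfolding continuous_at_eps_delta using \<delta> by (metis dist_real_def zero_less_divide_iff zero_less_numeral)
    \<comment> \<open>Off the exceptional event the threshold is missed by at most e from Y and by z
      * e from z * s. The choice of e keeps the total (z + 1) * e below d / 2 * \<sigma>, so the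
      event lies between those for z - d / 2 and z + d / 2, up to probability e.\<close>
    define e where "e = min (\<delta> / 3) (d / 2 * \<sigma> / (z + 1))"
    have e: "0 < e" "e \<le> \<delta> / 3" using d z \<sigma> \<delta> unfolding e_def by (simp, intro min.cobounded1)
    have "e \<le> d / 2 * \<sigma> / (z + 1)" unfolding e_def by (rule min.cobounded2)
    then have ed: "e * (z + 1) \<le> d / 2 * \<sigma>" using z by (subst (asm) pos_le_divide_eq) auto
    let ?E = "\<lambda>j. {w \<in> space M. \<bar>A j w + Y j w\<bar> \<le> z * s j w}"
    let ?U = "\<lambda>j. {w \<in> space M. \<bar>A j w\<bar> \<le> (z + d / 2) * \<sigma>}" and ?L = "\<lambda>j. {w \<in> space M. \<bar>A j w\<bar> \<le> (z - d / 2) * \<sigma>}"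
    have "\<forall>\<^sub>F j in sequentially. dist (prob (?U j)) (?H (z + d / 2)) < \<delta> / 3"
         "\<forall>\<^sub>F j in sequentially. dist (prob (?L j)) (?H (z - d / 2)) < \<delta> / 3"
      using \<delta> by (intro tendstoD[OF lim], simp)+
    then show "\<forall>\<^sub>F j in sequentially. dist (prob (?E j)) (?H z) < \<delta>"
      using small[OF e(1)]
    proof eventually_elim
      case (elim j)
      obtain B where BM[measurable]: "B \<in> sets M" and B: "prob B \<le> e"
        "\<And>w. w \<in> space M - B \<Longrightarrow> \<bar>Y j w\<bar> \<le> e \<and> \<bar>s j w - \<sigma>\<bar> \<le> e"
        using elim by blast
      have zs: "\<bar>z * s j w - z * \<sigma>\<bar> \<le> z * e" if "w \<in> space M - B" for w
        using B(2)[OF that] z by (simp add: right_diff_distrib[symmetric] abs_mult)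
      have "prob (?E j) \<le> prob (?U j \<union> B)"
      proof (rule finite_measure_mono)
        show "?E j \<subseteq> ?U j \<union> B"
        proof
          fix w assume w: "w \<in> ?E j"
          show "w \<in> ?U j \<union> B"
          proof (cases "w \<in> B")
            case False
            then show ?thesis using w B(2)[of w] zs[of w] ed by (auto simp: algebra_simps) 
          qed simp
        qed
      qed measurable
      also have "\<dots> \<le> prob (?U j) + prob B" by (intro measure_Un_le) measurable
      finally have up: "prob (?E j) \<le> prob (?U j) + e" using B(1) by linarith
      have "prob (?L j) \<le> prob (?E j \<union> B)"
      proof (rule finite_measure_mono)
        show "?L j \<subseteq> ?E j \<union> B"
        proof
          fix w assume w: "w \<in> ?L j"
          show "w \<in> ?E j \<union> B"
          proof (cases "w \<in> B")
            case False
            then show ?thesis using w B(2)[of w] zs[of w] ed by (auto simp: algebra_simps)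
          qed simp
        qed
      qed (intro sets.Un Ev BM)
      also have "\<dots> \<le> prob (?E j) + prob B" by (intro measure_Un_le Ev BM)
      finally have lo: "prob (?L j) \<le> prob (?E j) + e" using B(1) by linarith
      have "\<bar>?H (z + d / 2) - ?H z\<bar> < \<delta> / 3" "\<bar>?H (z - d / 2) - ?H z\<bar> < \<delta> / 3"
        by (rule d(2), use d(1) in simp)+
      then show ?case
        using up lo elim(1,2) e(2) unfolding dist_real_def abs_less_iff by arith
    qed
  qed
qed

subsection \<open>The data process\<close>

lemma measurable_obs_fst [measurable]: "fst \<in> measurable obs_space (count_space UNIV)"
  and measurable_obs_snd [measurable]: "snd \<in> measurable obs_space (count_space UNIV \<Otimes>\<^sub>M borel)"
  by (simp_all add: obs_space_def)

lemma measurable_transition_fst [measurable]: "fst \<in> measurable transition_space (count_space UNIV)"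
  and measurable_transition_snd [measurable]:
    "snd \<in> measurable transition_space (count_space UNIV \<Otimes>\<^sub>M (borel \<Otimes>\<^sub>M count_space UNIV))"
  by (simp_all add: transition_space_def)

locale ope_data = prob_space M + off_policy_evaluation \<gamma> p r pol G pinf B
  for M :: "'w measure" and \<gamma> p r pol G and pinf :: "('a::countable \<times> 's::countable) pmf" and B +
  fixes S :: "nat \<Rightarrow> nat \<Rightarrow> 'w \<Rightarrow> 's" and A :: "nat \<Rightarrow> nat \<Rightarrow> 'w \<Rightarrow> 'a"
    and R :: "nat \<Rightarrow> nat \<Rightarrow> 'w \<Rightarrow> real" and X :: "nat \<Rightarrow> nat \<Rightarrow> 'w \<Rightarrow> ('s, 'a) obs"
  assumes X_def: "X = (\<lambda>i t w. (S i t w, A i t w, R i t w))"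
    and mdp: "\<forall>i. mdp_trajectory M p r (S i) (A i) (R i)"
    and R_bound: "\<forall>i t. AE w in M. \<bar>R i t w\<bar> \<le> B"
    and iid: "iid_trajectories M X"
    and stationary: "\<forall>i. strictly_stationary M (X i)"
    and mixing: "\<forall>i. exp_beta_mixing M (X i)"
    and limiting_distribution:
      "\<forall>i a s. (\<lambda>t. measure M {w \<in> space M. A i t w = a \<and> S i t w = s}) \<longlonglongrightarrow> pmf pinf (a, s)"
    and nondegenerate:
      "\<not> (AE w in M. omega_ratio \<gamma> p pol G pinf (A 0 0 w) (S 0 0 w) *
             (R 0 0 w - Q_fun \<gamma> p r pol (A 0 0 w) (S 0 0 w)
              + \<gamma> * measure_pmf.expectation (pol (S 0 1 w)) (\<lambda>a. Q_fun \<gamma> p r pol a (S 0 1 w))) = 0)"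
begin

abbreviation Z :: "nat \<Rightarrow> nat \<Rightarrow> 'w \<Rightarrow> 'a \<times> 's" where "Z i t w \<equiv> (A i t w, S i t w)"

abbreviation tn :: "nat \<Rightarrow> nat \<Rightarrow> 'w \<Rightarrow> ('s, 'a) transition" where
  "tn i t w \<equiv> transitions S A R w i t"

abbreviation paths :: "(nat \<Rightarrow> ('s, 'a) obs) measure" where "paths \<equiv> PiM UNIV (\<lambda>_. obs_space)"

text \<open>Independence and stationarity are assumed for whole paths, so transitions are expressed
  as a fixed functional of a path.\<close>

definition tr :: "nat \<Rightarrow> (nat \<Rightarrow> ('s, 'a) obs) \<Rightarrow> ('s, 'a) transition" where
  "tr t \<xi> = (fst (\<xi> t), fst (snd (\<xi> t)), snd (snd (\<xi> t)), fst (\<xi> (Suc t)))"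

lemma tn_tr: "tn i t w = tr t (\<lambda>t. X i t w)"
  by (simp add: transitions_def tr_def X_def)

lemma measurable_data [measurable]:
  "S i t \<in> measurable M (count_space UNIV)" "A i t \<in> measurable M (count_space UNIV)" "R i t \<in> borel_measurable M"
  using mdp by (auto simp: mdp_trajectory_def Let_def)

lemma measurable_X [measurable]: "X i t \<in> measurable M obs_space"
  unfolding X_def obs_space_def by measurable

lemma measurable_tr [measurable]: "tr t \<in> measurable paths transition_space"
  unfolding tr_def transition_space_def by measurable

lemma measurable_path [measurable]: "(\<lambda>w t. X i t w) \<in> measurable M paths"
  by (rule measurable_PiM_single') (auto intro: measurable_space[OF measurable_X])

lemma measurable_transition:
  assumes "X i t \<in> measurable N obs_space" "S i (Suc t) \<in> measurable N (count_space UNIV)"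
  shows "tn i t \<in> measurable N transition_space"
proof -
  note [measurable] = assms
  have "tn i t = (\<lambda>w. (fst (X i t w), fst (snd (X i t w)), snd (snd (X i t w)), S i (Suc t) w))"
    by (simp add: X_def transitions_def)
  also have "\<dots> \<in> measurable N transition_space"
    unfolding transition_space_def by measurable
  finally show ?thesis .
qed

lemma measurable_tn [measurable]: "tn i t \<in> measurable M transition_space"
  by (intro measurable_transition) measurable

lemma expectation_path:
  fixes \<phi> :: "_ \<Rightarrow> real"
  assumes [measurable]: "\<phi> \<in> borel_measurable paths"
  shows "expectation (\<lambda>w. \<phi> (\<lambda>t. X i (t + h) w)) = expectation (\<lambda>w. \<phi> (\<lambda>t. X 0 t w))"
proof -
  have [measurable]: "(\<lambda>w t. X i (t + h) w) \<in> measurable M paths"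
    by (rule measurable_PiM_single') (auto intro: measurable_space[OF measurable_X])
  have "distr M paths (\<lambda>w t. X i (t + h) w) = distr M paths (\<lambda>w t. X i t w)"
    using stationary by (auto simp: strictly_stationary_def)
  also have "\<dots> = distr M paths (\<lambda>w t. X 0 t w)"
    using iid by (auto simp: iid_trajectories_def)
  finally have "integral\<^sup>L (distr M paths (\<lambda>w t. X i (t + h) w)) \<phi> = integral\<^sup>L (distr M paths (\<lambda>w t. X 0 t w)) \<phi>"
    by simp
  then show ?thesis by (simp add: integral_distr)
qed

lemma expectation_transitions:
  fixes \<phi> \<psi> :: "_ \<Rightarrow> real"
  assumes [measurable]: "\<phi> \<in> borel_measurable transition_space" "\<psi> \<in> borel_measurable transition_space"
  shows "expectation (\<lambda>w. \<phi> (tn i (t + h) w) * \<psi> (tn i (t' + h) w)) = expectation (\<lambda>w. \<phi> (tn 0 t w) * \<psi> (tn 0 t' w))"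
proof -
  have s: "tr t (\<lambda>t. X i (t + h) w) = tn i (t + h) w" for i t w
    by (simp add: tn_tr tr_def)
  show ?thesis
    using expectation_path[of "\<lambda>X. \<phi> (tr t X) * \<psi> (tr t' X)" i h] by (simp only: s) (simp add: tn_tr)
qed

lemma expectation_transition:
  fixes \<phi> :: "_ \<Rightarrow> real"
  assumes [measurable]: "\<phi> \<in> borel_measurable transition_space"
  shows "expectation (\<lambda>w. \<phi> (tn i t w)) = expectation (\<lambda>w. \<phi> (tn 0 0 w))"
  using expectation_transitions[of \<phi> "\<lambda>_. 1" i 0 t 0] by simp

text \<open>By stationarity the sequence in \<open>limiting_distribution\<close> is constant, hence
  equal to its limit at every time.\<close>

lemma prob_Z: "prob {w \<in> space M. Z i t w = z} = pmf pinf z"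
proof -
  define \<phi> :: "('s, 'a) transition \<Rightarrow> real"
    where "\<phi> = (\<lambda>x. indicator {fst z} (fst (snd x)) * indicator {snd z} (fst x))"
  have [measurable]: "\<phi> \<in> borel_measurable transition_space"
    unfolding \<phi>_def by measurable
  have eq: "prob {w \<in> space M. Z i t w = z} = expectation (\<lambda>w. \<phi> (tn i t w))" for t
  proof -
    have "expectation (\<lambda>w. \<phi> (tn i t w)) = expectation (indicator {w \<in> space M. Z i t w = z})"
      by (intro Bochner_Integration.integral_cong) (cases z, auto simp: \<phi>_def transitions_def indicator_def)+
    then show ?thesis by simp
  qed
  have "(\<lambda>t. prob {w \<in> space M. Z i t w = z}) \<longlonglongrightarrow> pmf pinf z"
    using limiting_distribution[rule_format, of i "fst z" "snd z"] by (simp add: prod_eq_iff)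
  then have "(\<lambda>t. expectation (\<lambda>w. \<phi> (tn 0 0 w))) \<longlonglongrightarrow> pmf pinf z"
    unfolding eq by (subst (asm) expectation_transition) simp_all
  then have "expectation (\<lambda>w. \<phi> (tn 0 0 w)) = pmf pinf z"
    by (simp add: LIMSEQ_const_iff)
  then show ?thesis unfolding eq by (subst expectation_transition) simp_all
qed

lemma AE_Z: "AE w in M. Z i t w \<in> F"
proof -
  have "AE w in M. \<forall>z. pmf pinf z = 0 \<longrightarrow> Z i t w \<noteq> z"
    unfolding AE_all_countable
  proof
    fix z
    show "AE w in M. pmf pinf z = 0 \<longrightarrow> Z i t w \<noteq> z"
    proof (cases "pmf pinf z = 0")
      case True
      have "AE w in M. w \<notin> {w \<in> space M. Z i t w = z}"
        using prob_Z[of i t z] True by (subst prob_eq_0[symmetric]) auto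
      then show ?thesis using AE_space by eventually_elim auto
    qed simp
  qed
  then show ?thesis by eventually_elim (auto simp: set_pmf_iff)
qed

section \<open>Conditional expectations given the past of a trajectory\<close>

abbreviation past :: "nat \<Rightarrow> nat \<Rightarrow> 'w measure" where "past i t \<equiv> pre_reward_algebra M (X i) t"

lemma past_measurable_aux:
  assumes "\<And>j. j < t \<Longrightarrow> X i j \<in> measurable N obs_space" "S i t \<in> measurable N (count_space UNIV)"
    "A i t \<in> measurable N (count_space UNIV)"
  shows "(\<lambda>w. (fst (X i t w), fst (snd (X i t w)), \<lambda>j\<in>{..<t}. X i j w))
     \<in> measurable N (count_space UNIV \<Otimes>\<^sub>M (count_space UNIV \<Otimes>\<^sub>M PiM {..<t} (\<lambda>_. obs_space)))"
proof -
  have [simp]: "(\<lambda>w. fst (X i t w)) = S i t" "(\<lambda>w. fst (snd (X i t w))) = A i t"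
    by (auto simp: X_def)
  have "(\<lambda>w. \<lambda>j\<in>{..<t}. X i j w) \<in> measurable N (PiM {..<t} (\<lambda>_. obs_space))"
    using assms(1) by (intro measurable_restrict) auto
  then show ?thesis using assms(2,3) by (intro measurable_Pair) simp_all
qed

lemma space_past [simp]: "space (past i t) = space M"
  by (simp add: pre_reward_algebra_def)

lemma subalgebra_past: "subalgebra M (past i t)"
  unfolding subalgebra_def pre_reward_algebra_def space_vimage_algebra
  by (intro conjI refl sets_image_in_sets past_measurable_aux measurable_X measurable_data)

lemma subalgebra_sub_algebra: "subalgebra M (sub_algebra M (X i) J)"
  unfolding subalgebra_def using sets_sub_algebra[of J "X i" M] by auto

lemma measurable_past:
  shows "S i t \<in> measurable (past i t) (count_space UNIV)"
    and "A i t \<in> measurable (past i t) (count_space UNIV)"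
    and "j < t \<Longrightarrow> X i j \<in> measurable (past i t) obs_space"
proof -
  let ?g = "\<lambda>w. (fst (X i t w), fst (snd (X i t w)), \<lambda>j\<in>{..<t}. X i j w)"
  let ?N = "count_space UNIV \<Otimes>\<^sub>M (count_space UNIV \<Otimes>\<^sub>M PiM {..<t} (\<lambda>_. obs_space))"
  have g: "?g \<in> measurable (past i t) ?N"
    unfolding pre_reward_algebra_def
    by (intro measurable_vimage_algebra1 Pi_I measurable_space[OF past_measurable_aux]) auto
  note m = measurable_compose[OF g]
  show "S i t \<in> measurable (past i t) (count_space UNIV)"
    using m[of fst] by (simp add: X_def)
  show "A i t \<in> measurable (past i t) (count_space UNIV)"
    using m[of "\<lambda>x. fst (snd x)"] by (simp add: X_def)
  assume j: "j < t"
  have "(\<lambda>x. snd (snd x)) \<in> measurable ?N (PiM {..<t} (\<lambda>_. obs_space))"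
    by measurable
  from measurable_compose[OF m[OF this] measurable_component_singleton[of j]]
  show "X i j \<in> measurable (past i t) obs_space"
    using j by simp
qed

lemma fst_X: "fst (X i t w) = S i t w" "fst (snd (X i t w)) = A i t w"
  by (simp_all add: X_def)

lemma measurable_sub_algebra_Z:
  assumes "t \<in> J"
  shows "S i t \<in> measurable (sub_algebra M (X i) J) (count_space UNIV)"
    and "A i t \<in> measurable (sub_algebra M (X i) J) (count_space UNIV)"
  using measurable_compose[OF measurable_sub_algebra[of t J "X i" M, OF assms measurable_X], of fst "count_space UNIV"]
    measurable_compose[OF measurable_sub_algebra[of t J "X i" M, OF assms measurable_X], of "\<lambda>x. fst (snd x)" "count_space UNIV"]
  by (simp_all add: fst_X)

text \<open>The next state is conditioned on all observations up to time t, the reward only on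
  \<open>past\<close>. Weights measurable for the smaller algebra serve in both cases.\<close>

lemma past_le_sub_algebra: "sets (past i t) \<subseteq> sets (sub_algebra M (X i) {..t})"
proof -
  have "(\<lambda>w. (fst (X i t w), fst (snd (X i t w)), \<lambda>j\<in>{..<t}. X i j w))
     \<in> measurable (sub_algebra M (X i) {..t}) (count_space UNIV \<Otimes>\<^sub>M (count_space UNIV \<Otimes>\<^sub>M PiM {..<t} (\<lambda>_. obs_space)))"
    by (intro past_measurable_aux measurable_sub_algebra measurable_sub_algebra_Z) auto
  from sets_image_in_sets[OF _ this, of "space M"] show ?thesis
    by (simp add: pre_reward_algebra_def)
qed

text \<open>A transition at time j includes the state at j + 1. For j + 1 = t this is the current
  state, which \<open>past\<close> contains although it does not contain the whole observation at
  time t.\<close>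

lemma past_measurable_tn: "j < t \<Longrightarrow> tn i j \<in> measurable (past i t) transition_space"
proof (intro measurable_transition)
  assume j: "j < t"
  show "X i j \<in> measurable (past i t) obs_space" using j by (rule measurable_past)
  show "S i (Suc j) \<in> measurable (past i t) (count_space UNIV)"
  proof (cases "Suc j = t")
    case True
    then show ?thesis using measurable_past(1) by simp
  next
    case False
    then have "X i (Suc j) \<in> measurable (past i t) obs_space" using j by (intro measurable_past) auto
    from measurable_compose[OF this measurable_obs_fst] show ?thesis by (simp add: X_def)
  qed
qed

lemma past_measurable_hit:
  "(\<lambda>w. of_bool (A i t w = a \<and> S i t w = s) :: real) \<in> borel_measurable (past i t)"
proof -
  note [measurable] = measurable_past(1,2)
  show ?thesis by measurable
qed

text \<open>The Markov property tested against a weight Y that may depend on the whole past. The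
  indicator of the current pair makes the conditional probability constant.\<close>

lemma expectation_next_state:
  fixes Y :: "'w \<Rightarrow> real"
  assumes Y: "Y \<in> borel_measurable (past i t)" "\<And>w. \<bar>Y w\<bar> \<le> C"
  shows "expectation (\<lambda>w. Y w * of_bool (Z i t w = z) * of_bool (S i (Suc t) w = s))
     = pmf (p (fst z) (snd z)) s * expectation (\<lambda>w. Y w * of_bool (Z i t w = z))"
proof -
  let ?H = "sub_algebra M (X i) {..t}"
  interpret H: finite_measure_subalgebra M ?H
    by unfold_locales (rule subalgebra_sub_algebra)
  define f where "f w = Y w * of_bool (A i t w = fst z \<and> S i t w = snd z)" for w
  have fp: "f \<in> borel_measurable (past i t)"
    unfolding f_def using Y(1) past_measurable_hit by (rule borel_measurable_times)
  then have f: "f \<in> borel_measurable ?H"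
    by (rule measurable_from_subalg[rotated]) (simp add: subalgebra_def past_le_sub_algebra)
  then have fM: "f \<in> borel_measurable M"
    by (rule measurable_from_subalg[rotated]) (rule subalgebra_sub_algebra)
  note [measurable] = fM
  let ?g = "indicator {w \<in> space M. S i (Suc t) w = s} :: 'w \<Rightarrow> real"
  have fb: "\<bar>f w\<bar> \<le> C" for w using Y(2)[of w] order.trans[OF abs_ge_zero Y(2)[of w]] by (simp add: f_def)
  have "expectation (\<lambda>w. f w * ?g w) = expectation (\<lambda>w. f w * real_cond_exp M ?H ?g w)"
    using fb by (intro H.real_cond_exp_intg(2)[symmetric] f integrable_const_bound[where B=C])
      (auto simp: abs_mult indicator_def intro: order.trans[OF abs_ge_zero])
  also have "\<dots> = expectation (\<lambda>w. pmf (p (fst z) (snd z)) s * f w)"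
  proof (rule integral_cong_AE)
    have "AE w in M. real_cond_exp M ?H ?g w = pmf (p (A i t w) (S i t w)) s"
      using mdp by (auto simp: mdp_trajectory_def Let_def X_def)
    then show "AE w in M. f w * real_cond_exp M ?H ?g w = pmf (p (fst z) (snd z)) s * f w"
      by eventually_elim (auto simp: f_def)
  qed auto
  also have "expectation (\<lambda>w. f w * ?g w) = expectation (\<lambda>w. Y w * of_bool (Z i t w = z) * of_bool (S i (Suc t) w = s))"
    by (intro Bochner_Integration.integral_cong) (auto simp: f_def indicator_def prod_eq_iff)
  finally show ?thesis by (simp add: f_def prod_eq_iff)
qed

lemma expectation_reward:
  fixes Y :: "'w \<Rightarrow> real"
  assumes Y: "Y \<in> borel_measurable (past i t)" "\<And>w. \<bar>Y w\<bar> \<le> C"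
  shows "expectation (\<lambda>w. Y w * of_bool (Z i t w = z) * R i t w)
     = r (fst z) (snd z) * expectation (\<lambda>w. Y w * of_bool (Z i t w = z))"
proof -
  interpret H: finite_measure_subalgebra M "past i t"
    by unfold_locales (rule subalgebra_past)
  define f where "f w = Y w * of_bool (A i t w = fst z \<and> S i t w = snd z)" for w
  have f: "f \<in> borel_measurable (past i t)"
    unfolding f_def using Y(1) past_measurable_hit by (rule borel_measurable_times)
  then have [measurable]: "f \<in> borel_measurable M"
    by (rule measurable_from_subalg[rotated]) (rule subalgebra_past)
  have fb: "\<bar>f w\<bar> \<le> C" for w using Y(2)[of w] order.trans[OF abs_ge_zero Y(2)[of w]] by (simp add: f_def)
  have "AE w in M. \<bar>R i t w\<bar> \<le> B" using R_bound by blast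
  then have "AE w in M. norm (f w * R i t w) \<le> C * B"
  proof eventually_elim
    case (elim w)
    then show ?case using mult_mono[OF fb[of w] elim order.trans[OF abs_ge_zero fb[of w]] abs_ge_zero]
      by (simp add: abs_mult)
  qed
  then have "expectation (\<lambda>w. f w * R i t w) = expectation (\<lambda>w. f w * real_cond_exp M (past i t) (R i t) w)"
    by (intro H.real_cond_exp_intg(2)[symmetric] f integrable_const_bound[where B="C * B"]) auto
  also have "\<dots> = expectation (\<lambda>w. r (fst z) (snd z) * f w)"
  proof (rule integral_cong_AE)
    have "AE w in M. real_cond_exp M (past i t) (R i t) w = r (A i t w) (S i t w)"
      using mdp by (auto simp: mdp_trajectory_def Let_def X_def)
    then show "AE w in M. f w * real_cond_exp M (past i t) (R i t) w = r (fst z) (snd z) * f w"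
      by eventually_elim (auto simp: f_def)
  qed auto
  finally show ?thesis by (simp add: f_def prod_eq_iff)
qed

section \<open>Bounded features of a transition and their means\<close>

definition hit :: "('s, 'a) transition \<Rightarrow> 'a \<times> 's \<Rightarrow> real" where
  "hit x z = of_bool (fst (snd x) = fst z) * of_bool (fst x = snd z)"

text \<open>The probability, given the observed next state, that the target policy continues with
  the pair z. Summing it against Q over \<open>F\<close> gives the policy expectation in a temporal
  difference.\<close>

definition nxt :: "('s, 'a) transition \<Rightarrow> 'a \<times> 's \<Rightarrow> real" where
  "nxt x z = of_bool (snd (snd (snd x)) = snd z) * pmf (pol (snd z)) (fst z)"

definition clip :: "real \<Rightarrow> real" where "clip u = max (- B) (min B u)"

text \<open>\<open>b\<close> and \<open>e\<close> are the features for \<open>err_step\<close>; rewards are clipped to make \<open>e\<close> bounded everywhere.\<close>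

definition b :: "('s, 'a) transition \<Rightarrow> 'a \<times> 's \<Rightarrow> 'a \<times> 's \<Rightarrow> real" where
  "b x z' z'' = hit x z' * (of_bool (z'' = z') - \<gamma> * nxt x z'')"

definition e :: "('s, 'a) transition \<Rightarrow> 'a \<times> 's \<Rightarrow> real" where
  "e x z' = hit x z' * (clip (fst (snd (snd x))) + \<gamma> * (\<Sum>z''\<in>F. nxt x z'' * Qpi z'') - Qpi z')"

lemma hit_measurable [measurable]: "(\<lambda>x. hit x z) \<in> borel_measurable transition_space"
  unfolding hit_def by measurable

lemma nxt_measurable [measurable]: "(\<lambda>x. nxt x z) \<in> borel_measurable transition_space"
  unfolding nxt_def by measurable

lemma clip_measurable [measurable]: "clip \<in> borel_measurable borel"
  unfolding clip_def by measurable

lemma b_measurable [measurable]: "(\<lambda>x. b x z' z'') \<in> borel_measurable transition_space"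
  unfolding b_def by measurable

lemma e_measurable [measurable]: "(\<lambda>x. e x z) \<in> borel_measurable transition_space"
  unfolding e_def by measurable

lemma hit_nxt_bounds: "0 \<le> hit x z" "hit x z \<le> 1" "0 \<le> nxt x z" "nxt x z \<le> 1"
  by (auto simp: hit_def nxt_def pmf_le_1)

lemma abs_hit_nxt: "\<bar>hit y z\<bar> \<le> 1" "\<bar>nxt y z\<bar> \<le> 1"
  using hit_nxt_bounds[of y z] by auto

lemma b_bound: "\<bar>b x z' z''\<bar> \<le> 1"
proof -
  have "\<gamma> * nxt x z'' \<le> 1" "0 \<le> \<gamma> * nxt x z''"
    using hit_nxt_bounds[of x z''] discount by (auto intro: mult_le_one)
  then have "\<bar>of_bool (z'' = z') - \<gamma> * nxt x z''\<bar> \<le> 1" by auto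
  then show ?thesis using hit_nxt_bounds[of x z'] by (auto simp: b_def abs_mult intro: mult_le_one)
qed

definition e_bd :: real where "e_bd = B + real (card F) * (c * B) + c * B"

lemma e_bound: "\<bar>e x z\<bar> \<le> e_bd"
proof -
  have "\<bar>nxt x z'' * Qpi z''\<bar> \<le> 1 * (c * B)" for z''
    unfolding abs_mult using Qpi_bound hit_nxt_bounds[of x z''] by (intro mult_mono) auto
  then have n: "\<bar>\<Sum>z''\<in>F. nxt x z'' * Qpi z''\<bar> \<le> real (card F) * (c * B)"
    by (intro order.trans[OF sum_abs] sum_bounded_above) simp
  have "\<bar>\<gamma> * (\<Sum>z''\<in>F. nxt x z'' * Qpi z'')\<bar> \<le> 1 * (real (card F) * (c * B))"
    unfolding abs_mult using discount n by (intro mult_mono) auto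
  moreover have "\<bar>clip (fst (snd (snd x)))\<bar> \<le> B" using B_pos by (auto simp: clip_def)
  ultimately have "\<bar>clip (fst (snd (snd x))) + \<gamma> * (\<Sum>z''\<in>F. nxt x z'' * Qpi z'') - Qpi z\<bar> \<le> e_bd"
    using Qpi_bound[of z] unfolding e_bd_def by linarith
  then have "\<bar>e x z\<bar> \<le> 1 * e_bd"
    unfolding e_def abs_mult using hit_nxt_bounds[of x z] by (intro mult_mono) auto
  then show ?thesis by simp
qed

lemma e_bd_pos: "0 < e_bd"
  unfolding e_bd_def using B_pos discount' by (intro add_nonneg_pos add_nonneg_nonneg mult_nonneg_nonneg mult_pos_pos) auto

lemma hit_tn: "hit (tn i t w) z = of_bool (Z i t w = z)"
  by (cases z) (auto simp: hit_def transitions_def)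

lemma expectation_nxt:
  fixes Y :: "'w \<Rightarrow> real"
  assumes Y: "Y \<in> borel_measurable (past i t)" "\<And>w. \<bar>Y w\<bar> \<le> C"
  shows "expectation (\<lambda>w. Y w * (hit (tn i t w) z' * nxt (tn i t w) z''))
     = pmf (step z') z'' * expectation (\<lambda>w. Y w * hit (tn i t w) z')"
proof -
  have "expectation (\<lambda>w. Y w * (hit (tn i t w) z' * nxt (tn i t w) z''))
    = expectation (\<lambda>w. pmf (pol (snd z'')) (fst z'') * (Y w * of_bool (Z i t w = z') * of_bool (S i (Suc t) w = snd z'')))"
    by (intro Bochner_Integration.integral_cong refl, simp only: hit_tn) (simp add: nxt_def transitions_def)
  also have "\<dots> = pmf (pol (snd z'')) (fst z'') * (pmf (p (fst z') (snd z')) (snd z'') * expectation (\<lambda>w. Y w * of_bool (Z i t w = z')))"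
    by (simp only: integral_mult_right_zero expectation_next_state[OF Y])
  also have "\<dots> = pmf (step z') z'' * expectation (\<lambda>w. Y w * hit (tn i t w) z')"
    using pmf_start_law[of pol "p (fst z') (snd z')" "fst z''" "snd z''"] by (simp add: step_def hit_tn ac_simps)
  finally show ?thesis .
qed

text \<open>Conditionally on the past and on the pair z', the mean of \<open>e\<close> is the
  Bellman residual of \<open>Qpi\<close> at z', which is zero. Clipping changes the rewards only on
  a null set.\<close>

lemma expectation_e:
  fixes Y :: "'w \<Rightarrow> real"
  assumes Y: "Y \<in> borel_measurable (past i t)" "\<And>w. \<bar>Y w\<bar> \<le> C" and z': "z' \<in> F"
  shows "expectation (\<lambda>w. Y w * e (tn i t w) z') = 0"
proof -
  have [measurable]: "Y \<in> borel_measurable M"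
    by (rule measurable_from_subalg[OF subalgebra_past Y(1)])
  have C: "0 \<le> C" using Y(2) order.trans[OF abs_ge_zero] by blast
  have int: "integrable M (\<lambda>w. Y w * f w)" if [measurable]: "f \<in> borel_measurable M" and "\<And>w. \<bar>f w\<bar> \<le> D" for f D
    using that(2) Y(2) C by (intro integrable_const_bound[where B="C * D"]) (auto simp: abs_mult intro!: mult_mono)
  have clipB: "\<bar>clip u\<bar> \<le> B" for u using B_pos by (auto simp: clip_def)
  let ?E = "expectation (\<lambda>w. Y w * hit (tn i t w) z')"
  have r: "expectation (\<lambda>w. Y w * (hit (tn i t w) z' * clip (R i t w))) = r (fst z') (snd z') * ?E"
  proof -
    have "AE w in M. \<bar>R i t w\<bar> \<le> B" using R_bound by blast
    then have "expectation (\<lambda>w. Y w * (hit (tn i t w) z' * clip (R i t w)))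
      = expectation (\<lambda>w. Y w * of_bool (Z i t w = z') * R i t w)"
      by (intro integral_cong_AE) (auto simp: hit_tn clip_def)
    also have "\<dots> = r (fst z') (snd z') * ?E"
      unfolding hit_tn by (rule expectation_reward[OF Y])
    finally show ?thesis .
  qed
  have i1: "integrable M (\<lambda>w. Y w * (hit (tn i t w) z' * clip (R i t w)))"
  proof (rule int)
    show "\<bar>hit (tn i t w) z' * clip (R i t w)\<bar> \<le> 1 * B" for w
      unfolding abs_mult by (intro mult_mono abs_hit_nxt clipB) auto
  qed measurable
  have i2: "integrable M (\<lambda>w. Y w * (hit (tn i t w) z' * nxt (tn i t w) z''))" for z''
  proof (rule int)
    show "\<bar>hit (tn i t w) z' * nxt (tn i t w) z''\<bar> \<le> 1" for w
      unfolding abs_mult by (intro mult_le_one abs_hit_nxt) auto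
  qed measurable
  have i3: "integrable M (\<lambda>w. Y w * hit (tn i t w) z')"
    by (rule int[OF _ abs_hit_nxt(1)]) measurable
  have split: "Y w * e (tn i t w) z' = Y w * (hit (tn i t w) z' * clip (R i t w))
      + \<gamma> * (\<Sum>z''\<in>F. Qpi z'' * (Y w * (hit (tn i t w) z' * nxt (tn i t w) z'')))
      - Qpi z' * (Y w * hit (tn i t w) z')" for w
  proof -
    have "(\<Sum>z''\<in>F. Qpi z'' * (Y w * (hit (tn i t w) z' * nxt (tn i t w) z'')))
       = Y w * hit (tn i t w) z' * (\<Sum>z''\<in>F. nxt (tn i t w) z'' * Qpi z'')"
      unfolding sum_distrib_left by (intro sum.cong refl) (simp only: ac_simps)
    moreover have "fst (snd (snd (tn i t w))) = R i t w" by (simp add: transitions_def)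
    moreover have "y * (h * (k + g * u - q)) = y * (h * k) + g * (y * h * u) - q * (y * h)" for y h k g u q :: real
      by (simp add: algebra_simps)
    ultimately show ?thesis unfolding e_def by (simp only:)
  qed
  have h1: "has_bochner_integral M (\<lambda>w. Y w * (hit (tn i t w) z' * clip (R i t w))) (r (fst z') (snd z') * ?E)"
    using has_bochner_integral_integrable[OF i1] unfolding r .
  have h2: "has_bochner_integral M (\<lambda>w. Y w * (hit (tn i t w) z' * nxt (tn i t w) z'')) (pmf (step z') z'' * ?E)" for z''
    using has_bochner_integral_integrable[OF i2] unfolding expectation_nxt[OF Y] .
  note h3 = has_bochner_integral_integrable[OF i3]
  have "expectation (\<lambda>w. Y w * e (tn i t w) z') = r (fst z') (snd z') * ?E
      + \<gamma> * (\<Sum>z''\<in>F. Qpi z'' * (pmf (step z') z'' * ?E)) - Qpi z' * ?E"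
    unfolding split
    by (intro has_bochner_integral_integral_eq has_bochner_integral_diff has_bochner_integral_add
        has_bochner_integral_mult_right has_bochner_integral_sum h1 h2 h3)
  also have "\<dots> = (r (fst z') (snd z') + \<gamma> * (\<Sum>z''\<in>F. pmf (step z') z'' * Qpi z'') - Qpi z') * ?E"
  proof -
    have "(\<Sum>z''\<in>F. Qpi z'' * (pmf (step z') z'' * ?E)) = (\<Sum>z''\<in>F. pmf (step z') z'' * Qpi z'') * ?E"
      unfolding sum_distrib_right by (intro sum.cong refl) (simp only: ac_simps)
    then show ?thesis by (simp only: left_diff_distrib distrib_right mult.assoc)
  qed
  also have "\<dots> = 0" using Bellman[OF z'] by simp
  finally show ?thesis .
qed

lemma expectation_b: "expectation (\<lambda>w. b (tn i t w) z' z'') = Bm z' z''"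
proof -
  have h: "expectation (\<lambda>w. hit (tn i t w) z') = pmf pinf z'"
  proof -
    have "expectation (\<lambda>w. hit (tn i t w) z') = expectation (indicator {w \<in> space M. Z i t w = z'})"
      by (intro Bochner_Integration.integral_cong) (auto simp: hit_tn indicator_def)
    then show ?thesis using prob_Z by simp
  qed
  have n: "expectation (\<lambda>w. hit (tn i t w) z' * nxt (tn i t w) z'') = pmf (step z') z'' * pmf pinf z'"
    using expectation_nxt[of "\<lambda>_. 1" i t 1 z' z''] h by simp
  have i1: "integrable M (\<lambda>w. hit (tn i t w) z' * nxt (tn i t w) z'')"
    by (rule integrable_const_bound[where B=1], rule AE_I2) (simp_all add: abs_mult abs_hit_nxt mult_le_one)
  have i2: "integrable M (\<lambda>w. hit (tn i t w) z')"
    by (rule integrable_const_bound[where B=1], rule AE_I2) (simp_all add: abs_hit_nxt)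
  have "b y z' z'' = of_bool (z'' = z') * hit y z' - \<gamma> * (hit y z' * nxt y z'')" for y
    unfolding b_def by algebra
  then have "expectation (\<lambda>w. b (tn i t w) z' z'')
     = expectation (\<lambda>w. of_bool (z'' = z') * hit (tn i t w) z' - \<gamma> * (hit (tn i t w) z' * nxt (tn i t w) z''))"
    by (simp only:)
  also have "\<dots> = of_bool (z'' = z') * pmf pinf z' - \<gamma> * (pmf (step z') z'' * pmf pinf z')"
    by (subst Bochner_Integration.integral_diff) (use i1 i2 in \<open>simp_all only: integrable_mult_right integral_mult_right_zero h n\<close>)
  also have "\<dots> = Bm z' z''"
    unfolding Bm_def by (cases "z' = z''") (auto simp: algebra_simps)
  finally show ?thesis .
qed

text \<open>An observed next state almost surely lies in the support of the kernel at a pair of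
  \<open>F\<close>, and \<open>F\<close> is closed under steps of the target chain. Policy
  expectations at next states are therefore sums over \<open>F\<close>.\<close>

lemma AE_next: "AE w in M. \<forall>a'\<in>set_pmf (pol (S i (Suc t) w)). (a', S i (Suc t) w) \<in> F"
proof -
  have "AE w in M. \<forall>z s'. z \<in> F \<longrightarrow> pmf (p (fst z) (snd z)) s' = 0 \<longrightarrow> \<not> (Z i t w = z \<and> S i (Suc t) w = s')"
    unfolding AE_all_countable
  proof (intro allI)
    fix z s'
    show "AE w in M. z \<in> F \<longrightarrow> pmf (p (fst z) (snd z)) s' = 0 \<longrightarrow> \<not> (Z i t w = z \<and> S i (Suc t) w = s')"
    proof (cases "pmf (p (fst z) (snd z)) s' = 0")
      case True
      have "prob {w \<in> space M. Z i t w = z \<and> S i (Suc t) w = s'}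
         = expectation (indicator {w \<in> space M. Z i t w = z \<and> S i (Suc t) w = s'})" by simp
      also have "\<dots> = expectation (\<lambda>w. 1 * of_bool (Z i t w = z) * of_bool (S i (Suc t) w = s'))"
        by (intro Bochner_Integration.integral_cong) (auto simp: indicator_def)
      also have "\<dots> = 0"
        using True by (subst expectation_next_state[where C=1]) auto
      finally have "prob {w \<in> space M. Z i t w = z \<and> S i (Suc t) w = s'} = 0" .
      then have "AE w in M. w \<notin> {w \<in> space M. Z i t w = z \<and> S i (Suc t) w = s'}"
        by (subst (asm) prob_eq_0) auto
      then show ?thesis using AE_space by eventually_elim auto
    qed simp
  qed
  then show ?thesis using AE_Z[of i t]
  proof eventually_elim
    case (elim w)
    then have "S i (Suc t) w \<in> set_pmf (p (A i t w) (S i t w))" by (auto simp: set_pmf_iff)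
    moreover have "set_pmf (step (Z i t w)) \<subseteq> F" using elim by (intro set_step)
    ultimately show ?case by (auto simp: step_def set_start_law)
  qed
qed

end

subsection \<open>Second moments and products of scores\<close>

text \<open>The exponent is the distance of t and t' written without a truncated difference. There
  is one geometric series on each side of t, and the diagonal is counted in both.\<close>

lemma sum_power_dist_le:
  fixes \<rho> :: real
  assumes "0 < \<rho>" "\<rho> < 1"
  shows "(\<Sum>t'<T. \<rho> ^ (max t t' - min t t')) \<le> 2 / (1 - \<rho>)"
proof -
  have geo: "(\<Sum>k\<in>K. \<rho> ^ k) \<le> 1 / (1 - \<rho>)" if "finite K" for K
    using sum_le_suminf[of "\<lambda>k. \<rho> ^ k" K] that assms by (simp add: summable_geometric suminf_geometric)
  have "(\<Sum>t'<T. \<rho> ^ (max t t' - min t t'))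
     \<le> (\<Sum>t'<T. (if t' \<le> t then \<rho> ^ (t - t') else 0) + (if t \<le> t' then \<rho> ^ (t' - t) else 0))"
    using assms by (intro sum_mono) (auto simp: max_def min_def)
  also have "\<dots> = (\<Sum>t'\<in>{..<T} \<inter> {..t}. \<rho> ^ (t - t')) + (\<Sum>t'\<in>{..<T} \<inter> {t..}. \<rho> ^ (t' - t))"
    by (simp add: sum.distrib sum.If_cases atMost_def atLeast_def)
  also have "(\<Sum>t'\<in>{..<T} \<inter> {..t}. \<rho> ^ (t - t')) = (\<Sum>k\<in>(\<lambda>t'. t - t') ` ({..<T} \<inter> {..t}). \<rho> ^ k)"
    by (subst sum.reindex) (auto simp: inj_on_def)
  also have "(\<Sum>t'\<in>{..<T} \<inter> {t..}. \<rho> ^ (t' - t)) = (\<Sum>k\<in>(\<lambda>t'. t' - t) ` ({..<T} \<inter> {t..}). \<rho> ^ k)"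
    by (subst sum.reindex) (auto simp: inj_on_def)
  finally show ?thesis
    using geo[of "(\<lambda>t'. t - t') ` ({..<T} \<inter> {..t})"] geo[of "(\<lambda>t'. t' - t) ` ({..<T} \<inter> {t..})"] by simp
qed

context ope_data
begin

lemma expectation_independent:
  fixes \<phi> \<psi> :: "_ \<Rightarrow> real"
  assumes [measurable]: "\<phi> \<in> borel_measurable transition_space" "\<psi> \<in> borel_measurable transition_space"
    and bd: "\<And>y. \<bar>\<phi> y\<bar> \<le> D" "\<And>y. \<bar>\<psi> y\<bar> \<le> D" and "i \<noteq> j"
  shows "expectation (\<lambda>w. \<phi> (tn i t w) * \<psi> (tn j t' w)) = expectation (\<lambda>w. \<phi> (tn i t w)) * expectation (\<lambda>w. \<psi> (tn j t' w))"
proof -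
  \<comment> \<open>A single family indexed by trajectories, as independence requires: \<phi> sits
    at i and \<psi> at the other index.\<close>
  define f where "f k = (if k = i then \<lambda>\<xi>. \<phi> (tr t \<xi>) else (\<lambda>\<xi>. \<psi> (tr t' \<xi>)))" for k
  have [measurable]: "f k \<in> borel_measurable paths" for k
    by (simp add: f_def)
  have "indep_vars (\<lambda>_. paths) (\<lambda>i w t. X i t w) UNIV"
    using iid by (simp add: iid_trajectories_def)
  then have ind: "indep_vars (\<lambda>_. borel) (\<lambda>k w. f k (\<lambda>t. X k t w)) {i, j}"
    by (rule indep_vars_compose2[OF indep_vars_subset]) auto
  have "integrable M (\<lambda>w. f k (\<lambda>t. X k t w))" for k
    using bd by (intro integrable_const_bound[where B=D]) (auto simp: f_def)
  with indep_vars_lebesgue_integral[OF _ ind] \<open>i \<noteq> j\<close> show ?thesis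
    by (simp add: f_def tn_tr)
qed

text \<open>Different trajectories are independent with mean zero and contribute nothing. Within a
  trajectory each row of the covariance matrix is a two-sided geometric series, so the sum grows
  linearly in the number of terms. The decay is a hypothesis so that it can come either from mixing
  or from the martingale property.\<close>

lemma second_moment_sum:
  fixes \<phi> :: "_ \<Rightarrow> real"
  assumes [measurable]: "\<phi> \<in> borel_measurable transition_space"
    and bd: "\<And>y. \<bar>\<phi> y\<bar> \<le> D" and zero: "expectation (\<lambda>w. \<phi> (tn 0 0 w)) = 0"
    and \<rho>: "0 < \<rho>" "\<rho> < 1"
    and cov: "\<And>t q. \<bar>expectation (\<lambda>w. \<phi> (tn 0 t w) * \<phi> (tn 0 (t + q) w))\<bar> \<le> C * \<rho> ^ q"
    and I: "finite I"
  shows "expectation (\<lambda>w. (\<Sum>ii\<in>I \<times> {..<T}. \<phi> (tn (fst ii) (snd ii) w))\<^sup>2) \<le> C * (2 / (1 - \<rho>)) * real (card (I \<times> {..<T}))"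
proof -
  let ?E = "\<lambda>i t j t'. expectation (\<lambda>w. \<phi> (tn i t w) * \<phi> (tn j t' w))"
  have C: "0 \<le> C" using order.trans[OF abs_ge_zero cov[of 0 0]] by simp
  have int: "integrable M (\<lambda>w. \<phi> (tn i t w) * \<phi> (tn j t' w))" for i t j t'
    using bd order.trans[OF abs_ge_zero bd]
    by (intro integrable_const_bound[where B="D * D"] AE_I2) (simp_all add: abs_mult mult_mono)
  have E: "?E i t j t' \<le> (if i = j then C * \<rho> ^ (max t t' - min t t') else 0)" for i t j t'
  proof (cases "i = j")
    case False
    then show ?thesis
      using expectation_independent[of \<phi> \<phi> D i j t t'] bd zero expectation_transition[of \<phi> i t] by simp
  next
    case True
    have "\<bar>?E i t i t'\<bar> \<le> C * \<rho> ^ (max t t' - min t t')"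
    proof (cases "t \<le> t'")
      case True
      then show ?thesis using cov[of t "t' - t"] expectation_transitions[of \<phi> \<phi> i t 0 t'] by (simp add: max_def min_def)
    next
      case False
      have "?E i t i t' = ?E i t' i t" by (simp only: mult.commute)
      then show ?thesis using False cov[of t' "t - t'"] expectation_transitions[of \<phi> \<phi> i t' 0 t] by (simp add: max_def min_def)
    qed
    then show ?thesis using True by simp
  qed
  have "expectation (\<lambda>w. (\<Sum>ii\<in>I \<times> {..<T}. \<phi> (tn (fst ii) (snd ii) w))\<^sup>2)
     = expectation (\<lambda>w. \<Sum>ii\<in>I \<times> {..<T}. \<Sum>ii'\<in>I \<times> {..<T}. \<phi> (tn (fst ii) (snd ii) w) * \<phi> (tn (fst ii') (snd ii') w))"
    by (simp only: power2_eq_square sum_product)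
  also have "\<dots> = (\<Sum>ii\<in>I \<times> {..<T}. \<Sum>ii'\<in>I \<times> {..<T}. ?E (fst ii) (snd ii) (fst ii') (snd ii'))"
    by (intro has_bochner_integral_integral_eq has_bochner_integral_sum has_bochner_integral_integrable int)
  also have "\<dots> \<le> (\<Sum>ii\<in>I \<times> {..<T}. \<Sum>ii'\<in>I \<times> {..<T}. if fst ii = fst ii' then C * \<rho> ^ (max (snd ii) (snd ii') - min (snd ii) (snd ii')) else 0)"
    by (intro sum_mono E)
  also have "\<dots> \<le> (\<Sum>ii\<in>I \<times> {..<T}. C * (2 / (1 - \<rho>)))"
  proof (intro sum_mono)
    fix ii assume ii: "ii \<in> I \<times> {..<T}"
    have "(\<Sum>ii'\<in>I \<times> {..<T}. if fst ii = fst ii' then C * \<rho> ^ (max (snd ii) (snd ii') - min (snd ii) (snd ii')) else 0)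
       = (\<Sum>j\<in>I. \<Sum>t'<T. if fst ii = j then C * \<rho> ^ (max (snd ii) t' - min (snd ii) t') else 0)"
      by (simp add: sum.cartesian_product case_prod_unfold)
    also have "\<dots> = (\<Sum>j\<in>I. if fst ii = j then (\<Sum>t'<T. C * \<rho> ^ (max (snd ii) t' - min (snd ii) t')) else 0)"
      by (intro sum.cong) auto
    also have "\<dots> = C * (\<Sum>t'<T. \<rho> ^ (max (snd ii) t' - min (snd ii) t'))"
      using ii I by (auto simp: sum_distrib_left)
    also have "\<dots> \<le> C * (2 / (1 - \<rho>))"
      using C by (intro mult_left_mono sum_power_dist_le \<rho>)
    finally show "(\<Sum>ii'\<in>I \<times> {..<T}. if fst ii = fst ii' then C * \<rho> ^ (max (snd ii) (snd ii') - min (snd ii) (snd ii')) else 0)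
       \<le> C * (2 / (1 - \<rho>))" .
  qed
  also have "\<dots> = C * (2 / (1 - \<rho>)) * real (card (I \<times> {..<T}))" by simp
  finally show ?thesis .
qed

lemma mixing_covariance:
  fixes \<phi> :: "_ \<Rightarrow> real"
  assumes [measurable]: "\<phi> \<in> borel_measurable transition_space"
    and bd: "\<And>y. \<bar>\<phi> y\<bar> \<le> D" and zero: "expectation (\<lambda>w. \<phi> (tn 0 0 w)) = 0"
  shows "\<exists>\<rho> C. 0 < \<rho> \<and> \<rho> < 1 \<and>
    (\<forall>t q. \<bar>expectation (\<lambda>w. \<phi> (tn 0 t w) * \<phi> (tn 0 (t + q) w))\<bar> \<le> C * \<rho> ^ q)"
proof -
  obtain \<rho> C where \<rho>: "0 < \<rho>" "\<rho> < 1" and C: "0 < C" "\<And>q. beta_mixing_coeff M (X 0) q \<le> C * \<rho> ^ q"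
    using exp_beta_mixing_bound[of "X 0"] mixing by auto
  have D: "0 \<le> D" using bd order.trans[OF abs_ge_zero] by blast
  define C' where "C' = D * D + 2 * (D + 1)\<^sup>2 * C / \<rho>"
  have "\<bar>expectation (\<lambda>w. \<phi> (tn 0 t w) * \<phi> (tn 0 (t + q) w))\<bar> \<le> C' * \<rho> ^ q" for t q
  proof (cases q)
    case 0
    have "\<bar>expectation (\<lambda>w. \<phi> (tn 0 t w) * \<phi> (tn 0 t w))\<bar> \<le> expectation (\<lambda>w. \<bar>\<phi> (tn 0 t w) * \<phi> (tn 0 t w)\<bar>)"
      by (rule integral_abs_bound)
    also have "\<dots> \<le> D * D"
    proof (rule integral_le_const)
      have bb: "\<bar>\<phi> y * \<phi> y\<bar> \<le> D * D" for y unfolding abs_mult using bd D by (intro mult_mono) auto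
      show "AE w in M. \<bar>\<phi> (tn 0 t w) * \<phi> (tn 0 t w)\<bar> \<le> D * D"
        by (intro AE_I2 bb)
      show "integrable M (\<lambda>w. \<bar>\<phi> (tn 0 t w) * \<phi> (tn 0 t w)\<bar>)"
        by (rule integrable_const_bound[where B="D * D"], rule AE_I2, unfold real_norm_def abs_idempotent, rule bb) measurable
    qed
    also have "\<dots> \<le> C' * \<rho> ^ q" using 0 C \<rho> by (simp add: C'_def)
    finally show ?thesis using 0 by simp
  next
    case (Suc k)
    \<comment> \<open>A transition at time t reaches to the state at t + 1, so the gap between the
      two algebras is only k = q - 1. The lost step is the division by \<rho> in \<open>C'\<close>,
      while its summand D * D covers q = 0.\<close>
    let ?F = "sub_algebra M (X 0) {..Suc t}" and ?H = "sub_algebra M (X 0) {Suc t + k..}"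
    have m1: "tn 0 t \<in> measurable ?F transition_space"
      by (intro measurable_transition measurable_sub_algebra measurable_sub_algebra_Z measurable_X) auto
    have m2: "tn 0 (t + q) \<in> measurable ?H transition_space"
      by (intro measurable_transition measurable_sub_algebra measurable_sub_algebra_Z measurable_X) (auto simp: Suc)
    have "\<bar>expectation (\<lambda>w. \<phi> (tn 0 t w) * \<phi> (tn 0 (t + q) w)) - expectation (\<lambda>w. \<phi> (tn 0 t w)) * expectation (\<lambda>w. \<phi> (tn 0 (t + q) w))\<bar>
       \<le> 2 * (D + 1)\<^sup>2 * beta_dep M ?F ?H"
      using measurable_compose[OF m1, of \<phi> borel] measurable_compose[OF m2, of \<phi> borel] bd
      by (intro covariance_beta sets_sub_algebra) auto
    also have "expectation (\<lambda>w. \<phi> (tn 0 t w)) = 0" using expectation_transition[of \<phi> 0 t] zero by simp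
    also have "2 * (D + 1)\<^sup>2 * beta_dep M ?F ?H \<le> 2 * (D + 1)\<^sup>2 * (C * \<rho> ^ k)"
      by (intro mult_left_mono order.trans[OF beta_mixing_upper(1) C(2)]) auto
    also have "\<dots> = 2 * (D + 1)\<^sup>2 * C / \<rho> * \<rho> ^ q" using \<rho> by (simp add: Suc)
    also have "\<dots> \<le> C' * \<rho> ^ q" using \<rho> D by (intro mult_right_mono) (auto simp: C'_def)
    finally show ?thesis by simp
  qed
  then show ?thesis using \<rho> by blast
qed

lemma second_moment_mixing:
  fixes \<phi> :: "_ \<Rightarrow> real"
  assumes [measurable]: "\<phi> \<in> borel_measurable transition_space" and bd: "\<And>y. \<bar>\<phi> y\<bar> \<le> D"
  shows "\<exists>C\<ge>0. \<forall>I T. finite I \<longrightarrow> expectation (\<lambda>w. (\<Sum>ii\<in>I \<times> {..<T}.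
      \<phi> (tn (fst ii) (snd ii) w) - expectation (\<lambda>w. \<phi> (tn 0 0 w)))\<^sup>2) \<le> C * real (card (I \<times> {..<T}))"
proof -
  define \<mu> where "\<mu> = expectation (\<lambda>w. \<phi> (tn 0 0 w))"
  have int: "integrable M (\<lambda>w. \<phi> (tn 0 0 w))" using bd by (intro integrable_const_bound[where B=D]) auto
  have bd': "\<bar>\<phi> y - \<mu>\<bar> \<le> D + \<bar>\<mu>\<bar>" for y using bd[of y] by linarith
  have zero: "expectation (\<lambda>w. \<phi> (tn 0 0 w) - \<mu>) = 0" using int by (simp add: \<mu>_def prob_space)
  obtain \<rho> C where \<rho>: "0 < \<rho>" "\<rho> < 1"
    and C: "\<And>t q. \<bar>expectation (\<lambda>w. (\<phi> (tn 0 t w) - \<mu>) * (\<phi> (tn 0 (t + q) w) - \<mu>))\<bar> \<le> C * \<rho> ^ q"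
    using mixing_covariance[of "\<lambda>y. \<phi> y - \<mu>", OF _ bd' zero] by auto
  have "0 \<le> C" using order.trans[OF abs_ge_zero C[of 0 0]] by simp
  then have "0 \<le> C * (2 / (1 - \<rho>))" using \<rho> by simp
  moreover have "expectation (\<lambda>w. (\<Sum>ii\<in>I \<times> {..<T}. \<phi> (tn (fst ii) (snd ii) w) - \<mu>)\<^sup>2)
      \<le> C * (2 / (1 - \<rho>)) * real (card (I \<times> {..<T}))" if "finite I" for I T
    using second_moment_sum[of "\<lambda>y. \<phi> y - \<mu>", OF _ bd' zero \<rho> C that] by simp
  ultimately show ?thesis unfolding \<mu>_def by blast
qed

lemma past_measurable_e: "(\<lambda>w. e (tn i j w) z) \<in> borel_measurable (past i t)" if "j < t"
  using measurable_compose[OF past_measurable_tn[OF that] e_measurable] .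

lemma second_moment_e:
  assumes z: "z \<in> F"
  shows "\<exists>C\<ge>0. \<forall>I T. finite I \<longrightarrow> expectation (\<lambda>w. (\<Sum>ii\<in>I \<times> {..<T}.
      e (tn (fst ii) (snd ii) w) z)\<^sup>2) \<le> C * real (card (I \<times> {..<T}))"
proof -
  have zero: "expectation (\<lambda>w. e (tn 0 0 w) z) = 0"
    using expectation_e[of "\<lambda>_. 1" 0 0 1 z] z by simp
  \<comment> \<open>All covariances with q > 0 vanish, so the ratio 1 / 2 is an arbitrary
    choice.\<close>
  have cov: "\<bar>expectation (\<lambda>w. e (tn 0 t w) z * e (tn 0 (t + q) w) z)\<bar> \<le> (e_bd * e_bd) * (1 / 2) ^ q" for t q
  proof (cases q)
    case 0
    have bd: "\<bar>e y z * e y z\<bar> \<le> e_bd * e_bd" for y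
      unfolding abs_mult using e_bound e_bd_pos by (intro mult_mono) auto
    have "\<bar>expectation (\<lambda>w. e (tn 0 t w) z * e (tn 0 t w) z)\<bar> \<le> expectation (\<lambda>w. \<bar>e (tn 0 t w) z * e (tn 0 t w) z\<bar>)"
      by (rule integral_abs_bound)
    also have "\<dots> \<le> e_bd * e_bd"
      using bd by (intro integral_le_const integrable_const_bound[where B="e_bd * e_bd"]) auto
    finally show ?thesis using 0 by simp
  next
    case (Suc k)
    then have "expectation (\<lambda>w. e (tn 0 t w) z * e (tn 0 (t + q) w) z) = 0"
      using z by (intro expectation_e[where C=e_bd] past_measurable_e e_bound) auto
    then show ?thesis using e_bd_pos by simp
  qed
  have "expectation (\<lambda>w. (\<Sum>ii\<in>I \<times> {..<T}. e (tn (fst ii) (snd ii) w) z)\<^sup>2)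
      \<le> (e_bd * e_bd) * (2 / (1 - 1 / 2)) * real (card (I \<times> {..<T}))" if "finite I" for I T
    by (rule second_moment_sum[OF _ e_bound zero _ _ cov that]) auto
  moreover have "0 \<le> (e_bd * e_bd) * (2 / (1 - 1 / 2))" using e_bd_pos by simp
  ultimately show ?thesis by blast
qed

text \<open>The influence function of the estimator: on transitions that occur it is c times
  \<omega> times the temporal difference at the true Q-function. Written through \<open>e\<close> it
  is bounded on all transitions.\<close>

definition y\<^sub>0 :: "('s, 'a) transition \<Rightarrow> real" where
  "y\<^sub>0 x = c * (\<Sum>z\<in>F. \<omega> z * e x z)"

definition y_bd :: real where "y_bd = c * (real (card F) * (B * e_bd))"

text \<open>The asymptotic variance; the second moment is a variance because scores have mean
  zero.\<close>

definition \<sigma>2 :: real where "\<sigma>2 = expectation (\<lambda>w. (y\<^sub>0 (tn 0 0 w))\<^sup>2)"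

lemma y0_measurable [measurable]: "y\<^sub>0 \<in> borel_measurable transition_space"
  unfolding y\<^sub>0_def by measurable

lemma omega_bound: "z \<in> F \<Longrightarrow> \<bar>\<omega> z\<bar> \<le> B"
  using ratio_bound by (auto simp: \<omega>_def)

lemma tau_bound: "z \<in> F \<Longrightarrow> z' \<in> F \<Longrightarrow> \<bar>\<tau> z z'\<bar> \<le> B"
  using ratio_bound by (cases z, cases z') (fastforce simp: \<tau>_def)

lemma y0_bound: "\<bar>y\<^sub>0 x\<bar> \<le> y_bd"
proof -
  have "\<bar>\<omega> z * e x z\<bar> \<le> B * e_bd" if "z \<in> F" for z
    unfolding abs_mult using omega_bound[OF that] e_bound B_pos by (intro mult_mono) auto
  then have "\<bar>\<Sum>z\<in>F. \<omega> z * e x z\<bar> \<le> real (card F) * (B * e_bd)"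
    by (intro order.trans[OF sum_abs] sum_bounded_above) auto
  then show ?thesis unfolding y\<^sub>0_def y_bd_def abs_mult using discount' by (intro mult_mono) auto
qed

text \<open>Induction on the last factor: the product of the earlier factors is measurable for the
  past of time T, so its product with the last score has expectation zero and only the summand 1 of
  the last factor survives.\<close>

lemma expectation_product_trajectory:
  "expectation (\<lambda>w. \<Prod>t<T. 1 + \<i> * of_real (u * y\<^sub>0 (tn i t w))) = 1"
proof (induction T)
  case 0
  then show ?case by (simp add: prob_space)
next
  case (Suc T)
  define P where "P w = (\<Prod>t<T. 1 + \<i> * of_real (u * y\<^sub>0 (tn i t w)))" for w
  have bd: "cmod (1 + \<i> * of_real (u * y\<^sub>0 x)) \<le> 1 + \<bar>u\<bar> * y_bd" for x
  proof -
    have "\<bar>u * y\<^sub>0 x\<bar> \<le> \<bar>u\<bar> * y_bd" unfolding abs_mult by (intro mult_left_mono y0_bound) auto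
    then show ?thesis
      using norm_triangle_ineq[of 1 "\<i> * of_real (u * y\<^sub>0 x)"] by (simp add: norm_mult)
  qed
  have Pb: "cmod (P w) \<le> (1 + \<bar>u\<bar> * y_bd) ^ T" for w
  proof -
    have "cmod (P w) = (\<Prod>t<T. cmod (1 + \<i> * of_real (u * y\<^sub>0 (tn i t w))))"
      by (simp only: P_def prod_norm)
    also have "\<dots> \<le> (\<Prod>t<T. 1 + \<bar>u\<bar> * y_bd)"
      by (intro prod_mono conjI norm_ge_zero bd)
    finally show ?thesis by simp
  qed
  have yp: "(\<lambda>w. y\<^sub>0 (tn i t w)) \<in> borel_measurable (past i T)" if "t < T" for t
    using measurable_compose[OF past_measurable_tn[OF that] y0_measurable] .
  have Pm: "P \<in> borel_measurable (past i T)"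
    unfolding P_def using yp by (intro borel_measurable_prod borel_measurable_add borel_measurable_times
      borel_measurable_const borel_measurable_of_real) auto
  then have [measurable]: "P \<in> borel_measurable M"
    by (rule measurable_from_subalg[OF subalgebra_past])
  \<comment> \<open>Past weights in \<open>expectation_e\<close> are real, so the complex product is
    treated through h = Re and h = Im.\<close>
  have part: "expectation (\<lambda>w. h (P w) * y\<^sub>0 (tn i T w)) = 0"
    if h: "h \<in> borel_measurable borel" "\<And>x. \<bar>h x\<bar> \<le> cmod x" for h :: "complex \<Rightarrow> real"
  proof -
    have hm: "(\<lambda>w. h (P w)) \<in> borel_measurable (past i T)" by (rule measurable_compose[OF Pm h(1)])
    have hb: "\<bar>h (P w)\<bar> \<le> (1 + \<bar>u\<bar> * y_bd) ^ T" for w using h(2) Pb order.trans by blast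
    have [measurable]: "(\<lambda>w. h (P w)) \<in> borel_measurable M"
      by (rule measurable_from_subalg[OF subalgebra_past hm])
    have int: "integrable M (\<lambda>w. h (P w) * e (tn i T w) z)" for z
    proof (rule integrable_const_bound[where B="(1 + \<bar>u\<bar> * y_bd) ^ T * e_bd"])
      show "AE w in M. norm (h (P w) * e (tn i T w) z) \<le> (1 + \<bar>u\<bar> * y_bd) ^ T * e_bd"
        unfolding real_norm_def abs_mult
        using order.trans[OF abs_ge_zero hb] by (intro AE_I2 mult_mono hb e_bound) auto
    qed measurable
    have "(\<lambda>w. h (P w) * y\<^sub>0 (tn i T w)) = (\<lambda>w. \<Sum>z\<in>F. (c * \<omega> z) * (h (P w) * e (tn i T w) z))"
      unfolding y\<^sub>0_def sum_distrib_left by (simp only: ac_simps)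
    then have "expectation (\<lambda>w. h (P w) * y\<^sub>0 (tn i T w)) = (\<Sum>z\<in>F. (c * \<omega> z) * expectation (\<lambda>w. h (P w) * e (tn i T w) z))"
      using int by (simp only: integral_mult_right_zero Bochner_Integration.integral_sum integrable_mult_right)
    also have "\<dots> = 0" using expectation_e[OF hm hb] by simp
    finally show ?thesis .
  qed
  have iP: "integrable M P" using Pb by (intro integrable_const_bound[where B="(1 + \<bar>u\<bar> * y_bd) ^ T"]) auto
  have iPy: "integrable M (\<lambda>w. P w * of_real (y\<^sub>0 (tn i T w)))"
  proof (rule integrable_const_bound[where B="(1 + \<bar>u\<bar> * y_bd) ^ T * y_bd"])
    show "AE w in M. cmod (P w * of_real (y\<^sub>0 (tn i T w))) \<le> (1 + \<bar>u\<bar> * y_bd) ^ T * y_bd"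
      unfolding norm_mult norm_of_real
      using order.trans[OF norm_ge_zero Pb] by (intro AE_I2 mult_mono Pb y0_bound) auto
  qed measurable
  have "expectation (\<lambda>w. P w * of_real (y\<^sub>0 (tn i T w))) = 0"
  proof (rule complex_eqI)
    show "Re (expectation (\<lambda>w. P w * of_real (y\<^sub>0 (tn i T w)))) = Re 0"
      using part[of Re] by (simp add: integral_Re[OF iPy, symmetric] abs_Re_le_cmod)
    show "Im (expectation (\<lambda>w. P w * of_real (y\<^sub>0 (tn i T w)))) = Im 0"
      using part[of Im] by (simp add: integral_Im[OF iPy, symmetric] abs_Im_le_cmod)
  qed
  moreover have "(\<lambda>w. \<Prod>t<Suc T. 1 + \<i> * of_real (u * y\<^sub>0 (tn i t w)))
     = (\<lambda>w. P w + (\<i> * of_real u) * (P w * of_real (y\<^sub>0 (tn i T w))))"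
    by (rule ext) (simp add: P_def algebra_simps)
  moreover have "expectation P = 1" using Suc.IH unfolding P_def .
  ultimately show ?case
    using iP iPy by (simp only: Bochner_Integration.integral_add integrable_mult_right integral_mult_right_zero) simp
qed

lemma expectation_product:
  "expectation (\<lambda>w. \<Prod>ii\<in>{..<n} \<times> {..<T}. 1 + \<i> * of_real (u * y\<^sub>0 (tn (fst ii) (snd ii) w))) = 1"
proof -
  define h where "h \<xi> = (\<Prod>t<T. 1 + \<i> * of_real (u * y\<^sub>0 (tr t \<xi>)))" for \<xi>
  have [measurable]: "h \<in> borel_measurable paths"
    unfolding h_def by measurable
  have hx: "h (\<lambda>t. X i t w) = (\<Prod>t<T. 1 + \<i> * of_real (u * y\<^sub>0 (tn i t w)))" for i w
    by (simp only: h_def tn_tr)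
  have "indep_vars (\<lambda>_. paths) (\<lambda>i w t. X i t w) UNIV"
    using iid by (simp add: iid_trajectories_def)
  then have ind: "indep_vars (\<lambda>_. borel) (\<lambda>i w. h (\<lambda>t. X i t w)) {..<n}"
    by (rule indep_vars_compose2[OF indep_vars_subset]) auto
  have int: "integrable M (\<lambda>w. h (\<lambda>t. X i t w))" for i
  proof (rule ccontr)
    \<comment> \<open>The integral of a function that is not integrable is 0 by convention, whereas
      this one is already known to be 1.\<close>
    assume "\<not> integrable M (\<lambda>w. h (\<lambda>t. X i t w))"
    then have "expectation (\<lambda>w. h (\<lambda>t. X i t w)) = 0" by (rule not_integrable_integral_eq)
    then show False using expectation_product_trajectory[of u i T] by (simp only: hx) simp
  qed
  have "(\<Prod>ii\<in>{..<n} \<times> {..<T}. 1 + \<i> * of_real (u * y\<^sub>0 (tn (fst ii) (snd ii) w))) = (\<Prod>i<n. h (\<lambda>t. X i t w))" for w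
    unfolding hx by (subst prod.cartesian_product) (simp only: case_prod_unfold)
  then have "expectation (\<lambda>w. \<Prod>ii\<in>{..<n} \<times> {..<T}. 1 + \<i> * of_real (u * y\<^sub>0 (tn (fst ii) (snd ii) w)))
     = expectation (\<lambda>w. \<Prod>i<n. h (\<lambda>t. X i t w))" by (simp only:)
  also have "\<dots> = (\<Prod>i<n. expectation (\<lambda>w. h (\<lambda>t. X i t w)))"
    by (rule indep_vars_lebesgue_integral[OF _ ind int]) simp
  also have "\<dots> = 1" by (simp only: hx expectation_product_trajectory prod.neutral_const)
  finally show ?thesis .
qed

text \<open>The pointwise conditions under which clipping rewards and summing over \<open>F\<close>
  change nothing. They hold for all transitions at once outside a null set, so the algebra of the
  estimator can be done for fixed data.\<close>

definition valid :: "('s, 'a) transition \<Rightarrow> bool" where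
  "valid x \<longleftrightarrow> (case x of (s, a, \<rho>, s') \<Rightarrow>
     (a, s) \<in> F \<and> \<bar>\<rho>\<bar> \<le> B \<and> (\<forall>a'\<in>set_pmf (pol s'). (a', s') \<in> F))"

lemma AE_valid: "AE w in M. \<forall>i t. valid (tn i t w)"
  unfolding AE_all_countable
proof (intro allI)
  fix i t
  have "AE w in M. \<bar>R i t w\<bar> \<le> B" using R_bound by blast
  then show "AE w in M. valid (tn i t w)"
    using AE_Z[of i t] AE_next[of i t] by eventually_elim (simp add: valid_def transitions_def)
qed

text \<open>A temporal difference is affine in Q: \<open>e\<close> is its value at
  \<open>Qpi\<close>, and \<open>b\<close> applied to Q - \<open>Qpi\<close> is the change. The
  factor \<open>hit\<close> reduces the sum over z' to the visited pair, so an arbitrary weight u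
  can be carried along; it will be a ratio estimate.\<close>

lemma temporal_difference:
  assumes "valid (s, a, \<rho>, s')"
  shows "(\<Sum>z'\<in>F. u z' * (e (s, a, \<rho>, s') z' - (\<Sum>z''\<in>F. b (s, a, \<rho>, s') z' z'' * (Q (fst z'') (snd z'') - Qpi z''))))
     = u (a, s) * (\<rho> + \<gamma> * measure_pmf.expectation (pol s') (\<lambda>a'. Q a' s') - Q a s)"
proof -
  let ?x = "(s, a, \<rho>, s')"
  have z: "(a, s) \<in> F" and \<rho>: "clip \<rho> = \<rho>" and v: "\<And>a'. a' \<in> set_pmf (pol s') \<Longrightarrow> (a', s') \<in> F"
    using assms by (auto simp: valid_def clip_def)
  have fin: "finite F" by (rule finite_F)
  have hit: "hit ?x z' = of_bool (z' = (a, s))" for z'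
    by (cases z') (auto simp: hit_def)
  have "(\<Sum>z''\<in>F. nxt ?x z'' * Q (fst z'') (snd z'')) = (\<Sum>z''\<in>F. pmf (start_law pol (return_pmf s')) z'' * Q (fst z'') (snd z''))"
  proof (intro sum.cong refl)
    fix z'' :: "'a \<times> 's"
    show "nxt ?x z'' * Q (fst z'') (snd z'') = pmf (start_law pol (return_pmf s')) z'' * Q (fst z'') (snd z'')"
      by (cases z'') (simp add: nxt_def pmf_start_law indicator_def)
  qed
  also have "\<dots> = measure_pmf.expectation (pol s') (\<lambda>a'. Q a' s')"
    using v by (subst expectation_policy[symmetric]) auto
  finally have E: "(\<Sum>z''\<in>F. nxt ?x z'' * Q (fst z'') (snd z'')) = measure_pmf.expectation (pol s') (\<lambda>a'. Q a' s')" .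
  have bsum: "(\<Sum>z''\<in>F. b ?x (a, s) z'' * (Q (fst z'') (snd z'') - Qpi z''))
    = Q a s - Qpi (a, s) - \<gamma> * ((\<Sum>z''\<in>F. nxt ?x z'' * Q (fst z'') (snd z'')) - (\<Sum>z''\<in>F. nxt ?x z'' * Qpi z''))"
  proof -
    have "b ?x (a, s) z'' * (Q (fst z'') (snd z'') - Qpi z'')
      = (if z'' = (a, s) then Q a s - Qpi (a, s) else 0) - \<gamma> * (nxt ?x z'' * Q (fst z'') (snd z'')) + \<gamma> * (nxt ?x z'' * Qpi z'')" for z''
      by (cases "z'' = (a, s)") (simp_all add: b_def hit left_diff_distrib right_diff_distrib)
    then have "(\<Sum>z''\<in>F. b ?x (a, s) z'' * (Q (fst z'') (snd z'') - Qpi z''))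
      = (\<Sum>z''\<in>F. if z'' = (a, s) then Q a s - Qpi (a, s) else 0)
        - (\<Sum>z''\<in>F. \<gamma> * (nxt ?x z'' * Q (fst z'') (snd z''))) + (\<Sum>z''\<in>F. \<gamma> * (nxt ?x z'' * Qpi z''))"
      by (simp only: sum.distrib sum_subtractf)
    also have "(\<Sum>z''\<in>F. if z'' = (a, s) then Q a s - Qpi (a, s) else 0) = Q a s - Qpi (a, s)"
      using fin z by simp
    finally show ?thesis by (simp only: sum_distrib_left[symmetric] right_diff_distrib)
  qed
  define U where "U z' = u z' * (e ?x z' - (\<Sum>z''\<in>F. b ?x z' z'' * (Q (fst z'') (snd z'') - Qpi z'')))" for z'
  have "U z' = 0" if "z' \<noteq> (a, s)" for z'
  proof -
    have "e ?x z' = 0" "b ?x z' z'' = 0" for z'' using that by (simp_all add: e_def b_def hit)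
    then show ?thesis by (simp add: U_def)
  qed
  then have "(\<Sum>z'\<in>F. U z') = U (a, s)"
    using sum.remove[OF fin z, of U] by (simp add: sum.neutral)
  also have "U (a, s) = u (a, s) * (e ?x (a, s) - (\<Sum>z''\<in>F. b ?x (a, s) z'' * (Q (fst z'') (snd z'') - Qpi z'')))"
    by (rule U_def)
  also have "e ?x (a, s) = \<rho> + \<gamma> * (\<Sum>z''\<in>F. nxt ?x z'' * Qpi z'') - Qpi (a, s)"
    by (simp add: e_def hit \<rho>)
  finally show ?thesis unfolding U_def bsum E by (simp add: algebra_simps)
qed

lemma sigma2_pos: "0 < \<sigma>2"
proof (rule ccontr)
  assume "\<not> 0 < \<sigma>2"
  moreover have "0 \<le> \<sigma>2" unfolding \<sigma>2_def by simp
  ultimately have zero: "expectation (\<lambda>w. (y\<^sub>0 (tn 0 0 w))\<^sup>2) = 0" unfolding \<sigma>2_def by linarith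
  have "\<bar>(y\<^sub>0 x)\<^sup>2\<bar> \<le> y_bd\<^sup>2" for x
    using y0_bound[of x] by (simp add: abs_le_square_iff[symmetric])
  then have "integrable M (\<lambda>w. (y\<^sub>0 (tn 0 0 w))\<^sup>2)"
    by (intro integrable_const_bound[where B="y_bd\<^sup>2"] AE_I2) auto
  from integral_nonneg_eq_0_iff_AE[OF this] zero have "AE w in M. y\<^sub>0 (tn 0 0 w) = 0" by simp
  then have "AE w in M. \<omega> (Z 0 0 w) *
             (R 0 0 w - Qpi (Z 0 0 w) + \<gamma> * measure_pmf.expectation (pol (S 0 1 w)) (\<lambda>a. Qpi (a, S 0 1 w))) = 0"
    using AE_valid
  proof eventually_elim
    case (elim w)
    have v: "valid (S 0 0 w, A 0 0 w, R 0 0 w, S 0 1 w)" using elim(2) by (simp add: transitions_def)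
    have "(\<Sum>z\<in>F. \<omega> z * e (tn 0 0 w) z) = 0" using elim(1) discount' by (simp add: y\<^sub>0_def)
    then show ?case
      using temporal_difference[OF v, of \<omega> "\<lambda>a s. Qpi (a, s)"]
      by (simp add: transitions_def algebra_simps)
  qed
  then show False using nondegenerate by (simp add: \<omega>_def Qpi_def)
qed

end

subsection \<open>Boundedness in probability\<close>

context prob_space
begin

text \<open>
  Boundedness in probability, stated with exceptional events so that it makes sense for
  functions that are not known to be measurable.
\<close>

definition tight :: "(nat \<Rightarrow> 'a \<Rightarrow> real) \<Rightarrow> bool" where
  "tight Y \<longleftrightarrow> (\<forall>\<epsilon>>0. \<exists>C. \<forall>\<^sub>F j in sequentially. \<exists>E\<in>sets M. prob E \<le> \<epsilon> \<and> (\<forall>w\<in>space M - E. \<bar>Y j w\<bar> \<le> C))"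

lemma tight_add:
  assumes "tight Y" "tight Y'"
  shows "tight (\<lambda>j w. Y j w + Y' j w)"
  unfolding tight_def
proof (intro allI impI)
  fix \<epsilon> :: real assume \<epsilon>: "0 < \<epsilon>"
  obtain C where C: "\<forall>\<^sub>F j in sequentially. \<exists>E\<in>sets M. prob E \<le> \<epsilon> / 2 \<and> (\<forall>w\<in>space M - E. \<bar>Y j w\<bar> \<le> C)"
    using assms(1) \<epsilon> unfolding tight_def by (meson half_gt_zero)
  obtain C' where C': "\<forall>\<^sub>F j in sequentially. \<exists>E\<in>sets M. prob E \<le> \<epsilon> / 2 \<and> (\<forall>w\<in>space M - E. \<bar>Y' j w\<bar> \<le> C')"
    using assms(2) \<epsilon> unfolding tight_def by (meson half_gt_zero)
  have "\<forall>\<^sub>F j in sequentially. \<exists>E\<in>sets M. prob E \<le> \<epsilon> \<and> (\<forall>w\<in>space M - E. \<bar>Y j w + Y' j w\<bar> \<le> C + C')"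
    using C C'
  proof eventually_elim
    case (elim j)
    then obtain E E' where E: "E \<in> sets M" "prob E \<le> \<epsilon> / 2" "\<forall>w\<in>space M - E. \<bar>Y j w\<bar> \<le> C"
      and E': "E' \<in> sets M" "prob E' \<le> \<epsilon> / 2" "\<forall>w\<in>space M - E'. \<bar>Y' j w\<bar> \<le> C'" by blast
    have "prob (E \<union> E') \<le> \<epsilon>" using measure_Un_le[OF E(1) E'(1)] E(2) E'(2) by linarith
    moreover have "\<bar>Y j w + Y' j w\<bar> \<le> C + C'" if "w \<in> space M - (E \<union> E')" for w
      using E(3) E'(3) that by (intro order.trans[OF abs_triangle_ineq] add_mono) auto
    ultimately show ?case using E(1) E'(1) by (intro bexI[of _ "E \<union> E'"]) auto
  qed
  then show "\<exists>C. \<forall>\<^sub>F j in sequentially. \<exists>E\<in>sets M. prob E \<le> \<epsilon> \<and> (\<forall>w\<in>space M - E. \<bar>Y j w + Y' j w\<bar> \<le> C)"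
    by blast
qed

lemma tight_sum:
  assumes "finite I" "\<And>i. i \<in> I \<Longrightarrow> tight (\<lambda>j w. Y i j w)"
  shows "tight (\<lambda>j w. \<Sum>i\<in>I. Y i j w)"
  using assms
proof (induction I rule: finite_induct)
  case empty
  then show ?case unfolding tight_def by (intro allI impI exI[of _ 0] always_eventually bexI[of _ "{}"]) auto
next
  case (insert i I)
  then have "tight (\<lambda>j w. Y i j w + (\<Sum>i\<in>I. Y i j w))" by (intro tight_add) auto
  then show ?case using insert by simp
qed

lemma tight_abs: "tight (\<lambda>j w. \<bar>Y j w\<bar>) \<longleftrightarrow> tight Y"
  by (simp add: tight_def)

lemma tight_AE:
  assumes "\<forall>\<^sub>F j in sequentially. AE w in M. \<bar>Y j w\<bar> \<le> C"
  shows "tight Y"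
  unfolding tight_def
proof (intro allI impI exI)
  fix \<epsilon> :: real assume \<epsilon>: "0 < \<epsilon>"
  show "\<forall>\<^sub>F j in sequentially. \<exists>E\<in>sets M. prob E \<le> \<epsilon> \<and> (\<forall>w\<in>space M - E. \<bar>Y j w\<bar> \<le> C)"
    using assms
  proof eventually_elim
    case (elim j)
    from AE_E[OF elim] obtain E where "{w \<in> space M. \<not> \<bar>Y j w\<bar> \<le> C} \<subseteq> E" "emeasure M E = 0" "E \<in> sets M" .
    then show ?case using \<epsilon> by (intro bexI[of _ E]) (auto simp: measure_def)
  qed
qed

lemma chebyshev_second_moment:
  fixes Y :: "'a \<Rightarrow> real"
  assumes [measurable]: "Y \<in> borel_measurable M" and "integrable M (\<lambda>w. (Y w)\<^sup>2)"
    and "expectation (\<lambda>w. (Y w)\<^sup>2) \<le> V" "0 < C"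
  shows "prob {w \<in> space M. C < \<bar>Y w\<bar>} \<le> V / C\<^sup>2"
proof -
  have "prob {w \<in> space M. C < \<bar>Y w\<bar>} \<le> prob {w \<in> space M. C\<^sup>2 \<le> (Y w)\<^sup>2}"
    using assms(4) by (intro finite_measure_mono) (auto simp: abs_le_square_iff[symmetric])
  also have "\<dots> \<le> expectation (\<lambda>w. (Y w)\<^sup>2) / C\<^sup>2"
    using assms by (intro integral_Markov_inequality_measure[where A="space M"]) auto
  also have "\<dots> \<le> V / C\<^sup>2" using assms by (intro divide_right_mono) auto
  finally show ?thesis .
qed

lemma tight_second_moment:
  assumes "\<forall>\<^sub>F j in sequentially. Y j \<in> borel_measurable M \<and> integrable M (\<lambda>w. (Y j w)\<^sup>2)
    \<and> expectation (\<lambda>w. (Y j w)\<^sup>2) \<le> V"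
  shows "tight Y"
  unfolding tight_def
proof (intro allI impI)
  fix \<epsilon> :: real assume \<epsilon>: "0 < \<epsilon>"
  \<comment> \<open>Chosen so that the Chebyshev bound equals \<epsilon>; the maximum with 1 keeps C
    positive.\<close>
  define C where "C = sqrt (max V 1 / \<epsilon>)"
  have C: "0 < C" "max V 1 / C\<^sup>2 = \<epsilon>" using \<epsilon> by (auto simp: C_def)
  have "\<forall>\<^sub>F j in sequentially. \<exists>E\<in>sets M. prob E \<le> \<epsilon> \<and> (\<forall>w\<in>space M - E. \<bar>Y j w\<bar> \<le> C)"
    using assms
  proof eventually_elim
    case (elim j)
    have [measurable]: "Y j \<in> borel_measurable M" using elim by blast
    have "prob {w \<in> space M. C < \<bar>Y j w\<bar>} \<le> max V 1 / C\<^sup>2"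
      using elim C by (intro chebyshev_second_moment) auto
    then show ?case using C by (intro bexI[of _ "{w \<in> space M. C < \<bar>Y j w\<bar>}"]) auto
  qed
  then show "\<exists>C. \<forall>\<^sub>F j in sequentially. \<exists>E\<in>sets M. prob E \<le> \<epsilon> \<and> (\<forall>w\<in>space M - E. \<bar>Y j w\<bar> \<le> C)" by blast
qed

end

section \<open>Random divisions and averages over folds\<close>

lemma finite_fold_assignments: "finite (fold_assignments n K)"
  unfolding fold_assignments_def by (rule finite_subset[of _ "{..<n} \<rightarrow>\<^sub>E {..<K}"]) (auto intro: finite_PiE)

context ope_data
begin

abbreviation data_algebra :: "'w measure" where
  "data_algebra \<equiv> vimage_algebra (space M) (\<lambda>w i t. X i t w) (PiM UNIV (\<lambda>_. PiM UNIV (\<lambda>_. obs_space)))"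

lemma measurable_tn_data_algebra: "tn i t \<in> measurable data_algebra transition_space"
proof -
  have g: "(\<lambda>w i t. X i t w) \<in> measurable data_algebra (PiM UNIV (\<lambda>_. PiM UNIV (\<lambda>_. obs_space)))"
    by (rule measurable_vimage_algebra1)
      (auto simp: space_PiM[of UNIV "\<lambda>_. paths"] intro: measurable_space[OF measurable_path])
  have X: "X i t \<in> measurable data_algebra obs_space" for i t
    using measurable_compose[OF measurable_compose[OF g measurable_component_singleton[of i UNIV]]
        measurable_component_singleton[of t UNIV]] by simp
  have "S i (Suc t) \<in> measurable data_algebra (count_space UNIV)"
    using measurable_compose[OF X measurable_obs_fst] by (simp add: X_def)
  then show ?thesis by (intro measurable_transition X)
qed

lemma subalgebra_data_algebra: "subalgebra M data_algebra"
proof -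
  have "(\<lambda>w i t. X i t w) \<in> measurable M (PiM UNIV (\<lambda>_. paths))"
    by (rule measurable_PiM_single') (auto intro: measurable_space[OF measurable_path])
  from sets_image_in_sets[OF refl this] show ?thesis by (simp add: subalgebra_def)
qed

text \<open>
  A random division is independent of the data, so second moments that are bounded uniformly over
  all deterministic divisions give tightness along the random ones.
\<close>

lemma tight_random_division:
  assumes div: "\<forall>j. random_division M X (n j) K (f j)"
    and m: "\<And>j g. g \<in> fold_assignments (n j) K \<Longrightarrow> h j g \<in> borel_measurable data_algebra"
    and i: "\<And>j g. g \<in> fold_assignments (n j) K \<Longrightarrow> integrable M (\<lambda>w. (h j g w)\<^sup>2)"
    and V: "\<And>j g. g \<in> fold_assignments (n j) K \<Longrightarrow> expectation (\<lambda>w. (h j g w)\<^sup>2) \<le> V"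
  shows "tight (\<lambda>j w. h j (f j w) w)"
  unfolding tight_def
proof (intro allI impI)
  fix \<epsilon> :: real assume \<epsilon>: "0 < \<epsilon>"
  define C where "C = sqrt (max V 1 / \<epsilon>)"
  have C: "0 < C" "max V 1 / C\<^sup>2 = \<epsilon>" using \<epsilon> by (auto simp: C_def)
  have "\<exists>E\<in>sets M. prob E \<le> \<epsilon> \<and> (\<forall>w\<in>space M - E. \<bar>h j (f j w) w\<bar> \<le> C)" for j
  proof -
    let ?G = "fold_assignments (n j) K"
    have fm [measurable]: "f j \<in> measurable M (count_space ?G)"
      and ind: "indep_set (sets (vimage_algebra (space M) (f j) (count_space ?G))) (sets data_algebra)"
      using div by (auto simp: random_division_def)
    have fG: "f j w \<in> ?G" if "w \<in> space M" for w using measurable_space[OF fm that] by simp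
    define a where "a g = {w \<in> space M. f j w = g}" for g
    define d where "d g = {w \<in> space M. C < \<bar>h j g w\<bar>}" for g
    have aV: "a g \<in> sets (vimage_algebra (space M) (f j) (count_space ?G))" if "g \<in> ?G" for g
    proof -
      have "a g = f j -` {g} \<inter> space M" by (auto simp: a_def)
      moreover have "f j -` {g} \<inter> space M \<in> sets (vimage_algebra (space M) (f j) (count_space ?G))"
        using that by (intro in_vimage_algebra) simp
      ultimately show ?thesis by simp
    qed
    have aM: "a g \<in> sets M" if "g \<in> ?G" for g
    proof -
      have "a g = f j -` {g} \<inter> space M" by (auto simp: a_def)
      then show ?thesis using measurable_sets[OF fm, of "{g}"] that by simp
    qed
    have dD: "d g \<in> sets data_algebra" if "g \<in> ?G" for g
    proof -
      note [measurable] = m[OF that]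
      have "{w \<in> space data_algebra. C < \<bar>h j g w\<bar>} \<in> sets data_algebra" by measurable
      then show ?thesis by (simp add: d_def)
    qed
    have dp: "prob (d g) \<le> \<epsilon>" if "g \<in> ?G" for g
    proof -
      have "h j g \<in> borel_measurable M"
        by (rule measurable_from_subalg[OF subalgebra_data_algebra m[OF that]])
      then have "prob (d g) \<le> max V 1 / C\<^sup>2"
        unfolding d_def using i[OF that] V[OF that] C by (intro chebyshev_second_moment) auto
      then show ?thesis using C by simp
    qed
    \<comment> \<open>Only the exceptional event of the division that is actually drawn counts. By
      independence its probability is at most the average of the probabilities of the
      \<open>d g\<close>, each at most \<epsilon>.\<close>
    define E where "E = (\<Union>g\<in>?G. a g \<inter> d g)"
    have adM: "a g \<inter> d g \<in> sets M" if "g \<in> ?G" for g 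
      using subalgebra_data_algebra aM[OF that] dD[OF that] unfolding subalgebra_def by blast
    have "prob E \<le> (\<Sum>g\<in>?G. prob (a g \<inter> d g))"
      unfolding E_def by (intro finite_measure_subadditive_finite finite_fold_assignments image_subsetI adM)
    also have "\<dots> = (\<Sum>g\<in>?G. prob (a g) * prob (d g))"
      using ind aV dD by (intro sum.cong refl indep_setD)
    also have "\<dots> \<le> (\<Sum>g\<in>?G. prob (a g) * \<epsilon>)"
      using dp by (intro sum_mono mult_left_mono) auto
    also have "\<dots> = (\<Sum>g\<in>?G. prob (a g)) * \<epsilon>" by (simp add: sum_distrib_right)
    also have "(\<Sum>g\<in>?G. prob (a g)) = prob (\<Union>g\<in>?G. a g)"
      using aM by (intro finite_measure_finite_Union[symmetric] finite_fold_assignments)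
        (auto simp: disjoint_family_on_def a_def)
    also have "\<dots> * \<epsilon> \<le> 1 * \<epsilon>" using \<epsilon> by (intro mult_right_mono) auto
    finally have "prob E \<le> \<epsilon>" by simp
    moreover have "E \<in> sets M" unfolding E_def by (intro sets.finite_UN finite_fold_assignments adM)
    moreover have "\<bar>h j (f j w) w\<bar> \<le> C" if "w \<in> space M - E" for w
    proof (rule ccontr)
      assume "\<not> \<bar>h j (f j w) w\<bar> \<le> C"
      then have "w \<in> E" 
        unfolding E_def using that fG[of w] by (intro UN_I[of "f j w"]) (simp_all add: a_def d_def)
      then show False using that by simp
    qed
    ultimately show ?thesis by blast
  qed
  then show "\<exists>C. \<forall>\<^sub>F j in sequentially. \<exists>E\<in>sets M. prob E \<le> \<epsilon> \<and> (\<forall>w\<in>space M - E. \<bar>h j (f j w) w\<bar> \<le> C)"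
    by (intro exI[of _ C] always_eventually allI)
qed

lemma in_fold_nonempty:
  assumes "g \<in> fold_assignments n K" "k < K"
  shows "finite (in_fold n g k)" "in_fold n g k \<noteq> {}"
proof -
  show "finite (in_fold n g k)" by (simp add: in_fold_def)
  have "k \<in> g ` {..<n}" using assms by (auto simp: fold_assignments_def)
  then show "in_fold n g k \<noteq> {}" by (auto simp: in_fold_def)
qed

definition fold_avg :: "nat set \<Rightarrow> nat \<Rightarrow> (('s, 'a) transition \<Rightarrow> real) \<Rightarrow> 'w \<Rightarrow> real" where
  "fold_avg I T \<phi> w = (\<Sum>ii\<in>I \<times> {..<T}. \<phi> (tn (fst ii) (snd ii) w)) / real (card (I \<times> {..<T}))"

text \<open>Scaled by the root of the size of its own fold, the deviation has second moment at most
  V for every fixed division, however small the fold.\<close>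

lemma tight_fold_avg:
  assumes div: "\<forall>j. random_division M X (n j) K (f j)" and k: "k < K" and T: "\<forall>j. 1 \<le> T j"
    and [measurable]: "\<phi> \<in> borel_measurable transition_space" and bd: "\<And>x. \<bar>\<phi> x\<bar> \<le> D"
    and V: "\<And>I T. finite I \<Longrightarrow> expectation (\<lambda>w. (\<Sum>ii\<in>I \<times> {..<T}. \<phi> (tn (fst ii) (snd ii) w) - \<mu>)\<^sup>2)
        \<le> V * real (card (I \<times> {..<T}))"
  shows "tight (\<lambda>j w. sqrt (real (card (in_fold (n j) (f j w) k \<times> {..<T j})))
     * (fold_avg (in_fold (n j) (f j w) k) (T j) \<phi> w - \<mu>))"
proof -
  define h where "h j g w = sqrt (real (card (in_fold (n j) g k \<times> {..<T j})))
     * (fold_avg (in_fold (n j) g k) (T j) \<phi> w - \<mu>)" for j g w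
  have "tight (\<lambda>j w. h j (f j w) w)"
  proof (rule tight_random_division[OF div])
    fix j g assume g: "g \<in> fold_assignments (n j) K"
    let ?X = "in_fold (n j) g k \<times> {..<T j}"
    note [measurable] = measurable_tn_data_algebra
    show m: "h j g \<in> borel_measurable data_algebra"
      unfolding h_def fold_avg_def by measurable
    then have [measurable]: "h j g \<in> borel_measurable M"
      by (rule measurable_from_subalg[OF subalgebra_data_algebra])
    have X: "finite ?X" "?X \<noteq> {}" using in_fold_nonempty[OF g k] T[rule_format, of j] by (auto simp: lessThan_empty_iff)
    then have N: "0 < real (card ?X)" by (simp add: card_gt_0_iff del: card_cartesian_product)
    have eq: "h j g w = (\<Sum>ii\<in>?X. \<phi> (tn (fst ii) (snd ii) w) - \<mu>) / sqrt (real (card ?X))" for w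
    proof -
      define r where "r = sqrt (real (card ?X))"
      have r: "real (card ?X) = r * r" "0 < r" using N by (simp_all add: r_def)
      show ?thesis unfolding h_def fold_avg_def r_def[symmetric]
        unfolding r(1) sum_subtractf sum_constant using r(2) by (simp add: r(1) field_simps)
    qed
    have sumb: "\<bar>\<Sum>ii\<in>?X. \<phi> (tn (fst ii) (snd ii) w) - \<mu>\<bar> \<le> real (card ?X) * (D + \<bar>\<mu>\<bar>)" for w
    proof (intro order.trans[OF sum_abs] sum_bounded_above)
      show "\<bar>\<phi> (tn (fst ii) (snd ii) w) - \<mu>\<bar> \<le> D + \<bar>\<mu>\<bar>" for ii
        using bd[of "tn (fst ii) (snd ii) w"] by linarith
    qed
    show "integrable M (\<lambda>w. (h j g w)\<^sup>2)"
    proof (rule integrable_const_bound[where B="(real (card ?X) * (D + \<bar>\<mu>\<bar>))\<^sup>2 / real (card ?X)"])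
      show "AE w in M. norm ((h j g w)\<^sup>2) \<le> (real (card ?X) * (D + \<bar>\<mu>\<bar>))\<^sup>2 / real (card ?X)"
      proof (rule AE_I2)
        fix w
        have "(\<Sum>ii\<in>?X. \<phi> (tn (fst ii) (snd ii) w) - \<mu>)\<^sup>2 \<le> (real (card ?X) * (D + \<bar>\<mu>\<bar>))\<^sup>2"
          using sumb[of w] by (intro power2_le_iff_abs_le[THEN iffD2]) auto
        then show "norm ((h j g w)\<^sup>2) \<le> (real (card ?X) * (D + \<bar>\<mu>\<bar>))\<^sup>2 / real (card ?X)"
          unfolding eq power_divide using N by (simp add: divide_right_mono del: card_cartesian_product)
      qed
    qed measurable
    have "expectation (\<lambda>w. (h j g w)\<^sup>2) = expectation (\<lambda>w. (\<Sum>ii\<in>?X. \<phi> (tn (fst ii) (snd ii) w) - \<mu>)\<^sup>2) / real (card ?X)"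
      unfolding eq power_divide using N by (simp del: card_cartesian_product)
    also have "\<dots> \<le> V * real (card ?X) / real (card ?X)"
      using V[of "in_fold (n j) g k" "T j"] in_fold_nonempty[OF g k] by (intro divide_right_mono) auto
    also have "\<dots> = V" using N by simp
    finally show "expectation (\<lambda>w. (h j g w)\<^sup>2) \<le> V" .
  qed
  then show ?thesis by (simp add: h_def)
qed

end

subsection \<open>The remainder on one fold\<close>

context ope_data
begin

definition kern :: "('a \<Rightarrow> 's \<Rightarrow> 'a \<Rightarrow> 's \<Rightarrow> real) \<Rightarrow> 'a \<times> 's \<Rightarrow> 'a \<times> 's \<Rightarrow> real" where
  "kern \<tau>h z' z = \<tau>h (fst z') (snd z') (fst z) (snd z)"

definition err :: "('a \<Rightarrow> 's \<Rightarrow> real) \<Rightarrow> 'a \<times> 's \<Rightarrow> real" where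
  "err Q z = Q (fst z) (snd z) - Qpi z"

text \<open>This is \<open>temporal_difference\<close> with the column of the ratio estimate at z as
  weight; it explains the form of \<open>err_step\<close>.\<close>

lemma debias_error:
  assumes "valid y"
  shows "err (debias \<gamma> pol \<tau>h y Q) z = err_step c F (kern \<tau>h) (b y) (e y) (err Q) z"
proof -
  obtain s a \<rho> s' where y: "y = (s, a, \<rho>, s')" by (metis prod_cases4)
  have v: "valid (s, a, \<rho>, s')" using assms y by simp
  have "err (debias \<gamma> pol \<tau>h y Q) z = err Q z + c * (kern \<tau>h (a, s) z *
      (\<rho> + \<gamma> * measure_pmf.expectation (pol s') (\<lambda>a'. Q a' s') - Q a s))"
    by (simp add: err_def debias_def y kern_def)
  also have "\<dots> = err_step c F (kern \<tau>h) (b y) (e y) (err Q) z"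
    by (subst temporal_difference[OF v, symmetric]) (simp only: err_step_def y err_def)
  finally show ?thesis .
qed

lemma foldr_debias_error:
  assumes "\<And>i t. (i, t) \<in> set xs \<Longrightarrow> valid (D i t)"
  shows "err (foldr (\<lambda>(i, t). debias \<gamma> pol \<tau>h (D i t)) xs Q) z
     = foldr (\<lambda>ii. err_step c F (kern \<tau>h) (b (D (fst ii) (snd ii))) (e (D (fst ii) (snd ii)))) xs (err Q) z"
  using assms
proof (induction xs arbitrary: z)
  case (Cons ii xs)
  obtain i t where ii: "ii = (i, t)" by (cases ii)
  have v: "valid (D i t)" using Cons.prems ii by auto
  have IH: "err (foldr (\<lambda>(i, t). debias \<gamma> pol \<tau>h (D i t)) xs Q)
    = foldr (\<lambda>ii. err_step c F (kern \<tau>h) (b (D (fst ii) (snd ii))) (e (D (fst ii) (snd ii)))) xs (err Q)"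
    using Cons by auto
  show ?case
    by (simp add: ii debias_error[OF v] IH)
qed simp

text \<open>The favourable event on one fold, which separates probability from algebra. The scales
  a, q, t and t3 belong to the feature averages and to the estimates of Q, \<tau> and \<omega>; C is
  a common constant.\<close>

definition good_fold :: "real \<Rightarrow> real \<Rightarrow> real \<Rightarrow> real \<Rightarrow> real \<Rightarrow> (nat \<times> nat) set \<Rightarrow>
    (nat \<Rightarrow> nat \<Rightarrow> ('s, 'a) transition) \<Rightarrow> ('a \<Rightarrow> 's \<Rightarrow> real) \<Rightarrow> ('a \<Rightarrow> 's \<Rightarrow> 'a \<Rightarrow> 's \<Rightarrow> real) \<Rightarrow>
    ('a \<Rightarrow> 's \<Rightarrow> real) \<Rightarrow> bool" where
  "good_fold C a q t t3 J D Q \<tau>h \<omega>h \<longleftrightarrow> (\<forall>z\<in>F.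
      \<bar>err Q z\<bar> \<le> C * q \<and> \<bar>\<omega>h (fst z) (snd z)\<bar> \<le> C \<and> \<bar>\<omega>h (fst z) (snd z) - \<omega> z\<bar> \<le> C * t3 \<and>
      \<bar>(\<Sum>ii\<in>J. e (D (fst ii) (snd ii)) z) / real (card J)\<bar> \<le> C * a \<and>
      (\<forall>z'\<in>F. \<bar>kern \<tau>h z z'\<bar> \<le> C \<and> \<bar>kern \<tau>h z z' - \<tau> z z'\<bar> \<le> C * t \<and>
        \<bar>(\<Sum>ii\<in>J. b (D (fst ii) (snd ii)) z z') / real (card J) - Bm z z'\<bar> \<le> C * a))"

lemma Bm_bound: "\<bar>Bm z z'\<bar> \<le> 1"
proof -
  have "\<gamma> * pmf (step z) z' \<le> 1" "0 \<le> \<gamma> * pmf (step z) z'"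
    using discount by (auto intro: mult_le_one simp: pmf_le_1)
  then have "\<bar>of_bool (z = z') - \<gamma> * pmf (step z) z'\<bar> \<le> 1" by auto
  then show ?thesis unfolding Bm_def abs_mult by (intro mult_le_one) (auto simp: pmf_le_1)
qed

lemma debiased_Q_error:
  assumes X: "finite I" "I \<times> {..<T} \<noteq> {}" "m - 1 \<le> card (I \<times> {..<T})"
    and valid: "\<And>i t. i \<in> I \<Longrightarrow> t < T \<Longrightarrow> valid (D i t)"
    and C: "1 \<le> C" "e_bd \<le> C"
    and a: "a = 1 / sqrt (real (card (I \<times> {..<T})))" and t: "0 \<le> t" "t \<le> 1" and q: "0 \<le> q" "q \<le> 1"
    and good: "good_fold C a q t t3 (I \<times> {..<T}) D Q \<tau>h \<omega>h" and z: "z \<in> F"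
  shows "\<bar>err (debiased_Q \<gamma> pol I T D \<tau>h Q m) z\<bar> \<le> fold_bound c (real (card F)) C (m - 1) * (a + q * t ^ (m - 1))"
proof -
  let ?X = "I \<times> {..<T}" and ?l = "m - 1"
  let ?L = "{xs. length xs = ?l \<and> distinct xs \<and> set xs \<subseteq> ?X}"
  have fX: "finite ?X" using X by simp
  \<comment> \<open>A prefix of an enumeration is a tuple of distinct indices. Their number is thus
    not zero, and subtracting \<open>Qpi\<close> in \<open>err\<close> passes under the
    average.\<close>
  obtain ys where ys: "set ys = ?X" "distinct ys" using finite_distinct_list[OF fX] by blast
  have "take ?l ys \<in> ?L"
    using ys X(3) by (auto simp: distinct_card[symmetric] dest: in_set_takeD)
  moreover have "finite ?L"
    by (rule finite_subset[OF _ finite_lists_length_eq[OF fX, of ?l]]) auto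
  ultimately have cL: "real (card ?L) \<noteq> 0" by (auto simp: card_eq_0_iff)
  have "err (debiased_Q \<gamma> pol I T D \<tau>h Q m) z
    = (\<Sum>xs\<in>?L. err (foldr (\<lambda>(i, t). debias \<gamma> pol \<tau>h (D i t)) xs Q) z) / real (card ?L)"
    using cL by (simp add: err_def debiased_Q_def index_tuples_def sum_subtractf diff_divide_distrib)
  also have "(\<Sum>xs\<in>?L. err (foldr (\<lambda>(i, t). debias \<gamma> pol \<tau>h (D i t)) xs Q) z)
    = (\<Sum>xs\<in>?L. foldr (\<lambda>ii. err_step c F (kern \<tau>h) (b (D (fst ii) (snd ii))) (e (D (fst ii) (snd ii)))) xs (err Q) z)"
    using valid by (intro sum.cong refl foldr_debias_error) auto
  also have "\<bar>\<dots> / real (card ?L)\<bar> \<le> fold_bound c (real (card F)) C ?l * (a + q * t ^ ?l)"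
  proof (rule distinct_average_bound[where ?\<tau>0.0 = \<tau> and ?b0.0 = Bm])
    show "c * (\<Sum>z'\<in>F. \<tau> z' z * Bm z' z'') = of_bool (z = z'')" if "z \<in> F" for z z''
      using that by (rule tau_Bm)
    show "\<bar>Bm z z'\<bar> \<le> C" for z z' using Bm_bound[of z z'] C by linarith
    show "\<bar>b (D (fst x) (snd x)) z z'\<bar> \<le> C" for x z z' by (rule order.trans[OF b_bound C(1)])
    show "\<bar>e (D (fst x) (snd x)) z\<bar> \<le> C" for x z by (rule order.trans[OF e_bound C(2)])
  qed (use good C discount' z a t q X fX finite_F in \<open>auto simp: good_fold_def\<close>)
  finally show ?thesis .
qed

text \<open>The weight estimate is split into \<omega> and its error, and the expectation under the
  reference distribution into the policy value and the part coming from \<open>err Q\<close>. After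
  averaging over a fold, the coefficient of \<open>err Q\<close> is small by
  \<open>omega_Bm\<close>, so that besides the score only products of small quantities
  remain.\<close>

lemma psi_term_expansion:
  assumes "valid y"
  shows "psi_term \<gamma> pol G \<omega>h Q y = policy_value \<gamma> p r pol G + y\<^sub>0 y
    + (c * (\<Sum>z'\<in>F. (\<omega>h (fst z') (snd z') - \<omega> z') * e y z')
       + (\<Sum>z''\<in>F. (pmf start z'' - c * (\<Sum>z'\<in>F. \<omega>h (fst z') (snd z') * b y z' z'')) * err Q z''))"
proof -
  obtain s a \<rho> s' where y: "y = (s, a, \<rho>, s')" by (metis prod_cases4)
  let ?w = "\<lambda>z'. \<omega>h (fst z') (snd z')"
  have start: "measure_pmf.expectation G (\<lambda>s. measure_pmf.expectation (pol s) (\<lambda>a. Q a s))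
     = (\<Sum>z\<in>F. pmf start z * Q (fst z) (snd z))"
    unfolding start_def using set_start
    by (intro expectation_policy) (auto simp: start_def set_start_law)
  have td: "\<omega>h a s * (\<rho> - Q a s + \<gamma> * measure_pmf.expectation (pol s') (\<lambda>a'. Q a' s'))
     = (\<Sum>z'\<in>F. ?w z' * (e y z' - (\<Sum>z''\<in>F. b y z' z'' * err Q z'')))"
    using temporal_difference[of s a \<rho> s' ?w Q] assms by (simp add: y err_def algebra_simps)
  have swap: "(\<Sum>z'\<in>F. ?w z' * (\<Sum>z''\<in>F. b y z' z'' * err Q z'')) = (\<Sum>z''\<in>F. (\<Sum>z'\<in>F. ?w z' * b y z' z'') * err Q z'')"
    unfolding sum_distrib_left sum_distrib_right by (subst sum.swap) (simp only: mult.assoc)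
  have "psi_term \<gamma> pol G \<omega>h Q y
     = c * (\<Sum>z'\<in>F. ?w z' * (e y z' - (\<Sum>z''\<in>F. b y z' z'' * err Q z''))) + (\<Sum>z\<in>F. pmf start z * Q (fst z) (snd z))"
    unfolding td[symmetric] start[symmetric] by (simp add: psi_term_def y)
  also have "(\<Sum>z\<in>F. pmf start z * Q (fst z) (snd z)) = policy_value \<gamma> p r pol G + (\<Sum>z\<in>F. pmf start z * err Q z)"
    unfolding policy_value_eq err_def by (simp add: right_diff_distrib sum_subtractf)
  also have "(\<Sum>z'\<in>F. ?w z' * (e y z' - (\<Sum>z''\<in>F. b y z' z'' * err Q z'')))
     = (\<Sum>z'\<in>F. ?w z' * e y z') - (\<Sum>z''\<in>F. (\<Sum>z'\<in>F. ?w z' * b y z' z'') * err Q z'')"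
    by (simp only: right_diff_distrib sum_subtractf swap)
  also have "(\<Sum>z'\<in>F. ?w z' * e y z') = (\<Sum>z'\<in>F. \<omega> z' * e y z') + (\<Sum>z'\<in>F. (?w z' - \<omega> z') * e y z')"
    by (simp only: left_diff_distrib sum_subtractf)
  finally have "psi_term \<gamma> pol G \<omega>h Q y = c * ((\<Sum>z'\<in>F. \<omega> z' * e y z') + (\<Sum>z'\<in>F. (?w z' - \<omega> z') * e y z')
     - (\<Sum>z''\<in>F. (\<Sum>z'\<in>F. ?w z' * b y z' z'') * err Q z'')) + (policy_value \<gamma> p r pol G + (\<Sum>z\<in>F. pmf start z * err Q z))" .
  moreover have "(\<Sum>z''\<in>F. (pmf start z'' - c * (\<Sum>z'\<in>F. ?w z' * b y z' z'')) * err Q z'')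
     = (\<Sum>z\<in>F. pmf start z * err Q z) - c * (\<Sum>z''\<in>F. (\<Sum>z'\<in>F. ?w z' * b y z' z'') * err Q z'')"
  proof -
    define k where "k z'' = (\<Sum>z'\<in>F. ?w z' * b y z' z'')" for z''
    show ?thesis unfolding k_def[symmetric]
      by (simp only: left_diff_distrib sum_subtractf sum_distrib_left mult.assoc)
  qed
  ultimately show ?thesis
    unfolding y\<^sub>0_def by (simp only: distrib_left right_diff_distrib)
qed

text \<open>The first summand belongs to the weight error times \<open>e\<close>, the second to the
  coefficient of the Q-error. There the 1 bounds \<open>pmf start\<close> in the pointwise estimate,
  where nothing cancels.\<close>

definition total_bound :: "real \<Rightarrow> nat \<Rightarrow> real" where
  "total_bound C l = c * (real (card F) * (C * C))
     + real (card F) * ((1 + c * (real (card F) * (C * C))) * fold_bound c (real (card F)) C l)"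

lemma fold_bound_nonneg: "0 \<le> C \<Longrightarrow> 0 \<le> fold_bound c (real (card F)) C l"
  unfolding fold_bound_def using discount' by (intro add_nonneg_nonneg mult_nonneg_nonneg iterate_bound_nonneg step_bound_nonneg) auto

definition psi_remainder :: "('a \<Rightarrow> 's \<Rightarrow> real) \<Rightarrow> ('a \<Rightarrow> 's \<Rightarrow> real) \<Rightarrow> ('s, 'a) transition \<Rightarrow> real" where
  "psi_remainder \<omega>h Q y = psi_term \<gamma> pol G \<omega>h Q y - policy_value \<gamma> p r pol G - y\<^sub>0 y"

text \<open>A single remainder is only as small as the errors of the weight and of the debiased
  Q-estimate; this suffices for the sample variance. In the fold average \<open>e\<close> has size
  a, and \<open>omega_Bm\<close> cancels the leading part of the coefficient of the Q-error, so
  every term is a product of two small factors; this is what the sample mean requires.\<close>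

lemma fold_remainder:
  assumes X: "finite I" "I \<times> {..<T} \<noteq> {}" "m - 1 \<le> card (I \<times> {..<T})"
    and valid: "\<And>i t. i \<in> I \<Longrightarrow> t < T \<Longrightarrow> valid (D i t)"
    and C: "1 \<le> C" "e_bd \<le> C"
    and a: "a = 1 / sqrt (real (card (I \<times> {..<T})))" and t: "0 \<le> t" "t \<le> 1" and q: "0 \<le> q" "q \<le> 1" and t3: "0 \<le> t3"
    and good: "good_fold C a q t t3 (I \<times> {..<T}) D Q \<tau>h \<omega>h"
  defines "Qm \<equiv> debiased_Q \<gamma> pol I T D \<tau>h Q m"
  shows "i \<in> I \<Longrightarrow> j < T \<Longrightarrow> \<bar>psi_remainder \<omega>h Qm (D i j)\<bar> \<le> total_bound C (m - 1) * (t3 + (a + q * t ^ (m - 1)))"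
    and "\<bar>(\<Sum>ii\<in>I \<times> {..<T}. psi_remainder \<omega>h Qm (D (fst ii) (snd ii))) / real (card (I \<times> {..<T}))\<bar>
      \<le> total_bound C (m - 1) * ((a + t3) * (a + q * t ^ (m - 1)) + a * t3)"
proof -
  let ?X = "I \<times> {..<T}" and ?d = "real (card F)" and ?Kf = "fold_bound c (real (card F)) C (m - 1)"
  let ?w = "\<lambda>z'. \<omega>h (fst z') (snd z')" and ?s = "a + q * t ^ (m - 1)"
  have g: "\<bar>err Qm z\<bar> \<le> ?Kf * ?s" if "z \<in> F" for z
    unfolding Qm_def by (rule debiased_Q_error[OF X valid C a t q good that])
  have a0: "0 \<le> a" by (simp add: a)
  have s0: "0 \<le> ?s" using a0 q t by auto
  have Kf: "0 \<le> ?Kf" using C by (intro fold_bound_nonneg) auto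
  have C0: "0 \<le> C" "C * 1 \<le> C * C" using C mult_left_mono[of 1 C C] by auto
  have w: "\<bar>?w z\<bar> \<le> C" "\<bar>?w z - \<omega> z\<bar> \<le> C * t3" if "z \<in> F" for z
    using good that by (auto simp: good_fold_def)
  have c0: "0 \<le> c" using discount' by simp
  have d: "psi_remainder \<omega>h Qm y = c * (\<Sum>z'\<in>F. (?w z' - \<omega> z') * e y z')
       + (\<Sum>z''\<in>F. (pmf start z'' - c * (\<Sum>z'\<in>F. ?w z' * b y z' z'')) * err Qm z'')" if "valid y" for y
    using psi_term_expansion[OF that, of \<omega>h Qm] by (simp add: psi_remainder_def)
  show "\<bar>psi_remainder \<omega>h Qm (D i j)\<bar> \<le> total_bound C (m - 1) * (t3 + ?s)" if "i \<in> I" "j < T"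
  proof -
    let ?y = "D i j"
    have 1: "\<bar>\<Sum>z'\<in>F. (?w z' - \<omega> z') * e ?y z'\<bar> \<le> ?d * ((C * t3) * C)"
    proof (rule abs_sum_le)
      show "\<bar>(?w z' - \<omega> z') * e ?y z'\<bar> \<le> (C * t3) * C" if "z' \<in> F" for z'
        unfolding abs_mult using w(2)[OF that] C0 t3 order.trans[OF e_bound C(2), of ?y z'] by (intro mult_mono) auto
    qed
    have 2: "\<bar>\<Sum>z''\<in>F. (pmf start z'' - c * (\<Sum>z'\<in>F. ?w z' * b ?y z' z'')) * err Qm z''\<bar>
        \<le> ?d * ((1 + c * (?d * (C * C))) * (?Kf * ?s))"
    proof (rule abs_sum_le)
      fix z'' assume z'': "z'' \<in> F"
      have "\<bar>\<Sum>z'\<in>F. ?w z' * b ?y z' z''\<bar> \<le> ?d * (C * 1)"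
      proof (rule abs_sum_le)
        show "\<bar>?w z' * b ?y z' z''\<bar> \<le> C * 1" if "z' \<in> F" for z'
          unfolding abs_mult using w(1)[OF that] b_bound C0 by (intro mult_mono) auto
      qed
      also have "\<dots> \<le> ?d * (C * C)" using C0 C(1) by (intro mult_left_mono) auto
      finally have "\<bar>c * (\<Sum>z'\<in>F. ?w z' * b ?y z' z'')\<bar> \<le> c * (?d * (C * C))"
        unfolding abs_mult using c0 by (intro mult_mono) auto
      then have "\<bar>pmf start z'' - c * (\<Sum>z'\<in>F. ?w z' * b ?y z' z'')\<bar> \<le> 1 + c * (?d * (C * C))"
        using pmf_le_1[of start z''] pmf_nonneg[of start z''] by linarith
      then show "\<bar>(pmf start z'' - c * (\<Sum>z'\<in>F. ?w z' * b ?y z' z'')) * err Qm z''\<bar> \<le> (1 + c * (?d * (C * C))) * (?Kf * ?s)"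
        unfolding abs_mult using g[OF z''] by (intro mult_mono) (auto intro: order.trans[OF abs_ge_zero])
    qed
    have "\<bar>psi_remainder \<omega>h Qm ?y\<bar> \<le> c * (?d * ((C * t3) * C)) + ?d * ((1 + c * (?d * (C * C))) * (?Kf * ?s))"
      unfolding d[OF valid[OF that]]
      using 2 mult_left_mono[OF 1 c0] c0
      by (intro order.trans[OF abs_triangle_ineq] add_mono) (simp_all only: abs_mult abs_of_nonneg)
    also have "\<dots> = c * (?d * (C * C)) * t3 + ?d * ((1 + c * (?d * (C * C))) * ?Kf) * ?s"
      by (simp only: ac_simps)
    also have "\<dots> \<le> total_bound C (m - 1) * (t3 + ?s)"
    proof -
      have "0 \<le> c * (?d * (C * C)) * ?s" "0 \<le> ?d * ((1 + c * (?d * (C * C))) * ?Kf) * t3"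
        using c0 C0 Kf s0 t3 by (auto intro!: mult_nonneg_nonneg add_nonneg_nonneg)
      then show ?thesis unfolding total_bound_def by (simp only: distrib_left distrib_right)
    qed
    finally show ?thesis .
  qed
  define N where "N = real (card ?X)"
  have fX: "finite ?X" using X by simp
  have "0 < card ?X" using X fX by (subst card_gt_0_iff) auto
  then have N: "0 < N" unfolding N_def by linarith
  let ?D = "\<lambda>ii. D (fst ii) (snd ii)"
  define eb where "eb z = (\<Sum>ii\<in>?X. e (?D ii) z) / N" for z
  define bb where "bb z z' = (\<Sum>ii\<in>?X. b (?D ii) z z') / N" for z z'
  have eb: "\<bar>eb z\<bar> \<le> C * a" if "z \<in> F" for z using good that unfolding good_fold_def eb_def N_def by blast
  have bb: "\<bar>bb z z' - Bm z z'\<bar> \<le> C * a" if "z \<in> F" "z' \<in> F" for z z'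
    using good that unfolding good_fold_def bb_def N_def by blast
  have sum1: "(\<Sum>ii\<in>?X. c * (\<Sum>z'\<in>F. (?w z' - \<omega> z') * e (?D ii) z')) = N * (c * (\<Sum>z'\<in>F. (?w z' - \<omega> z') * eb z'))"
  proof -
    have "(\<Sum>ii\<in>?X. \<Sum>z'\<in>F. (?w z' - \<omega> z') * e (?D ii) z') = (\<Sum>z'\<in>F. (?w z' - \<omega> z') * (N * eb z'))"
      using N by (subst sum.swap) (simp add: sum_distrib_left[symmetric] eb_def)
    also have "\<dots> = N * (\<Sum>z'\<in>F. (?w z' - \<omega> z') * eb z')"
      unfolding sum_distrib_left by (simp only: ac_simps)
    finally show ?thesis by (simp only: sum_distrib_left[symmetric]) (simp only: ac_simps)
  qed
  have sum2: "(\<Sum>ii\<in>?X. \<Sum>z''\<in>F. (pmf start z'' - c * (\<Sum>z'\<in>F. ?w z' * b (?D ii) z' z'')) * err Qm z'')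
     = N * (\<Sum>z''\<in>F. (pmf start z'' - c * (\<Sum>z'\<in>F. ?w z' * bb z' z'')) * err Qm z'')"
  proof -
    have inner: "(\<Sum>ii\<in>?X. pmf start z'' - c * (\<Sum>z'\<in>F. ?w z' * b (?D ii) z' z''))
       = N * (pmf start z'' - c * (\<Sum>z'\<in>F. ?w z' * bb z' z''))" for z''
    proof -
      have "(\<Sum>ii\<in>?X. \<Sum>z'\<in>F. ?w z' * b (?D ii) z' z'') = (\<Sum>z'\<in>F. ?w z' * (N * bb z' z''))"
        using N by (subst sum.swap) (simp add: sum_distrib_left[symmetric] bb_def)
      also have "\<dots> = N * (\<Sum>z'\<in>F. ?w z' * bb z' z'')"
        unfolding sum_distrib_left by (simp only: ac_simps)
      finally have "(\<Sum>ii\<in>?X. c * (\<Sum>z'\<in>F. ?w z' * b (?D ii) z' z'')) = N * (c * (\<Sum>z'\<in>F. ?w z' * bb z' z''))"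
        by (simp only: sum_distrib_left[symmetric]) (simp only: ac_simps)
      then show ?thesis by (simp only: sum_subtractf right_diff_distrib sum_constant N_def[symmetric])
    qed
    have "(\<Sum>ii\<in>?X. \<Sum>z''\<in>F. (pmf start z'' - c * (\<Sum>z'\<in>F. ?w z' * b (?D ii) z' z'')) * err Qm z'')
      = (\<Sum>z''\<in>F. (\<Sum>ii\<in>?X. pmf start z'' - c * (\<Sum>z'\<in>F. ?w z' * b (?D ii) z' z'')) * err Qm z'')"
      by (subst sum.swap) (simp only: sum_distrib_right)
    also have "\<dots> = (\<Sum>z''\<in>F. N * ((pmf start z'' - c * (\<Sum>z'\<in>F. ?w z' * bb z' z'')) * err Qm z''))"
      unfolding inner by (simp only: mult.assoc)
    finally show ?thesis by (simp only: sum_distrib_left[symmetric])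
  qed
  have "(\<Sum>ii\<in>?X. psi_remainder \<omega>h Qm (?D ii)) = (\<Sum>ii\<in>?X. c * (\<Sum>z'\<in>F. (?w z' - \<omega> z') * e (?D ii) z')
       + (\<Sum>z''\<in>F. (pmf start z'' - c * (\<Sum>z'\<in>F. ?w z' * b (?D ii) z' z'')) * err Qm z''))"
    using valid by (intro sum.cong refl d) auto
  then have "(\<Sum>ii\<in>?X. psi_remainder \<omega>h Qm (?D ii)) / N = c * (\<Sum>z'\<in>F. (?w z' - \<omega> z') * eb z')
     + (\<Sum>z''\<in>F. (pmf start z'' - c * (\<Sum>z'\<in>F. ?w z' * bb z' z'')) * err Qm z'')"
    using N by (simp only: sum.distrib sum1 sum2) (simp add: add_divide_distrib)
  also have "\<bar>\<dots>\<bar> \<le> c * (?d * ((C * t3) * (C * a))) + ?d * ((c * (?d * (C * C * (a + t3)))) * (?Kf * ?s))"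
  proof (intro order.trans[OF abs_triangle_ineq] add_mono)
    have "\<bar>\<Sum>z'\<in>F. (?w z' - \<omega> z') * eb z'\<bar> \<le> ?d * ((C * t3) * (C * a))"
    proof (rule abs_sum_le)
      show "\<bar>(?w z' - \<omega> z') * eb z'\<bar> \<le> (C * t3) * (C * a)" if "z' \<in> F" for z'
        unfolding abs_mult using w(2)[OF that] C0 t3 eb[OF that] by (intro mult_mono) auto
    qed
    then show "\<bar>c * (\<Sum>z'\<in>F. (?w z' - \<omega> z') * eb z')\<bar> \<le> c * (?d * ((C * t3) * (C * a)))"
      unfolding abs_mult using c0 by (intro mult_mono) auto
    show "\<bar>\<Sum>z''\<in>F. (pmf start z'' - c * (\<Sum>z'\<in>F. ?w z' * bb z' z'')) * err Qm z''\<bar>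
       \<le> ?d * ((c * (?d * (C * C * (a + t3)))) * (?Kf * ?s))"
    proof (rule abs_sum_le)
      fix z'' assume z'': "z'' \<in> F"
      have "\<bar>\<Sum>z'\<in>F. \<omega> z' * Bm z' z'' - ?w z' * bb z' z''\<bar> \<le> ?d * (C * C * (a + t3))"
      proof (rule abs_sum_le)
        fix z' assume z': "z' \<in> F"
        show "\<bar>\<omega> z' * Bm z' z'' - ?w z' * bb z' z''\<bar> \<le> C * C * (a + t3)"
          using w[OF z'] bb[OF z' z''] Bm_bound[of z' z''] C by (intro product_perturbation) auto
      qed
      moreover have "pmf start z'' - c * (\<Sum>z'\<in>F. ?w z' * bb z' z'') = c * (\<Sum>z'\<in>F. \<omega> z' * Bm z' z'' - ?w z' * bb z' z'')"
        unfolding omega_Bm[symmetric] by (simp only: sum_subtractf right_diff_distrib)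
      ultimately have "\<bar>pmf start z'' - c * (\<Sum>z'\<in>F. ?w z' * bb z' z'')\<bar> \<le> c * (?d * (C * C * (a + t3)))"
        using c0 by (simp only: abs_mult abs_of_nonneg mult_left_mono)
      then show "\<bar>(pmf start z'' - c * (\<Sum>z'\<in>F. ?w z' * bb z' z'')) * err Qm z''\<bar>
         \<le> (c * (?d * (C * C * (a + t3)))) * (?Kf * ?s)"
        unfolding abs_mult using g[OF z''] by (intro mult_mono) (auto intro: order.trans[OF abs_ge_zero])
    qed
  qed
  also have "\<dots> = c * (?d * (C * C)) * (a * t3) + ?d * ((c * (?d * (C * C))) * ?Kf) * ((a + t3) * ?s)"
    by (simp only: ac_simps)
  also have "\<dots> \<le> total_bound C (m - 1) * ((a + t3) * ?s + a * t3)"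
  proof -
    have nn: "0 \<le> a * t3" "0 \<le> (a + t3) * ?s" using a0 t3 s0 by auto
    have k: "c * (?d * (C * C)) \<le> total_bound C (m - 1)" "?d * ((c * (?d * (C * C))) * ?Kf) \<le> total_bound C (m - 1)"
    proof -
      have n: "0 \<le> c * (?d * (C * C))" using c0 C0 by auto
      have "0 \<le> ?d * ((1 + c * (?d * (C * C))) * ?Kf)" using n Kf by (intro mult_nonneg_nonneg) auto
      then show "c * (?d * (C * C)) \<le> total_bound C (m - 1)" unfolding total_bound_def by linarith
      have "?d * ((c * (?d * (C * C))) * ?Kf) \<le> ?d * ((1 + c * (?d * (C * C))) * ?Kf)"
        using Kf by (intro mult_left_mono mult_right_mono) auto
      then show "?d * ((c * (?d * (C * C))) * ?Kf) \<le> total_bound C (m - 1)" unfolding total_bound_def using n by linarith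
    qed
    show ?thesis
      using mult_right_mono[OF k(1) nn(1)] mult_right_mono[OF k(2) nn(2)] by (simp only: distrib_left)
  qed
  finally show "\<bar>(\<Sum>ii\<in>?X. psi_remainder \<omega>h Qm (?D ii)) / real (card ?X)\<bar> \<le> total_bound C (m - 1) * ((a + t3) * ?s + a * t3)"
    by (simp only: N_def)
qed

end

subsection \<open>The remainder of the whole sample\<close>

text \<open>The variance is invariant under shifts, so x is centred at \<eta>. \<open>A\<close> is
  the version with denominator N: its mean square is compared with that of y through a difference of
  squares, and its squared mean is at most (\<beta> + \<delta>)^2. The factor 2 bounds N / (N -
  1).\<close>

lemma sample_var_perturbation:
  fixes x y :: "nat \<Rightarrow> nat \<Rightarrow> real"
  assumes N: "N = real (n * T)" "2 \<le> N" and v: "0 \<le> v"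
    and y: "\<And>i t. i < n \<Longrightarrow> t < T \<Longrightarrow> \<bar>y i t\<bar> \<le> Y"
    and d: "\<And>i t. i < n \<Longrightarrow> t < T \<Longrightarrow> \<bar>x i t - \<eta> - y i t\<bar> \<le> D"
    and \<delta>: "(\<Sum>i<n. \<Sum>t<T. \<bar>x i t - \<eta> - y i t\<bar>) \<le> N * \<delta>"
    and ybar: "\<bar>\<Sum>i<n. \<Sum>t<T. y i t\<bar> \<le> N * \<beta>"
  shows "\<bar>sample_var n T x - v\<bar> \<le> 2 * (\<bar>(\<Sum>i<n. \<Sum>t<T. (y i t)\<^sup>2) / N - v\<bar> + (2 * Y + D) * \<delta> + (\<beta> + \<delta>)\<^sup>2) + 2 * v / N"
proof -
  define u where "u i t = x i t - \<eta>" for i t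
  define A where "A = (\<Sum>i<n. \<Sum>t<T. (u i t)\<^sup>2) / N - ((\<Sum>i<n. \<Sum>t<T. u i t) / N)\<^sup>2"
  define U where "U = (\<Sum>i<n. \<Sum>t<T. u i t) / N"
  have N0: "0 < N" using N by simp
  have cN: "(\<Sum>i<n. \<Sum>t<T. k) = N * k" for k :: real using N(1) by simp
  have xu: "x i t = u i t + \<eta>" for i t by (simp add: u_def)
  have mean: "sample_mean n T x = U + \<eta>"
    unfolding sample_mean_def xu sum.distrib cN U_def N(1)[symmetric] using N0 by (simp add: add_divide_distrib)
  have "(\<Sum>i<n. \<Sum>t<T. (x i t - sample_mean n T x)\<^sup>2) = (\<Sum>i<n. \<Sum>t<T. (u i t)\<^sup>2 - 2 * U * u i t + U\<^sup>2)"
    unfolding mean xu by (intro sum.cong refl) (simp add: power2_eq_square algebra_simps)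
  also have "\<dots> = (\<Sum>i<n. \<Sum>t<T. (u i t)\<^sup>2) - 2 * U * (\<Sum>i<n. \<Sum>t<T. u i t) + N * U\<^sup>2"
    by (simp only: sum.distrib sum_subtractf sum_distrib_left[symmetric] cN)
  also have "(\<Sum>i<n. \<Sum>t<T. u i t) = N * U" using N0 by (simp add: U_def)
  also have "(\<Sum>i<n. \<Sum>t<T. (u i t)\<^sup>2) = N * (A + U\<^sup>2)"
    using N0 by (simp add: A_def U_def)
  finally have "(\<Sum>i<n. \<Sum>t<T. (x i t - sample_mean n T x)\<^sup>2) = N * A"
    by (simp add: power2_eq_square algebra_simps)
  then have sv: "sample_var n T x = N * A / (N - 1)"
    by (simp add: sample_var_def N(1))
  have \<delta>0: "0 \<le> N * \<delta>" using \<delta> sum_nonneg[of "{..<n}" "\<lambda>i. \<Sum>t<T. \<bar>x i t - \<eta> - y i t\<bar>"] by (auto simp: sum_nonneg intro: order.trans[rotated])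
  have "\<bar>N * U\<bar> \<le> N * \<beta> + N * \<delta>"
  proof -
    have "N * U = (\<Sum>i<n. \<Sum>t<T. y i t) + (\<Sum>i<n. \<Sum>t<T. x i t - \<eta> - y i t)"
      using N0 by (simp add: U_def u_def sum.distrib[symmetric])
    moreover have "\<bar>\<Sum>i<n. \<Sum>t<T. x i t - \<eta> - y i t\<bar> \<le> (\<Sum>i<n. \<Sum>t<T. \<bar>x i t - \<eta> - y i t\<bar>)"
      by (intro order.trans[OF sum_abs] sum_mono sum_abs)
    ultimately show ?thesis using ybar \<delta> by linarith
  qed
  then have "N * \<bar>U\<bar> \<le> N * (\<beta> + \<delta>)" using N0 by (simp add: abs_mult distrib_left)
  then have U: "\<bar>U\<bar> \<le> \<beta> + \<delta>" using N0 by simp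
  then have U2: "U\<^sup>2 \<le> (\<beta> + \<delta>)\<^sup>2" by (metis abs_ge_zero power2_abs power_mono)
  have "\<bar>(\<Sum>i<n. \<Sum>t<T. (u i t)\<^sup>2) - (\<Sum>i<n. \<Sum>t<T. (y i t)\<^sup>2)\<bar> \<le> (2 * Y + D) * (N * \<delta>)"
  proof -
    have "\<bar>(u i t)\<^sup>2 - (y i t)\<^sup>2\<bar> \<le> (2 * Y + D) * \<bar>x i t - \<eta> - y i t\<bar>" if "i < n" "t < T" for i t
    proof -
      have "(u i t)\<^sup>2 - (y i t)\<^sup>2 = (2 * y i t + (x i t - \<eta> - y i t)) * (x i t - \<eta> - y i t)"
        by (simp add: u_def power2_eq_square algebra_simps)
      moreover have "\<bar>2 * y i t + (x i t - \<eta> - y i t)\<bar> \<le> 2 * Y + D"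
        using y[OF that] d[OF that] by linarith
      ultimately show ?thesis by (simp only: abs_mult mult_right_mono abs_ge_zero)
    qed
    then have "\<bar>\<Sum>i<n. \<Sum>t<T. (u i t)\<^sup>2 - (y i t)\<^sup>2\<bar> \<le> (\<Sum>i<n. \<Sum>t<T. (2 * Y + D) * \<bar>x i t - \<eta> - y i t\<bar>)"
      by (intro order.trans[OF sum_abs] sum_mono order.trans[OF sum_abs]) auto
    also have "\<dots> = (2 * Y + D) * (\<Sum>i<n. \<Sum>t<T. \<bar>x i t - \<eta> - y i t\<bar>)"
      by (simp only: sum_distrib_left)
    also have "\<dots> \<le> (2 * Y + D) * (N * \<delta>)"
    proof (rule mult_left_mono[OF \<delta>])
      have "0 < n" "0 < T" using N by (auto intro!: Nat.gr0I)
      then show "0 \<le> 2 * Y + D" using y[of 0 0] d[of 0 0] by linarith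
    qed
    finally show ?thesis by (simp only: sum_subtractf)
  qed
  then have "\<bar>(\<Sum>i<n. \<Sum>t<T. (u i t)\<^sup>2) / N - (\<Sum>i<n. \<Sum>t<T. (y i t)\<^sup>2) / N\<bar> \<le> (2 * Y + D) * \<delta>"
    using N0 by (simp add: diff_divide_distrib[symmetric] divide_le_eq ac_simps)
  then have A: "\<bar>A - v\<bar> \<le> \<bar>(\<Sum>i<n. \<Sum>t<T. (y i t)\<^sup>2) / N - v\<bar> + (2 * Y + D) * \<delta> + (\<beta> + \<delta>)\<^sup>2"
    using U2 unfolding A_def U_def[symmetric] by (smt (verit) zero_le_power2)
  have "sample_var n T x - v = (N * A - (N - 1) * v) / (N - 1)"
    using N(2) unfolding sv by (simp add: diff_divide_distrib)
  also have "N * A - (N - 1) * v = N * (A - v) + v" by (simp add: algebra_simps)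
  finally have "sample_var n T x - v = (N / (N - 1)) * (A - v) + v / (N - 1)"
    by (simp add: add_divide_distrib)
  moreover have "\<bar>(N / (N - 1)) * (A - v) + v / (N - 1)\<bar> \<le> 2 * \<bar>A - v\<bar> + 2 * v / N"
  proof (intro order.trans[OF abs_triangle_ineq] add_mono)
    have "\<bar>N / (N - 1)\<bar> \<le> 2" using N(2) by (simp add: field_simps)
    then show "\<bar>N / (N - 1) * (A - v)\<bar> \<le> 2 * \<bar>A - v\<bar>" unfolding abs_mult by (intro mult_right_mono) auto
    have "v / (N - 1) \<le> v / (N / 2)" using N(2) v by (intro divide_left_mono) auto
    then show "\<bar>v / (N - 1)\<bar> \<le> 2 * v / N" using N(2) v by (simp add: mult.commute)
  qed
  ultimately have "\<bar>sample_var n T x - v\<bar> \<le> 2 * \<bar>A - v\<bar> + 2 * v / N" by (simp only:)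
  also have "\<dots> \<le> 2 * (\<bar>(\<Sum>i<n. \<Sum>t<T. (y i t)\<^sup>2) / N - v\<bar> + (2 * Y + D) * \<delta> + (\<beta> + \<delta>)\<^sup>2) + 2 * v / N"
    using A by (intro add_right_mono mult_left_mono) auto
  finally show ?thesis .
qed

lemma sum_folds:
  assumes "g \<in> fold_assignments n K"
  shows "(\<Sum>i<n. \<Sum>t<T. h i t) = (\<Sum>k<K. \<Sum>ii\<in>in_fold n g k \<times> {..<T}. h (fst ii) (snd ii) :: real)"
proof -
  have "(\<Sum>k<K. \<Sum>ii\<in>in_fold n g k \<times> {..<T}. h (fst ii) (snd ii)) = (\<Sum>k<K. \<Sum>i\<in>in_fold n g k. \<Sum>t<T. h i t)"
    by (simp add: sum.cartesian_product case_prod_unfold)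
  also have "\<dots> = (\<Sum>k<K. \<Sum>i\<in>{i \<in> {..<n}. g i = k}. \<Sum>t<T. h i t)"
    by (simp add: in_fold_def)
  also have "\<dots> = (\<Sum>i<n. \<Sum>t<T. h i t)"
    using assms by (intro sum.group) (auto simp: fold_assignments_def)
  finally show ?thesis by simp
qed

context ope_data
begin

text \<open>A fold sum is N_k times a fold average. With a_k = 1 / sqrt N_k, the products N_k * a_k
  * a_k = 1 and N_k * a_k = sqrt N_k, the latter at most sqrt N, make the bounds independent of how
  the sample is divided.\<close>

lemma total_remainder:
  fixes D :: "nat \<Rightarrow> nat \<Rightarrow> ('s, 'a) transition"
  assumes g: "g \<in> fold_assignments n K" and T: "1 \<le> T"
    and valid: "\<And>i t. valid (D i t)"
    and C: "1 \<le> C" "e_bd \<le> C" "B \<le> C"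
    and t: "0 \<le> t" "t \<le> 1" and q: "0 \<le> q" "q \<le> 1" and t3: "0 \<le> t3"
    and m: "\<And>k. k < K \<Longrightarrow> m - 1 \<le> card (in_fold n g k) * T"
    and good: "\<And>k. k < K \<Longrightarrow> good_fold C (1 / sqrt (real (card (in_fold n g k \<times> {..<T})))) q t t3
        (in_fold n g k \<times> {..<T}) D (Qh k) (\<tau>h k) (\<omega>h k)"
  defines "d \<equiv> \<lambda>i j. psi \<gamma> pol G n T g D Qh \<tau>h \<omega>h m i j - policy_value \<gamma> p r pol G - y\<^sub>0 (D i j)"
    and "s \<equiv> q * t ^ (m - 1)" and "N \<equiv> real (n * T)"
  shows "\<bar>\<Sum>i<n. \<Sum>j<T. d i j\<bar> \<le> real K * total_bound C (m - 1) * (1 + sqrt N * s + 2 * (sqrt N * t3) + N * t3 * s)"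
    and "(\<Sum>i<n. \<Sum>j<T. \<bar>d i j\<bar>) \<le> real K * total_bound C (m - 1) * (N * t3 + sqrt N + N * s)"
    and "i < n \<Longrightarrow> j < T \<Longrightarrow> \<bar>d i j\<bar> \<le> total_bound C (m - 1) * (t3 + 1 + s)"
    and "\<bar>\<Sum>i<n. \<Sum>j<T. y\<^sub>0 (D i j)\<bar> \<le> real K * (c * (real (card F) * (C * C))) * sqrt N"
proof -
  let ?X = "\<lambda>k. in_fold n g k \<times> {..<T}" and ?B = "total_bound C (m - 1)"
  define Nk where "Nk k = real (card (?X k))" for k
  define a where "a k = 1 / sqrt (Nk k)" for k
  have X: "finite (in_fold n g k)" "?X k \<noteq> {}" if "k < K" for k
    using in_fold_nonempty[OF g that] T by (auto simp: lessThan_empty_iff)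
  have Nk1: "1 \<le> Nk k" if "k < K" for k
  proof -
    have "0 < card (?X k)" using X[OF that] by (subst card_gt_0_iff) auto
    then show ?thesis unfolding Nk_def by linarith
  qed
  have NkN: "Nk k \<le> N" for k
  proof -
    have "card (?X k) \<le> card ({..<n} \<times> {..<T})" by (intro card_mono) (auto simp: in_fold_def)
    then show ?thesis unfolding Nk_def N_def by (simp only: of_nat_le_iff card_cartesian_product card_lessThan)
  qed
  have a: "Nk k * a k = sqrt (Nk k)" "Nk k * (a k * a k) = 1" "0 \<le> a k" "a k \<le> 1" if "k < K" for k
    using Nk1[OF that] by (auto simp: a_def real_div_sqrt)
  have s0: "0 \<le> s" "0 \<le> N" using q t by (auto simp: s_def N_def)
  have TB: "0 \<le> ?B"
    unfolding total_bound_def using discount' C fold_bound_nonneg[of C] by (intro add_nonneg_nonneg mult_nonneg_nonneg) auto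
  have m': "m - 1 \<le> card (?X k)" if "k < K" for k using m[OF that] unfolding card_cartesian_product card_lessThan .
  have psi: "psi \<gamma> pol G n T g D Qh \<tau>h \<omega>h m i j
     = psi_term \<gamma> pol G (\<omega>h k) (debiased_Q \<gamma> pol (in_fold n g k) T D (\<tau>h k) (Qh k) m) (D i j)" if "g i = k" for i j k
    using that by (simp add: psi_def Let_def)
  have dr: "d i j = psi_remainder (\<omega>h k) (debiased_Q \<gamma> pol (in_fold n g k) T D (\<tau>h k) (Qh k) m) (D i j)" if "g i = k" for i j k
    unfolding d_def psi_remainder_def psi[OF that] ..
  have gi: "g i < K" if "i < n" for i using g that by (auto simp: fold_assignments_def)
  have pw: "\<bar>d i j\<bar> \<le> ?B * (t3 + (a k + s))" if "i < n" "j < T" "g i = k" for i j k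
  proof -
    have k: "k < K" using gi that by auto
    show ?thesis unfolding dr[OF that(3)] s_def a_def Nk_def
      by (rule fold_remainder(1)[OF X[OF k] m'[OF k] valid C(1,2) refl t q t3 good[OF k]])
         (use that in \<open>auto simp: in_fold_def\<close>)
  qed
  show "\<bar>d i j\<bar> \<le> ?B * (t3 + 1 + s)" if "i < n" "j < T" for i j
    using pw[OF that refl] mult_left_mono[OF _ TB, of "t3 + (a (g i) + s)" "t3 + 1 + s"] a(4)[OF gi[OF that(1)]] by linarith
  have in_g: "g (fst ii) = k" "fst ii < n" "snd ii < T" if "ii \<in> ?X k" for ii k using that by (auto simp: in_fold_def)
  have "\<bar>\<Sum>i<n. \<Sum>j<T. d i j\<bar> \<le> (\<Sum>k<K. \<bar>\<Sum>ii\<in>?X k. d (fst ii) (snd ii)\<bar>)"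
    unfolding sum_folds[OF g] by (rule sum_abs)
  also have "\<dots> \<le> (\<Sum>k<K. ?B * (1 + sqrt N * s + 2 * (sqrt N * t3) + N * t3 * s))"
  proof (rule sum_mono)
    fix k assume "k \<in> {..<K}"
    then have k: "k < K" by simp
    have "\<bar>(\<Sum>ii\<in>?X k. d (fst ii) (snd ii)) / Nk k\<bar> \<le> ?B * ((a k + t3) * (a k + s) + a k * t3)"
    proof -
      have "(\<Sum>ii\<in>?X k. d (fst ii) (snd ii))
        = (\<Sum>ii\<in>?X k. psi_remainder (\<omega>h k) (debiased_Q \<gamma> pol (in_fold n g k) T D (\<tau>h k) (Qh k) m) (D (fst ii) (snd ii)))"
        by (intro sum.cong refl dr) (use in_g in auto)
      then show ?thesis unfolding s_def a_def Nk_def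
        using fold_remainder(2)[OF X[OF k] m'[OF k] valid C(1,2) refl t q t3 good[OF k]] by (simp only:)
    qed
    then have "\<bar>\<Sum>ii\<in>?X k. d (fst ii) (snd ii)\<bar> \<le> Nk k * (?B * ((a k + t3) * (a k + s) + a k * t3))"
      using Nk1[OF k] by (simp add: divide_le_eq ac_simps)
    also have "\<dots> = ?B * (Nk k * (a k * a k) + (Nk k * a k) * s + 2 * ((Nk k * a k) * t3) + Nk k * t3 * s)"
      by (simp add: algebra_simps)
    also have "\<dots> = ?B * (1 + sqrt (Nk k) * s + 2 * (sqrt (Nk k) * t3) + Nk k * t3 * s)"
      by (simp only: a[OF k])
    also have "\<dots> \<le> ?B * (1 + sqrt N * s + 2 * (sqrt N * t3) + N * t3 * s)"
      using NkN[of k] s0 t3 by (intro mult_left_mono[OF _ TB] add_mono mult_right_mono) (auto intro!: mult_right_mono)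
    finally show "\<bar>\<Sum>ii\<in>?X k. d (fst ii) (snd ii)\<bar> \<le> ?B * (1 + sqrt N * s + 2 * (sqrt N * t3) + N * t3 * s)" .
  qed
  also have "\<dots> = real K * ?B * (1 + sqrt N * s + 2 * (sqrt N * t3) + N * t3 * s)" by simp
  finally show "\<bar>\<Sum>i<n. \<Sum>j<T. d i j\<bar> \<le> real K * ?B * (1 + sqrt N * s + 2 * (sqrt N * t3) + N * t3 * s)" .
  have "(\<Sum>i<n. \<Sum>j<T. \<bar>d i j\<bar>) = (\<Sum>k<K. \<Sum>ii\<in>?X k. \<bar>d (fst ii) (snd ii)\<bar>)"
    by (rule sum_folds[OF g])
  also have "\<dots> \<le> (\<Sum>k<K. ?B * (N * t3 + sqrt N + N * s))"
  proof (rule sum_mono)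
    fix k assume "k \<in> {..<K}"
    then have k: "k < K" by simp
    have "(\<Sum>ii\<in>?X k. \<bar>d (fst ii) (snd ii)\<bar>) \<le> Nk k * (?B * (t3 + (a k + s)))"
      unfolding Nk_def by (intro sum_bounded_above pw) (use in_g in auto)
    also have "\<dots> = ?B * (Nk k * t3 + Nk k * a k + Nk k * s)" by (simp add: algebra_simps)
    also have "\<dots> = ?B * (Nk k * t3 + sqrt (Nk k) + Nk k * s)" by (simp only: a[OF k])
    also have "\<dots> \<le> ?B * (N * t3 + sqrt N + N * s)"
      using NkN[of k] s0 t3 by (intro mult_left_mono[OF _ TB] add_mono mult_right_mono) auto
    finally show "(\<Sum>ii\<in>?X k. \<bar>d (fst ii) (snd ii)\<bar>) \<le> ?B * (N * t3 + sqrt N + N * s)" .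
  qed
  also have "\<dots> = real K * ?B * (N * t3 + sqrt N + N * s)" by simp
  finally show "(\<Sum>i<n. \<Sum>j<T. \<bar>d i j\<bar>) \<le> real K * ?B * (N * t3 + sqrt N + N * s)" .
  have "\<bar>\<Sum>i<n. \<Sum>j<T. y\<^sub>0 (D i j)\<bar> \<le> (\<Sum>k<K. \<bar>\<Sum>ii\<in>?X k. y\<^sub>0 (D (fst ii) (snd ii))\<bar>)"
    unfolding sum_folds[OF g] by (rule sum_abs)
  also have "\<dots> \<le> (\<Sum>k<K. c * (real (card F) * (C * C)) * sqrt N)"
  proof (rule sum_mono)
    fix k assume "k \<in> {..<K}"
    then have k: "k < K" by simp
    define eb where "eb z = (\<Sum>ii\<in>?X k. e (D (fst ii) (snd ii)) z) / Nk k" for z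
    have eb: "\<bar>eb z\<bar> \<le> C * a k" if "z \<in> F" for z
      using good[OF k] that unfolding good_fold_def eb_def Nk_def a_def by blast
    have "(\<Sum>ii\<in>?X k. y\<^sub>0 (D (fst ii) (snd ii))) = c * (\<Sum>z\<in>F. \<omega> z * (Nk k * eb z))"
      unfolding y\<^sub>0_def sum_distrib_left[symmetric]
      using Nk1[OF k] by (subst sum.swap) (simp add: eb_def sum_distrib_left[symmetric])
    also have "\<bar>\<dots>\<bar> \<le> c * (real (card F) * (C * (Nk k * (C * a k))))"
    proof -
      have "\<bar>\<Sum>z\<in>F. \<omega> z * (Nk k * eb z)\<bar> \<le> real (card F) * (C * (Nk k * (C * a k)))"
      proof (rule abs_sum_le)
        fix z assume z: "z \<in> F"
        have "\<bar>Nk k * eb z\<bar> \<le> Nk k * (C * a k)"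
          unfolding abs_mult using eb[OF z] Nk1[OF k] by (intro mult_mono) auto
        then show "\<bar>\<omega> z * (Nk k * eb z)\<bar> \<le> C * (Nk k * (C * a k))"
          unfolding abs_mult[of "\<omega> z"] using omega_bound[OF z] C by (intro mult_mono) auto
      qed
      then show ?thesis unfolding abs_mult[of c] using discount' by (intro mult_mono) auto
    qed
    also have "\<dots> = c * (real (card F) * (C * C)) * (Nk k * a k)" by (simp only: ac_simps)
    also have "\<dots> \<le> c * (real (card F) * (C * C)) * sqrt N"
      unfolding a[OF k] using NkN[of k] discount' C by (intro mult_left_mono) auto
    finally show "\<bar>\<Sum>ii\<in>?X k. y\<^sub>0 (D (fst ii) (snd ii))\<bar> \<le> c * (real (card F) * (C * C)) * sqrt N" .
  qed
  also have "\<dots> = real K * (c * (real (card F) * (C * C))) * sqrt N" by simp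
  finally show "\<bar>\<Sum>i<n. \<Sum>j<T. y\<^sub>0 (D i j)\<bar> \<le> real K * (c * (real (card F) * (C * C))) * sqrt N" .
qed

end

subsection \<open>Measurability and estimation rates\<close>

text \<open>An integral with a parameter requires joint measurability, which follows from
  measurability at each point because the integration variable is countable.\<close>

lemma measurable_pmf_expectation:
  fixes h :: "'w \<Rightarrow> 'b::countable \<Rightarrow> real"
  assumes "\<And>x. (\<lambda>w. h w x) \<in> borel_measurable N"
  shows "(\<lambda>w. measure_pmf.expectation q (h w)) \<in> borel_measurable N"
proof -
  have "(\<lambda>p. h (fst p) (snd p)) \<in> borel_measurable (N \<Otimes>\<^sub>M measure_pmf q)"
  proof (rule measurable_compose_countable[where f="\<lambda>x p. h (fst p) x" and g=snd])
    show "(\<lambda>p. h (fst p) x) \<in> borel_measurable (N \<Otimes>\<^sub>M measure_pmf q)" for x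
      by (rule measurable_compose[OF measurable_fst assms])
    show "snd \<in> measurable (N \<Otimes>\<^sub>M measure_pmf q) (count_space UNIV)"
      by (rule measurable_compose[OF measurable_snd, of "\<lambda>x. x" "measure_pmf q" "count_space UNIV" N]) simp
  qed
  then show ?thesis
    by (intro measure_pmf.borel_measurable_lebesgue_integral) (simp add: case_prod_unfold)
qed

lemma measurable_evaluation:
  fixes h :: "'w \<Rightarrow> 'b::countable \<Rightarrow> 'c::countable \<Rightarrow> real"
  assumes h: "\<And>x y. (\<lambda>w. h w x y) \<in> borel_measurable N"
    and x: "x \<in> measurable N (count_space UNIV)" and y: "y \<in> measurable N (count_space UNIV)"
  shows "(\<lambda>w. h w (x w) (y w)) \<in> borel_measurable N"
  by (rule measurable_compose_countable[where f="\<lambda>u w. h w u (y w)", OF _ x],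
      rule measurable_compose_countable[where f="\<lambda>u w. h w _ u", OF _ y], rule h)

context ope_data
begin

lemma measurable_next_value:
  assumes Q: "\<And>a s. (\<lambda>w. Q w a s :: real) \<in> borel_measurable M"
  shows "(\<lambda>w. measure_pmf.expectation (pol (S i t w)) (\<lambda>a. Q w a (S i t w))) \<in> borel_measurable M"
  by (rule measurable_compose_countable[where f="\<lambda>s w. measure_pmf.expectation (pol s) (\<lambda>a. Q w a s)" and g="S i t"],
      rule measurable_pmf_expectation, rule Q, rule measurable_data)

lemma measurable_debias:
  assumes Q: "\<And>a s. (\<lambda>w. Q w a s) \<in> borel_measurable M"
    and \<tau>: "\<And>a s a' s'. (\<lambda>w. \<tau>h w a s a' s') \<in> borel_measurable M"
  shows "(\<lambda>w. debias \<gamma> pol (\<tau>h w) (tn i t w) (Q w) a s) \<in> borel_measurable M"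
proof -
  have [measurable]: "(\<lambda>w. \<tau>h w (A i t w) (S i t w) a s) \<in> borel_measurable M"
    by (rule measurable_evaluation[where h="\<lambda>w x y. \<tau>h w x y a s"]) (rule \<tau> measurable_data)+
  have [measurable]: "(\<lambda>w. Q w (A i t w) (S i t w)) \<in> borel_measurable M"
    by (rule measurable_evaluation) (rule Q measurable_data)+
  note [measurable] = measurable_next_value[OF Q] Q
  show ?thesis unfolding debias_def transitions_def by simp measurable
qed

lemma measurable_foldr_debias:
  assumes Q: "\<And>a s. (\<lambda>w. Q w a s) \<in> borel_measurable M"
    and \<tau>: "\<And>a s a' s'. (\<lambda>w. \<tau>h w a s a' s') \<in> borel_measurable M"
  shows "(\<lambda>w. foldr (\<lambda>(i, t). debias \<gamma> pol (\<tau>h w) (tn i t w)) xs (Q w) a s) \<in> borel_measurable M"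
proof (induction xs arbitrary: a s)
  case Nil
  then show ?case using Q by simp
next
  case (Cons ii xs)
  show ?case
    using measurable_debias[of "\<lambda>w. foldr (\<lambda>(i, t). debias \<gamma> pol (\<tau>h w) (tn i t w)) xs (Q w)", OF Cons.IH \<tau>]
    by (cases ii) simp
qed

lemma measurable_debiased_Q:
  assumes Q: "\<And>a s. (\<lambda>w. Q w a s) \<in> borel_measurable M"
    and \<tau>: "\<And>a s a' s'. (\<lambda>w. \<tau>h w a s a' s') \<in> borel_measurable M"
  shows "(\<lambda>w. debiased_Q \<gamma> pol I T (transitions S A R w) (\<tau>h w) (Q w) m a s) \<in> borel_measurable M"
  unfolding debiased_Q_def
  by (intro borel_measurable_divide borel_measurable_sum borel_measurable_const measurable_foldr_debias Q \<tau>)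

lemma measurable_psi_term:
  assumes Q: "\<And>a s. (\<lambda>w. Q w a s) \<in> borel_measurable M"
    and \<omega>: "\<And>a s. (\<lambda>w. \<omega>h w a s) \<in> borel_measurable M"
  shows "(\<lambda>w. psi_term \<gamma> pol G (\<omega>h w) (Q w) (tn i t w)) \<in> borel_measurable M"
proof -
  have [measurable]: "(\<lambda>w. \<omega>h w (A i t w) (S i t w)) \<in> borel_measurable M" "(\<lambda>w. Q w (A i t w) (S i t w)) \<in> borel_measurable M"
    by (rule measurable_evaluation, (rule Q \<omega> measurable_data)+)+
  have [measurable]: "(\<lambda>w. measure_pmf.expectation G (\<lambda>s. measure_pmf.expectation (pol s) (\<lambda>a. Q w a s))) \<in> borel_measurable M"
    by (rule measurable_pmf_expectation, rule measurable_pmf_expectation, rule Q)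
  note [measurable] = measurable_next_value[OF Q]
  show ?thesis unfolding psi_term_def transitions_def by simp measurable
qed

text \<open>The functional \<open>E\<close> evaluates an estimate at fixed arguments, so that one
  statement serves all three estimators. The random division has finitely many values and can be
  fixed.\<close>

lemma measurable_fitted:
  assumes est: "estimator_measurable n T K k (\<lambda>g D. E (est g D))"
    and f: "f \<in> measurable M (count_space (fold_assignments n K))"
  shows "(\<lambda>w. E (fitted n T k est (f w) (transitions S A R w)) :: real) \<in> borel_measurable M"
proof (rule measurable_compose_countable'[OF _ f])
  show "countable (fold_assignments n K)" by (rule countable_finite[OF finite_fold_assignments])
  fix g assume g: "g \<in> fold_assignments n K"
  have "(\<lambda>w. \<lambda>i\<in>out_fold n g k. \<lambda>t\<in>{..<T}. tn i t w)
    \<in> measurable M (PiM (out_fold n g k) (\<lambda>_. PiM {..<T} (\<lambda>_. transition_space)))"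
    by (intro measurable_restrict measurable_tn)
  from measurable_compose[OF this est[unfolded estimator_measurable_def, rule_format, OF g]]
  show "(\<lambda>w. E (fitted n T k est g (transitions S A R w))) \<in> borel_measurable M"
    by (simp add: fitted_def)
qed

lemma measurable_psi:
  assumes f: "f \<in> measurable M (count_space (fold_assignments n K))"
    and Q: "\<And>k a s. k < K \<Longrightarrow> (\<lambda>w. Q w k a s) \<in> borel_measurable M"
    and \<tau>: "\<And>k a s a' s'. k < K \<Longrightarrow> (\<lambda>w. \<tau>h w k a s a' s') \<in> borel_measurable M"
    and \<omega>: "\<And>k a s. k < K \<Longrightarrow> (\<lambda>w. \<omega>h w k a s) \<in> borel_measurable M"
    and i: "i < n"
  shows "(\<lambda>w. psi \<gamma> pol G n T (f w) (transitions S A R w) (Q w) (\<tau>h w) (\<omega>h w) m i t) \<in> borel_measurable M"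
proof (rule measurable_compose_countable'[OF _ f])
  show "countable (fold_assignments n K)" by (rule countable_finite[OF finite_fold_assignments])
  fix g assume "g \<in> fold_assignments n K"
  then have k: "g i < K" using i by (auto simp: fold_assignments_def)
  show "(\<lambda>w. psi \<gamma> pol G n T g (transitions S A R w) (Q w) (\<tau>h w) (\<omega>h w) m i t) \<in> borel_measurable M"
    unfolding psi_def Let_def
    by (intro measurable_psi_term measurable_debiased_Q Q \<tau> \<omega> k)
qed

text \<open>On a finite support an averaged squared error dominates each of its terms. Dividing by
  the positive mass of z transfers the rate to every single point.\<close>

lemma L2_error_pointwise:
  assumes z: "z \<in> F"
  shows "pmf pinf z * expectation (\<lambda>w. (h w (fst z) (snd z) - g (fst z) (snd z))\<^sup>2) \<le> (L2_error M pinf h g)\<^sup>2"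
proof -
  let ?I = "\<lambda>z. expectation (\<lambda>w. (h w (fst z) (snd z) - g (fst z) (snd z))\<^sup>2)"
  have "(L2_error M pinf h g)\<^sup>2 = (\<Sum>z\<in>F. pmf pinf z * ?I z)"
    unfolding L2_error_def
    by (simp add: case_prod_unfold expectation_finite_support[OF finite_F subset_refl] sum_nonneg)
  moreover have "pmf pinf z * ?I z \<le> (\<Sum>z\<in>F. pmf pinf z * ?I z)"
    using z by (intro member_le_sum finite_F) auto
  ultimately show ?thesis by simp
qed

lemma L2_error2_pointwise:
  assumes z: "z \<in> F" "z' \<in> F"
  shows "pmf pinf z * pmf pinf z' * expectation (\<lambda>w. (h w (fst z) (snd z) (fst z') (snd z') - g (fst z) (snd z) (fst z') (snd z'))\<^sup>2)
    \<le> (L2_error2 M pinf h g)\<^sup>2"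
proof -
  let ?I = "\<lambda>z z'. expectation (\<lambda>w. (h w (fst z) (snd z) (fst z') (snd z') - g (fst z) (snd z) (fst z') (snd z'))\<^sup>2)"
  have "(L2_error2 M pinf h g)\<^sup>2 = (\<Sum>z\<in>F. pmf pinf z * (\<Sum>z'\<in>F. pmf pinf z' * ?I z z'))"
    unfolding L2_error2_def
    by (simp add: case_prod_unfold expectation_finite_support[OF finite_F subset_refl] sum_nonneg)
  moreover have "pmf pinf z' * ?I z z' \<le> (\<Sum>z'\<in>F. pmf pinf z' * ?I z z')"
    using z by (intro member_le_sum[of z' F "\<lambda>z'. pmf pinf z' * ?I z z'"] finite_F) auto
  then have "pmf pinf z * (pmf pinf z' * ?I z z') \<le> pmf pinf z * (\<Sum>z'\<in>F. pmf pinf z' * ?I z z')"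
    by (intro mult_left_mono) auto
  moreover have "\<dots> \<le> (\<Sum>z\<in>F. pmf pinf z * (\<Sum>z'\<in>F. pmf pinf z' * ?I z z'))"
    using z by (intro member_le_sum finite_F) (auto intro!: mult_nonneg_nonneg sum_nonneg)
  ultimately show ?thesis by (simp add: mult.assoc)
qed

text \<open>Chebyshev's inequality for h / q; \<pi> is the mass of the point, or pair of points, at
  which the estimate is evaluated.\<close>

lemma tight_rate:
  assumes m: "\<And>j. h j \<in> borel_measurable M" and bd: "\<And>j. AE w in M. \<bar>h j w\<bar> \<le> D"
    and \<pi>: "0 < \<pi>" and le: "\<And>j. \<pi> * expectation (\<lambda>w. (h j w)\<^sup>2) \<le> (L j)\<^sup>2"
    and L: "L \<in> O(\<lambda>j. q j)" and q: "\<And>j. 0 < q j"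
  shows "tight (\<lambda>j w. h j w / q j)"
proof -
  obtain c where c: "0 < c" "\<forall>\<^sub>F j in sequentially. norm (L j) \<le> c * norm (q j)"
    using landau_o.bigE[OF L] by auto
  show ?thesis
  proof (rule tight_second_moment[where V="c\<^sup>2 / \<pi>"])
    show "\<forall>\<^sub>F j in sequentially. (\<lambda>w. h j w / q j) \<in> borel_measurable M \<and> integrable M (\<lambda>w. (h j w / q j)\<^sup>2)
        \<and> expectation (\<lambda>w. (h j w / q j)\<^sup>2) \<le> c\<^sup>2 / \<pi>"
      using c(2)
    proof eventually_elim
      case (elim j)
      note [measurable] = m
      have "AE w in M. norm ((h j w)\<^sup>2) \<le> D\<^sup>2"
        using bd[of j] by eventually_elim (auto simp: abs_le_square_iff[symmetric])
      then have i: "integrable M (\<lambda>w. (h j w)\<^sup>2)"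
        by (intro integrable_const_bound[where B="D\<^sup>2"]) auto
      have "\<pi> * expectation (\<lambda>w. (h j w)\<^sup>2) \<le> (c * q j)\<^sup>2"
      proof (rule order.trans[OF le])
        show "(L j)\<^sup>2 \<le> (c * q j)\<^sup>2"
          using elim c(1) q[of j] by (simp add: abs_le_square_iff[symmetric] abs_mult)
      qed
      then have "expectation (\<lambda>w. (h j w)\<^sup>2) / (q j)\<^sup>2 \<le> c\<^sup>2 / \<pi>"
        using \<pi> q[of j] by (simp add: field_simps power_mult_distrib)
      then show ?case using i q[of j] by (simp add: power_divide)
    qed
  qed
qed

end

subsection \<open>Limit theorem for the score and deterministic error bounds\<close>

context ope_data
begin

lemma y0_square_moment:
  "\<exists>V\<ge>0. \<forall>n T. 0 < n * T \<longrightarrow>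
     expectation (\<lambda>w. ((\<Sum>i<n. \<Sum>t<T. (y\<^sub>0 (tn i t w))\<^sup>2) / real (n * T) - \<sigma>2)\<^sup>2) \<le> V / real (n * T)"
proof -
  have "\<bar>(y\<^sub>0 x)\<^sup>2\<bar> \<le> y_bd\<^sup>2" for x
    using y0_bound[of x] by (simp add: abs_le_square_iff[symmetric])
  then obtain V where V: "0 \<le> V" "\<And>I T. finite I \<Longrightarrow> expectation (\<lambda>w. (\<Sum>ii\<in>I \<times> {..<T}.
      (y\<^sub>0 (tn (fst ii) (snd ii) w))\<^sup>2 - \<sigma>2)\<^sup>2) \<le> V * real (card (I \<times> {..<T}))"
    using second_moment_mixing[of "\<lambda>x. (y\<^sub>0 x)\<^sup>2" "y_bd\<^sup>2"] unfolding \<sigma>2_def by auto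
  have "expectation (\<lambda>w. ((\<Sum>i<n. \<Sum>t<T. (y\<^sub>0 (tn i t w))\<^sup>2) / real (n * T) - \<sigma>2)\<^sup>2) \<le> V / real (n * T)"
    if N: "0 < n * T" for n T
  proof -
    define N where "N = real (n * T)"
    have N0: "0 < N" using N by (simp add: N_def)
    have eq: "(\<Sum>i<n. \<Sum>t<T. (y\<^sub>0 (tn i t w))\<^sup>2) / N - \<sigma>2
       = (\<Sum>ii\<in>{..<n} \<times> {..<T}. (y\<^sub>0 (tn (fst ii) (snd ii) w))\<^sup>2 - \<sigma>2) / N" for w
    proof -
      have "(\<Sum>ii\<in>{..<n} \<times> {..<T}. (y\<^sub>0 (tn (fst ii) (snd ii) w))\<^sup>2 - \<sigma>2) = (\<Sum>i<n. \<Sum>t<T. (y\<^sub>0 (tn i t w))\<^sup>2) - N * \<sigma>2"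
        by (simp add: sum_subtractf sum.cartesian_product case_prod_unfold N_def)
      then show ?thesis using N0 by (simp add: diff_divide_distrib)
    qed
    have "expectation (\<lambda>w. ((\<Sum>i<n. \<Sum>t<T. (y\<^sub>0 (tn i t w))\<^sup>2) / N - \<sigma>2)\<^sup>2)
      = expectation (\<lambda>w. (\<Sum>ii\<in>{..<n} \<times> {..<T}. (y\<^sub>0 (tn (fst ii) (snd ii) w))\<^sup>2 - \<sigma>2)\<^sup>2) / N\<^sup>2"
      unfolding eq power_divide using N0 by simp
    also have "\<dots> \<le> V * N / N\<^sup>2"
      using V(2)[of "{..<n}" T] by (intro divide_right_mono) (auto simp: N_def)
    also have "\<dots> = V / N" using N0 by (simp add: power2_eq_square)
    finally show ?thesis unfolding N_def .
  qed
  then show ?thesis using V(1) by blast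
qed

lemma y0_average_bound: "\<bar>(\<Sum>i<n. \<Sum>t<T. (y\<^sub>0 (tn i t w))\<^sup>2) / real (n * T) - \<sigma>2\<bar> \<le> y_bd\<^sup>2 + \<sigma>2"
proof -
  have "(y\<^sub>0 x)\<^sup>2 \<le> y_bd\<^sup>2" for x using y0_bound[of x] by (simp add: abs_le_square_iff[symmetric])
  then have "(\<Sum>i<n. \<Sum>t<T. (y\<^sub>0 (tn i t w))\<^sup>2) \<le> (\<Sum>i<n. \<Sum>t<T. y_bd\<^sup>2)" by (intro sum_mono)
  then have "(\<Sum>i<n. \<Sum>t<T. (y\<^sub>0 (tn i t w))\<^sup>2) / real (n * T) \<le> y_bd\<^sup>2"
    by (cases "n * T = 0") (auto simp: divide_le_eq ac_simps)
  moreover have "0 \<le> (\<Sum>i<n. \<Sum>t<T. (y\<^sub>0 (tn i t w))\<^sup>2) / real (n * T)"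
    by (intro divide_nonneg_nonneg sum_nonneg) auto
  ultimately show ?thesis using sigma2_pos by (simp only: abs_le_iff) linarith
qed

lemma score_clt:
  assumes N: "filterlim (\<lambda>j. real (n j * T j)) at_top sequentially"
  shows "weak_conv_m (\<lambda>j. distr M borel (\<lambda>w. (\<Sum>i<n j. \<Sum>t<T j. y\<^sub>0 (tn i t w)) / sqrt (real (n j * T j)) / sqrt \<sigma>2))
    std_normal_distribution"
proof -
  let ?I = "\<lambda>j. {..<n j} \<times> {..<T j}" and ?Y = "\<lambda>ii w. y\<^sub>0 (tn (fst ii) (snd ii) w)"
  define V where "V j w = (\<Sum>i<n j. \<Sum>t<T j. (y\<^sub>0 (tn i t w))\<^sup>2) / real (n j * T j) - \<sigma>2" for j w
  have [measurable]: "V j \<in> borel_measurable M" for j unfolding V_def by measurable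
  obtain V0 where V0: "0 \<le> V0" "\<And>j. 0 < n j * T j \<Longrightarrow> expectation (\<lambda>w. (V j w)\<^sup>2) \<le> V0 / real (n j * T j)"
    using y0_square_moment unfolding V_def by blast
  have Vb: "\<bar>V j w\<bar> \<le> y_bd\<^sup>2 + \<sigma>2" for j w unfolding V_def by (rule y0_average_bound)
  have lim: "(\<lambda>j. expectation (\<lambda>w. \<bar>V j w\<bar>)) \<longlonglongrightarrow> 0"
  proof (rule tendsto_sandwich[OF _ _ tendsto_const])
    have "(\<lambda>j. sqrt (V0 / real (n j * T j))) \<longlonglongrightarrow> sqrt 0"
      by (intro tendsto_real_sqrt real_tendsto_divide_at_top[OF tendsto_const N])
    then show "(\<lambda>j. sqrt (V0 / real (n j * T j))) \<longlonglongrightarrow> 0" by simp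
    show "\<forall>\<^sub>F j in sequentially. 0 \<le> expectation (\<lambda>w. \<bar>V j w\<bar>)" by (intro always_eventually allI) simp
    have "\<forall>\<^sub>F j in sequentially. 1 \<le> real (n j * T j)" using N by (simp add: filterlim_at_top)
    then show "\<forall>\<^sub>F j in sequentially. expectation (\<lambda>w. \<bar>V j w\<bar>) \<le> sqrt (V0 / real (n j * T j))"
    proof eventually_elim
      case (elim j)
      have i1: "integrable M (\<lambda>w. \<bar>V j w\<bar>)" using Vb by (intro integrable_const_bound[where B="y_bd\<^sup>2 + \<sigma>2"]) auto
      have "AE w in M. norm (\<bar>V j w\<bar>\<^sup>2) \<le> (y_bd\<^sup>2 + \<sigma>2)\<^sup>2"
      proof (rule AE_I2)
        show "norm (\<bar>V j w\<bar>\<^sup>2) \<le> (y_bd\<^sup>2 + \<sigma>2)\<^sup>2" for w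
          using power_mono[OF Vb[of j w] abs_ge_zero, of 2] by simp
      qed
      then have i2: "integrable M (\<lambda>w. \<bar>V j w\<bar>\<^sup>2)" by (intro integrable_const_bound[where B="(y_bd\<^sup>2 + \<sigma>2)\<^sup>2"]) auto
      \<comment> \<open>Nonnegativity of the variance bounds the first absolute moment by the root
        of the second.\<close>
      have "0 \<le> variance (\<lambda>w. \<bar>V j w\<bar>)" by (rule variance_positive)
      also have "\<dots> = expectation (\<lambda>w. \<bar>V j w\<bar>\<^sup>2) - (expectation (\<lambda>w. \<bar>V j w\<bar>))\<^sup>2"
        by (rule variance_eq[OF i1 i2])
      finally have "(expectation (\<lambda>w. \<bar>V j w\<bar>))\<^sup>2 \<le> expectation (\<lambda>w. (V j w)\<^sup>2)" by simp
      also have "\<dots> \<le> V0 / real (n j * T j)"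
      proof (rule V0(2))
        show "0 < n j * T j" using elim by (metis of_nat_0_less_iff less_le_trans zero_less_one)
      qed
      finally show ?case by (rule real_le_rsqrt)
    qed
  qed
  have card: "real (card (?I j)) = real (n j * T j)" for j by simp
  have nested: "(\<Sum>ii\<in>?I j. h (fst ii) (snd ii)) = (\<Sum>i<n j. \<Sum>t<T j. h i t :: real)" for h j
    by (simp add: sum.cartesian_product case_prod_unfold)
  have "weak_conv_m (\<lambda>j. distr M borel (\<lambda>w. (\<Sum>ii\<in>?I j. ?Y ii w) / (sqrt \<sigma>2 * sqrt (real (card (?I j))))))
    std_normal_distribution"
  proof (rule mcleish_clt)
    show "\<bar>?Y ii w\<bar> \<le> y_bd" for ii w by (rule y0_bound)
    show "0 < sqrt \<sigma>2" using sigma2_pos by simp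
    show "filterlim (\<lambda>j. real (card (?I j))) at_top sequentially" unfolding card by (rule N)
    show "expectation (\<lambda>w. \<Prod>ii\<in>?I j. 1 + \<i> * of_real (u * ?Y ii w)) = 1" for j u
      by (rule expectation_product)
    have "(sqrt \<sigma>2)\<^sup>2 = \<sigma>2" using sigma2_pos by simp
    then show "(\<lambda>j. expectation (\<lambda>w. \<bar>(\<Sum>ii\<in>?I j. (?Y ii w)\<^sup>2) / real (card (?I j)) - (sqrt \<sigma>2)\<^sup>2\<bar>)) \<longlonglongrightarrow> 0"
      using lim unfolding V_def card nested[of "\<lambda>i t. (y\<^sub>0 (tn i t _))\<^sup>2"] by (simp only:)
  qed simp_all
  then show ?thesis
    unfolding card nested[of "\<lambda>i t. y\<^sub>0 (tn i t _)"] by (simp add: divide_divide_eq_left mult.commute)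
qed

text \<open>The bound on the summed remainders in \<open>total_remainder\<close>, divided by sqrt N.
  In its last summand a factor sqrt N is left, and there the condition on m is decisive.\<close>

definition remainder_rate :: "real \<Rightarrow> nat \<Rightarrow> nat \<Rightarrow> real \<Rightarrow> real \<Rightarrow> real \<Rightarrow> real" where
  "remainder_rate C K m N s t3 = real K * total_bound C (m - 1) * (1 / sqrt N + s + 2 * t3 + sqrt N * (t3 * s))"

text \<open>The bound of \<open>sample_var_perturbation\<close> with \<delta> and \<beta> from
  \<open>total_remainder\<close>; the 3 comes from t3 + 1 + s, all of whose terms are at most
  1.\<close>

definition variance_rate :: "real \<Rightarrow> nat \<Rightarrow> nat \<Rightarrow> real \<Rightarrow> real \<Rightarrow> real \<Rightarrow> real" where
  "variance_rate C K m N s t3 =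
     (let \<delta> = real K * total_bound C (m - 1) * (t3 + 1 / sqrt N + s);
          \<beta> = real K * (c * (real (card F) * (C * C))) * (1 / sqrt N)
      in 2 * (C * (1 / sqrt N) + (2 * y_bd + total_bound C (m - 1) * 3) * \<delta> + (\<beta> + \<delta>)\<^sup>2) + 2 * \<sigma>2 / N)"

text \<open>The data D are an arbitrary array of valid transitions, and probability enters only
  through the favourable event described by \<open>good\<close> and \<open>V\<close>. The bounds of
  \<open>total_remainder\<close> are rescaled for the mean and inserted into
  \<open>sample_var_perturbation\<close> for the variance.\<close>

lemma estimator_error_bounds:
  fixes D :: "nat \<Rightarrow> nat \<Rightarrow> ('s, 'a) transition"
  assumes g: "g \<in> fold_assignments n K" and T: "1 \<le> T" and n: "2 \<le> n"
    and valid: "\<And>i t. valid (D i t)"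
    and C: "1 \<le> C" "e_bd \<le> C" "B \<le> C"
    and t: "0 \<le> t" "t \<le> 1" and q: "0 \<le> q" "q \<le> 1" and t3: "0 \<le> t3" "t3 \<le> 1"
    and m: "\<And>k. k < K \<Longrightarrow> m - 1 \<le> card (in_fold n g k) * T"
    and good: "\<And>k. k < K \<Longrightarrow> good_fold C (1 / sqrt (real (card (in_fold n g k \<times> {..<T})))) q t t3
        (in_fold n g k \<times> {..<T}) D (Qh k) (\<tau>h k) (\<omega>h k)"
    and V: "\<bar>sqrt (real (n * T)) * ((\<Sum>i<n. \<Sum>j<T. (y\<^sub>0 (D i j))\<^sup>2) / real (n * T) - \<sigma>2)\<bar> \<le> C"
  defines "x \<equiv> psi \<gamma> pol G n T g D Qh \<tau>h \<omega>h m"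
    and "s \<equiv> q * t ^ (m - 1)" and "N \<equiv> real (n * T)"
  shows "\<bar>sqrt N * (sample_mean n T x - policy_value \<gamma> p r pol G) - (\<Sum>i<n. \<Sum>j<T. y\<^sub>0 (D i j)) / sqrt N\<bar>
      \<le> remainder_rate C K m N s t3"
    and "\<bar>sample_var n T x - \<sigma>2\<bar> \<le> variance_rate C K m N s t3"
proof -
  let ?\<eta> = "policy_value \<gamma> p r pol G" and ?TB = "total_bound C (m - 1)"
  define d where "d i j = x i j - ?\<eta> - y\<^sub>0 (D i j)" for i j
  define R where "R = sqrt N"
  have "2 \<le> n * T" using T n mult_le_mono[of 2 n 1 T] by simp
  then have N2: "2 \<le> N" unfolding N_def by linarith
  have N: "N = R * R" "0 < R" using N2 by (auto simp: R_def)
  note rem = total_remainder[OF g T valid C t q t3(1) m good, folded x_def s_def N_def d_def R_def]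
  have s1: "s \<le> 1" "0 \<le> s" using t q by (auto simp: s_def power_le_one intro!: mult_le_one)
  have TB: "0 \<le> ?TB"
    unfolding total_bound_def using discount' C fold_bound_nonneg[of C] by (intro add_nonneg_nonneg mult_nonneg_nonneg) auto
  have "sample_mean n T x - ?\<eta> = ((\<Sum>i<n. \<Sum>j<T. y\<^sub>0 (D i j)) + (\<Sum>i<n. \<Sum>j<T. d i j)) / N"
  proof -
    have "(\<Sum>i<n. \<Sum>j<T. y\<^sub>0 (D i j)) + (\<Sum>i<n. \<Sum>j<T. d i j) = (\<Sum>i<n. \<Sum>j<T. x i j - ?\<eta>)"
      unfolding sum.distrib[symmetric] by (intro sum.cong refl) (simp add: d_def)
    also have "\<dots> = (\<Sum>i<n. \<Sum>j<T. x i j) - N * ?\<eta>" by (simp add: sum_subtractf N_def)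
    finally have "(\<Sum>i<n. \<Sum>j<T. x i j) - N * ?\<eta> = (\<Sum>i<n. \<Sum>j<T. y\<^sub>0 (D i j)) + (\<Sum>i<n. \<Sum>j<T. d i j)" ..
    moreover have "sample_mean n T x - ?\<eta> = ((\<Sum>i<n. \<Sum>j<T. x i j) - N * ?\<eta>) / N"
      using N2 unfolding sample_mean_def N_def[symmetric] by (simp add: diff_divide_distrib)
    ultimately show ?thesis by simp
  qed
  then have "R * (sample_mean n T x - ?\<eta>) - (\<Sum>i<n. \<Sum>j<T. y\<^sub>0 (D i j)) / R = (\<Sum>i<n. \<Sum>j<T. d i j) / R"
    using N(2) unfolding N(1) by (simp add: add_divide_distrib distrib_left)
  also have "\<bar>\<dots>\<bar> \<le> (real K * ?TB * (1 + R * s + 2 * (R * t3) + N * t3 * s)) / R"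
  proof -
    have "\<bar>\<Sum>i<n. \<Sum>j<T. d i j\<bar> \<le> real K * ?TB * (1 + R * s + 2 * (R * t3) + N * t3 * s)" by (rule rem(1)) auto
    then show ?thesis unfolding abs_divide using N(2) by (simp add: divide_right_mono)
  qed
  also have "\<dots> = remainder_rate C K m N s t3"
    unfolding remainder_rate_def R_def[symmetric] using N(2) by (simp add: N(1) field_simps)
  finally show "\<bar>sqrt N * (sample_mean n T x - ?\<eta>) - (\<Sum>i<n. \<Sum>j<T. y\<^sub>0 (D i j)) / sqrt N\<bar> \<le> remainder_rate C K m N s t3"
    unfolding R_def .
  define \<delta> where "\<delta> = real K * ?TB * (t3 + 1 / R + s)"
  define \<beta> where "\<beta> = real K * (c * (real (card F) * (C * C))) * (1 / R)"
  have "\<bar>sample_var n T x - \<sigma>2\<bar> \<le> 2 * (\<bar>(\<Sum>i<n. \<Sum>j<T. (y\<^sub>0 (D i j))\<^sup>2) / N - \<sigma>2\<bar> + (2 * y_bd + ?TB * 3) * \<delta> + (\<beta> + \<delta>)\<^sup>2) + 2 * \<sigma>2 / N"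
  proof (rule sample_var_perturbation[where \<eta>="?\<eta>", OF meta_eq_to_obj_eq[OF N_def] N2])
    show "0 \<le> \<sigma>2" using sigma2_pos by simp
    show "\<bar>y\<^sub>0 (D i j)\<bar> \<le> y_bd" for i j by (rule y0_bound)
    show "\<bar>x i j - ?\<eta> - y\<^sub>0 (D i j)\<bar> \<le> ?TB * 3" if "i < n" "j < T" for i j
    proof -
      have "\<bar>d i j\<bar> \<le> ?TB * (t3 + 1 + s)" by (rule rem(3)) (use that in auto)
      also have "\<dots> \<le> ?TB * 3" using s1 t3 TB by (intro mult_left_mono) auto
      finally show ?thesis unfolding d_def .
    qed
    have "(\<Sum>i<n. \<Sum>j<T. \<bar>d i j\<bar>) \<le> real K * ?TB * (N * t3 + R + N * s)" by (rule rem(2)) auto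
    also have "\<dots> = N * \<delta>" unfolding \<delta>_def using N(2) by (simp add: N(1) field_simps)
    finally show "(\<Sum>i<n. \<Sum>j<T. \<bar>x i j - ?\<eta> - y\<^sub>0 (D i j)\<bar>) \<le> N * \<delta>" unfolding d_def .
    have "\<bar>\<Sum>i<n. \<Sum>j<T. y\<^sub>0 (D i j)\<bar> \<le> real K * (c * (real (card F) * (C * C))) * R" by (rule rem(4)) auto
    also have "\<dots> = N * \<beta>" unfolding \<beta>_def using N(2) by (simp add: N(1))
    finally show "\<bar>\<Sum>i<n. \<Sum>j<T. y\<^sub>0 (D i j)\<bar> \<le> N * \<beta>" .
  qed
  also have "\<bar>(\<Sum>i<n. \<Sum>j<T. (y\<^sub>0 (D i j))\<^sup>2) / N - \<sigma>2\<bar> \<le> C * (1 / R)"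
  proof -
    have "R * \<bar>(\<Sum>i<n. \<Sum>j<T. (y\<^sub>0 (D i j))\<^sup>2) / N - \<sigma>2\<bar> \<le> C"
      using V N(2) unfolding N_def[symmetric] R_def[symmetric] abs_mult by (simp only: abs_of_pos)
    then show ?thesis using N(2) by (simp add: pos_le_divide_eq mult.commute)
  qed
  finally show "\<bar>sample_var n T x - \<sigma>2\<bar> \<le> variance_rate C K m N s t3"
    unfolding variance_rate_def Let_def R_def[symmetric] \<delta>_def \<beta>_def by simp
qed

end

subsection \<open>Asymptotic coverage\<close>

context ope_data
begin

context
  fixes K m :: nat and n T :: "nat \<Rightarrow> nat" and f :: "nat \<Rightarrow> 'w \<Rightarrow> nat \<Rightarrow> nat"
    and Qest \<omega>est :: "nat \<Rightarrow> nat \<Rightarrow> (nat \<Rightarrow> nat) \<Rightarrow> (nat \<Rightarrow> nat \<Rightarrow> ('s, 'a) transition) \<Rightarrow> 'a \<Rightarrow> 's \<Rightarrow> real"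
    and \<tau>est :: "nat \<Rightarrow> nat \<Rightarrow> (nat \<Rightarrow> nat) \<Rightarrow> (nat \<Rightarrow> nat \<Rightarrow> ('s, 'a) transition) \<Rightarrow> 'a \<Rightarrow> 's \<Rightarrow> 'a \<Rightarrow> 's \<Rightarrow> real"
    and \<alpha>1 \<alpha>2 \<alpha>3 B' :: real
  assumes sample_size: "\<forall>j. 1 \<le> T j" "filterlim (\<lambda>j. max (n j) (T j)) at_top sequentially"
    and folds: "2 \<le> K" "\<forall>j. random_division M X (n j) K (f j)"
    and estimators:
      "\<forall>j. \<forall>k<K. \<forall>a s. estimator_measurable (n j) (T j) K k (\<lambda>g D. Qest j k g D a s)"
      "\<forall>j. \<forall>k<K. \<forall>a s a' s'. estimator_measurable (n j) (T j) K k (\<lambda>g D. \<tau>est j k g D a s a' s')"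
      "\<forall>j. \<forall>k<K. \<forall>a s. estimator_measurable (n j) (T j) K k (\<lambda>g D. \<omega>est j k g D a s)"
    and rates_pos: "0 < \<alpha>1" "0 < \<alpha>2" "0 < \<alpha>3"
begin

abbreviation Qhat where
  "Qhat j w k \<equiv> fitted (n j) (T j) k (Qest j k) (f j w) (transitions S A R w)"
abbreviation \<tau>hat where
  "\<tau>hat j w k \<equiv> fitted (n j) (T j) k (\<tau>est j k) (f j w) (transitions S A R w)"
abbreviation \<omega>hat where
  "\<omega>hat j w k \<equiv> fitted (n j) (T j) k (\<omega>est j k) (f j w) (transitions S A R w)"

context
  assumes rates:
      "\<forall>k<K. (\<lambda>j. L2_error M pinf (\<lambda>w. Qhat j w k) (Q_fun \<gamma> p r pol))
               \<in> O(\<lambda>j. real (n j * T j) powr (- \<alpha>1))"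
      "\<forall>k<K. (\<lambda>j. L2_error2 M pinf (\<lambda>w. \<tau>hat j w k) (tau_ratio \<gamma> p pol pinf))
               \<in> O(\<lambda>j. real (n j * T j) powr (- \<alpha>2))"
      "\<forall>k<K. (\<lambda>j. L2_error M pinf (\<lambda>w. \<omega>hat j w k) (omega_ratio \<gamma> p pol G pinf))
               \<in> O(\<lambda>j. real (n j * T j) powr (- \<alpha>3))"
    and bounded_estimators:
      "\<forall>j. \<forall>k<K. AE w in M. \<forall>(a, s)\<in>set_pmf pinf.
         \<bar>Qhat j w k a s\<bar> \<le> B' \<and> \<bar>\<omega>hat j w k a s\<bar> \<le> B' \<and>
         (\<forall>(a', s')\<in>set_pmf pinf. \<bar>\<tau>hat j w k a s a' s'\<bar> \<le> B')"
    and order: "1 / 2 < \<alpha>1 + real (m - 1) * \<alpha>2 + \<alpha>3"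
    and enough_indices: "\<forall>j. \<forall>w\<in>space M. \<forall>k<K. m - 1 \<le> card (in_fold (n j) (f j w) k) * T j"
begin

abbreviation N :: "nat \<Rightarrow> real" where "N j \<equiv> real (n j * T j)"
abbreviation q\<^sub>1 where "q\<^sub>1 j \<equiv> N j powr (- \<alpha>1)"
abbreviation q\<^sub>2 where "q\<^sub>2 j \<equiv> N j powr (- \<alpha>2)"
abbreviation q\<^sub>3 where "q\<^sub>3 j \<equiv> N j powr (- \<alpha>3)"
abbreviation J where "J j w k \<equiv> in_fold (n j) (f j w) k \<times> {..<T j}"

lemma measurable_f: "f j \<in> measurable M (count_space (fold_assignments (n j) K))"
  using folds by (auto simp: random_division_def)

lemma f_in: "w \<in> space M \<Longrightarrow> f j w \<in> fold_assignments (n j) K"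
  using measurable_space[OF measurable_f] by simp

lemma n_ge_2: "2 \<le> n j"
proof -
  obtain w where "w \<in> space M" using not_empty by blast
  then have "f j w ` {..<n j} = {..<K}" using f_in by (auto simp: fold_assignments_def)
  then have "K \<le> n j" using card_image_le[of "{..<n j}" "f j w"] by simp
  then show ?thesis using folds by simp
qed

lemma T_ge_1: "1 \<le> T j"
  using sample_size by blast

lemma N_pos: "0 < n j * T j"
  using n_ge_2[of j] T_ge_1[of j] by simp

lemma N_ge_1: "1 \<le> N j"
  using N_pos[of j] by linarith

text \<open>Both factors are at least 1, so the product dominates whichever of them
  diverges.\<close>

lemma N_at_top: "filterlim N at_top sequentially"
proof (rule filterlim_at_top_mono)
  show "filterlim (\<lambda>j. real (max (n j) (T j))) at_top sequentially"
    by (rule filterlim_compose[OF filterlim_real_sequentially sample_size(2)])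
  have "max (n j) (T j) \<le> n j * T j" for j
    using n_ge_2[of j] T_ge_1[of j] mult_le_mono[of "n j" "n j" 1 "T j"] mult_le_mono[of 1 "n j" "T j" "T j"] by simp
  then show "\<forall>\<^sub>F j in sequentially. real (max (n j) (T j)) \<le> N j"
    by (intro always_eventually allI) (simp only: of_nat_le_iff)
qed

lemma rate_bounds: "0 < \<alpha> \<Longrightarrow> 0 < N j powr (- \<alpha>)" "0 < \<alpha> \<Longrightarrow> N j powr (- \<alpha>) \<le> 1"
proof -
  have N: "1 \<le> N j" "N j \<noteq> 0" using N_ge_1[of j] by linarith+
  show "0 < N j powr (- \<alpha>)" by (subst powr_gt_zero) (rule N(2))
  have "1 \<le> N j powr \<alpha>" if "0 < \<alpha>" using N that by (intro ge_one_powr_ge_zero) auto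
  then show "N j powr (- \<alpha>) \<le> 1" if "0 < \<alpha>" using that by (simp only: powr_minus inverse_le_1_iff) simp
qed

section \<open>Tightness of the scaled estimation errors\<close>

lemma measurable_Qhat: "k < K \<Longrightarrow> (\<lambda>w. Qhat j w k a s) \<in> borel_measurable M"
  using estimators(1) by (intro measurable_fitted[where E="\<lambda>q. q a s", OF _ measurable_f]) auto

lemma measurable_\<tau>hat: "k < K \<Longrightarrow> (\<lambda>w. \<tau>hat j w k a s a' s') \<in> borel_measurable M"
  using estimators(2) by (intro measurable_fitted[where E="\<lambda>q. q a s a' s'", OF _ measurable_f]) auto

lemma measurable_\<omega>hat: "k < K \<Longrightarrow> (\<lambda>w. \<omega>hat j w k a s) \<in> borel_measurable M"
  using estimators(3) by (intro measurable_fitted[where E="\<lambda>q. q a s", OF _ measurable_f]) auto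

lemma AE_estimators:
  assumes "k < K" "z \<in> F"
  shows "AE w in M. \<bar>Qhat j w k (fst z) (snd z)\<bar> \<le> B'" "AE w in M. \<bar>\<omega>hat j w k (fst z) (snd z)\<bar> \<le> B'"
    and "z' \<in> F \<Longrightarrow> AE w in M. \<bar>kern (\<tau>hat j w k) z z'\<bar> \<le> B'"
proof -
  have ae: "AE w in M. \<forall>(a, s)\<in>F.
         \<bar>Qhat j w k a s\<bar> \<le> B' \<and> \<bar>\<omega>hat j w k a s\<bar> \<le> B' \<and>
         (\<forall>(a', s')\<in>F. \<bar>\<tau>hat j w k a s a' s'\<bar> \<le> B')"
    using bounded_estimators assms(1) by blast
  show "AE w in M. \<bar>Qhat j w k (fst z) (snd z)\<bar> \<le> B'"
    using ae by eventually_elim (use assms(2) in \<open>force simp: case_prod_unfold\<close>)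
  show "AE w in M. \<bar>\<omega>hat j w k (fst z) (snd z)\<bar> \<le> B'"
    using ae by eventually_elim (use assms(2) in \<open>force simp: case_prod_unfold\<close>)
  show "AE w in M. \<bar>kern (\<tau>hat j w k) z z'\<bar> \<le> B'" if "z' \<in> F"
    using ae by eventually_elim (use assms(2) that in \<open>force simp: case_prod_unfold kern_def\<close>)
qed

lemma tight_Q: "k < K \<Longrightarrow> z \<in> F \<Longrightarrow> tight (\<lambda>j w. err (Qhat j w k) z / q\<^sub>1 j)"
proof (rule tight_rate[where D="B' + c * B"])
  assume k: "k < K" and z: "z \<in> F"
  show "(\<lambda>w. err (Qhat j w k) z) \<in> borel_measurable M" for j
    unfolding err_def using measurable_Qhat[OF k] by measurable
  show "AE w in M. \<bar>err (Qhat j w k) z\<bar> \<le> B' + c * B" for j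
    using AE_estimators(1)[OF k z, of j] by eventually_elim (use Qpi_bound[of z] in \<open>auto simp: err_def\<close>)
  show "0 < pmf pinf z" using z by (simp add: pmf_positive)
  show "pmf pinf z * expectation (\<lambda>w. (err (Qhat j w k) z)\<^sup>2) \<le> (L2_error M pinf (\<lambda>w. Qhat j w k) (Q_fun \<gamma> p r pol))\<^sup>2" for j
    using L2_error_pointwise[OF z, of "\<lambda>w. Qhat j w k" "Q_fun \<gamma> p r pol"] by (simp add: err_def Qpi_def)
  show "(\<lambda>j. L2_error M pinf (\<lambda>w. Qhat j w k) (Q_fun \<gamma> p r pol)) \<in> O(\<lambda>j. q\<^sub>1 j)" using rates(1) k by blast
qed (rule rate_bounds(1)[OF rates_pos(1)])

lemma tight_\<omega>: "k < K \<Longrightarrow> z \<in> F \<Longrightarrow> tight (\<lambda>j w. (\<omega>hat j w k (fst z) (snd z) - \<omega> z) / q\<^sub>3 j)"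
proof (rule tight_rate[where D="B' + B"])
  assume k: "k < K" and z: "z \<in> F"
  show "(\<lambda>w. \<omega>hat j w k (fst z) (snd z) - \<omega> z) \<in> borel_measurable M" for j
    using measurable_\<omega>hat[OF k] by measurable
  show "AE w in M. \<bar>\<omega>hat j w k (fst z) (snd z) - \<omega> z\<bar> \<le> B' + B" for j
    using AE_estimators(2)[OF k z, of j] by eventually_elim (use omega_bound[OF z] in auto)
  show "0 < pmf pinf z" using z by (simp add: pmf_positive)
  show "pmf pinf z * expectation (\<lambda>w. (\<omega>hat j w k (fst z) (snd z) - \<omega> z)\<^sup>2)
     \<le> (L2_error M pinf (\<lambda>w. \<omega>hat j w k) (omega_ratio \<gamma> p pol G pinf))\<^sup>2" for j
    using L2_error_pointwise[OF z, of "\<lambda>w. \<omega>hat j w k" "omega_ratio \<gamma> p pol G pinf"] by (simp add: \<omega>_def)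
  show "(\<lambda>j. L2_error M pinf (\<lambda>w. \<omega>hat j w k) (omega_ratio \<gamma> p pol G pinf)) \<in> O(\<lambda>j. q\<^sub>3 j)" using rates(3) k by blast
qed (rule rate_bounds(1)[OF rates_pos(3)])

lemma tight_\<tau>: "k < K \<Longrightarrow> z \<in> F \<Longrightarrow> z' \<in> F \<Longrightarrow> tight (\<lambda>j w. (kern (\<tau>hat j w k) z z' - \<tau> z z') / q\<^sub>2 j)"
proof (rule tight_rate[where D="B' + B"])
  assume k: "k < K" and z: "z \<in> F" "z' \<in> F"
  show "(\<lambda>w. kern (\<tau>hat j w k) z z' - \<tau> z z') \<in> borel_measurable M" for j
    unfolding kern_def using measurable_\<tau>hat[OF k] by measurable
  show "AE w in M. \<bar>kern (\<tau>hat j w k) z z' - \<tau> z z'\<bar> \<le> B' + B" for j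
    using AE_estimators(3)[OF k z, of j] by eventually_elim (use tau_bound[OF z] in auto)
  show "0 < pmf pinf z * pmf pinf z'" using z by (simp add: pmf_positive)
  show "pmf pinf z * pmf pinf z' * expectation (\<lambda>w. (kern (\<tau>hat j w k) z z' - \<tau> z z')\<^sup>2)
     \<le> (L2_error2 M pinf (\<lambda>w. \<tau>hat j w k) (tau_ratio \<gamma> p pol pinf))\<^sup>2" for j
    using L2_error2_pointwise[OF z, of "\<lambda>w. \<tau>hat j w k" "tau_ratio \<gamma> p pol pinf"] by (simp add: \<tau>_def kern_def)
  show "(\<lambda>j. L2_error2 M pinf (\<lambda>w. \<tau>hat j w k) (tau_ratio \<gamma> p pol pinf)) \<in> O(\<lambda>j. q\<^sub>2 j)" using rates(2) k by blast
qed (rule rate_bounds(1)[OF rates_pos(2)])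

abbreviation scaled_avg where
  "scaled_avg \<phi> \<mu> k j w \<equiv> sqrt (real (card (J j w k))) * (fold_avg (in_fold (n j) (f j w) k) (T j) \<phi> w - \<mu>)"

lemma tight_e: "k < K \<Longrightarrow> z \<in> F \<Longrightarrow> tight (scaled_avg (\<lambda>y. e y z) 0 k)"
proof -
  assume k: "k < K" and z: "z \<in> F"
  obtain V where V: "0 \<le> V" "\<And>I T. finite I \<Longrightarrow> expectation (\<lambda>w. (\<Sum>ii\<in>I \<times> {..<T}.
      e (tn (fst ii) (snd ii) w) z)\<^sup>2) \<le> V * real (card (I \<times> {..<T}))"
    using second_moment_e[OF z] by blast
  show ?thesis
    by (rule tight_fold_avg[where V=V and D=e_bd, OF folds(2) k sample_size(1) e_measurable e_bound])
       (use V in simp)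
qed

lemma tight_b: "k < K \<Longrightarrow> tight (scaled_avg (\<lambda>y. b y z z') (Bm z z') k)"
proof -
  assume k: "k < K"
  obtain V where V: "0 \<le> V" "\<And>I T. finite I \<Longrightarrow> expectation (\<lambda>w. (\<Sum>ii\<in>I \<times> {..<T}.
      b (tn (fst ii) (snd ii) w) z z' - Bm z z')\<^sup>2) \<le> V * real (card (I \<times> {..<T}))"
    using second_moment_mixing[OF b_measurable b_bound, of z z'] unfolding expectation_b by blast
  show ?thesis
    by (rule tight_fold_avg[where V=V and D=1, OF folds(2) k sample_size(1) b_measurable b_bound V(2)])
qed

abbreviation Vhat where
  "Vhat j w \<equiv> sqrt (N j) * ((\<Sum>i<n j. \<Sum>t<T j. (y\<^sub>0 (tn i t w))\<^sup>2) / N j - \<sigma>2)"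

lemma tight_Vhat: "tight Vhat"
proof -
  obtain V where V: "0 \<le> V" "\<And>n T. 0 < n * T \<Longrightarrow>
     expectation (\<lambda>w. ((\<Sum>i<n. \<Sum>t<T. (y\<^sub>0 (tn i t w))\<^sup>2) / real (n * T) - \<sigma>2)\<^sup>2) \<le> V / real (n * T)"
    using y0_square_moment by blast
  show ?thesis
  proof (rule tight_second_moment[where V=V], intro always_eventually allI conjI)
    fix j
    let ?h = "\<lambda>w. (\<Sum>i<n j. \<Sum>t<T j. (y\<^sub>0 (tn i t w))\<^sup>2) / N j - \<sigma>2"
    have sq: "(Vhat j w)\<^sup>2 = N j * (?h w)\<^sup>2" for w
      using N_ge_1[of j] by (simp only: power_mult_distrib real_sqrt_pow2)
    show m: "Vhat j \<in> borel_measurable M" by measurable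
    have "AE w in M. norm ((?h w)\<^sup>2) \<le> (y_bd\<^sup>2 + \<sigma>2)\<^sup>2"
    proof (rule AE_I2)
      show "norm ((?h w)\<^sup>2) \<le> (y_bd\<^sup>2 + \<sigma>2)\<^sup>2" for w
        using power_mono[OF y0_average_bound[where n="n j" and T="T j" and w=w] abs_ge_zero, of 2] by simp
    qed
    then have "integrable M (\<lambda>w. (?h w)\<^sup>2)"
      by (intro integrable_const_bound[where B="(y_bd\<^sup>2 + \<sigma>2)\<^sup>2"]) auto
    then show "integrable M (\<lambda>w. (Vhat j w)\<^sup>2)" unfolding sq by (rule integrable_mult_right)
    have "expectation (\<lambda>w. (Vhat j w)\<^sup>2) = N j * expectation (\<lambda>w. (?h w)\<^sup>2)"
      unfolding sq by simp
    also have "\<dots> \<le> N j * (V / N j)"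
      by (intro mult_left_mono V(2) N_pos) simp
    also have "\<dots> = V" using N_pos[of j] by simp
    finally show "expectation (\<lambda>w. (Vhat j w)\<^sup>2) \<le> V" .
  qed
qed

definition W\<^sub>1 where
  "W\<^sub>1 k z j w = \<bar>err (Qhat j w k) z / q\<^sub>1 j\<bar> + \<bar>\<omega>hat j w k (fst z) (snd z)\<bar>
     + \<bar>(\<omega>hat j w k (fst z) (snd z) - \<omega> z) / q\<^sub>3 j\<bar> + \<bar>scaled_avg (\<lambda>y. e y z) 0 k j w\<bar>"

definition W\<^sub>2 where
  "W\<^sub>2 k z z' j w = \<bar>kern (\<tau>hat j w k) z z'\<bar> + \<bar>(kern (\<tau>hat j w k) z z' - \<tau> z z') / q\<^sub>2 j\<bar>
     + \<bar>scaled_avg (\<lambda>y. b y z z') (Bm z z') k j w\<bar>"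

text \<open>One tight variable dominating all scaled errors over all folds and points of
  \<open>F\<close>. As its summands are nonnegative, the single event that it is at most C makes
  every fold good at once.\<close>

definition W where
  "W j w = \<bar>Vhat j w\<bar> + (\<Sum>k<K. \<Sum>z\<in>F. W\<^sub>1 k z j w + (\<Sum>z'\<in>F. W\<^sub>2 k z z' j w))"

lemma tight_W: "tight W"
proof -
  have "tight (\<lambda>j w. W\<^sub>1 k z j w)" if "k < K" "z \<in> F" for k z
  proof -
    have "tight (\<lambda>j w. \<omega>hat j w k (fst z) (snd z))"
      by (rule tight_AE[where C=B'], rule always_eventually, rule allI, rule AE_estimators(2)[OF that])
    then show ?thesis
      unfolding W\<^sub>1_def using tight_Q[OF that] tight_\<omega>[OF that] tight_e[OF that]
      by (intro tight_add) (simp_all only: tight_abs)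
  qed
  moreover have "tight (\<lambda>j w. W\<^sub>2 k z z' j w)" if "k < K" "z \<in> F" "z' \<in> F" for k z z'
  proof -
    have "tight (\<lambda>j w. kern (\<tau>hat j w k) z z')"
      by (rule tight_AE[where C=B'], rule always_eventually, rule allI, rule AE_estimators(3)[OF that])
    then show ?thesis
      unfolding W\<^sub>2_def using tight_\<tau>[OF that] tight_b[OF that(1), of z z']
      by (intro tight_add) (simp_all only: tight_abs)
  qed
  ultimately show ?thesis
    unfolding W_def using tight_Vhat finite_F
    by (intro tight_add tight_sum) (simp_all add: tight_abs)
qed

lemma W_good:
  assumes w: "w \<in> space M" and C: "W j w \<le> C" and k: "k < K"
  shows "good_fold C (1 / sqrt (real (card (J j w k)))) (q\<^sub>1 j) (q\<^sub>2 j) (q\<^sub>3 j) (J j w k) (transitions S A R w)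
     (Qhat j w k) (\<tau>hat j w k) (\<omega>hat j w k)"
    and "\<bar>Vhat j w\<bar> \<le> C"
proof -
  have n1: "0 \<le> W\<^sub>1 k z j w" "0 \<le> W\<^sub>2 k z z' j w" for k z z' by (simp_all add: W\<^sub>1_def W\<^sub>2_def)
  have n2: "0 \<le> W\<^sub>1 k z j w + (\<Sum>z'\<in>F. W\<^sub>2 k z z' j w)" for k z using n1 by (intro add_nonneg_nonneg sum_nonneg)
  have n3: "0 \<le> (\<Sum>z\<in>F. W\<^sub>1 k z j w + (\<Sum>z'\<in>F. W\<^sub>2 k z z' j w))" for k using n2 by (intro sum_nonneg)
  have V: "\<bar>Vhat j w\<bar> + (\<Sum>k<K. \<Sum>z\<in>F. W\<^sub>1 k z j w + (\<Sum>z'\<in>F. W\<^sub>2 k z z' j w)) \<le> C"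
    using C unfolding W_def .
  have "0 \<le> (\<Sum>k<K. \<Sum>z\<in>F. W\<^sub>1 k z j w + (\<Sum>z'\<in>F. W\<^sub>2 k z z' j w))" by (rule sum_nonneg) (rule n3)
  then show "\<bar>Vhat j w\<bar> \<le> C" using V by linarith
  have le: "W\<^sub>1 k z j w + (\<Sum>z'\<in>F. W\<^sub>2 k z z' j w) \<le> C" if "z \<in> F" for z
  proof -
    have "W\<^sub>1 k z j w + (\<Sum>z'\<in>F. W\<^sub>2 k z z' j w) \<le> (\<Sum>z\<in>F. W\<^sub>1 k z j w + (\<Sum>z'\<in>F. W\<^sub>2 k z z' j w))"
      using that n2 by (intro member_le_sum[of z F] finite_F) auto
    also have "\<dots> \<le> (\<Sum>k<K. \<Sum>z\<in>F. W\<^sub>1 k z j w + (\<Sum>z'\<in>F. W\<^sub>2 k z z' j w))"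
      using k n3 by (intro member_le_sum[of k "{..<K}"]) auto
    finally show ?thesis using V abs_ge_zero[of "Vhat j w"] by linarith
  qed
  have W1: "W\<^sub>1 k z j w \<le> C" if "z \<in> F" for z
  proof -
    have "0 \<le> (\<Sum>z'\<in>F. W\<^sub>2 k z z' j w)" using n1 by (intro sum_nonneg)
    then show ?thesis using le[OF that] by linarith
  qed
  have W2: "W\<^sub>2 k z z' j w \<le> C" if "z \<in> F" "z' \<in> F" for z z'
  proof -
    have "W\<^sub>2 k z z' j w \<le> (\<Sum>z'\<in>F. W\<^sub>2 k z z' j w)"
      using that(2) n1(2) by (intro member_le_sum[of z' F] finite_F) auto
    then show ?thesis using le[OF that(1)] n1(1)[of k z] by linarith
  qed
  have X: "finite (in_fold (n j) (f j w) k)" "in_fold (n j) (f j w) k \<noteq> {}"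
    by (rule in_fold_nonempty[OF f_in[OF w] k])+
  define \<rho> where "\<rho> = sqrt (real (card (J j w k)))"
  have "0 < card (J j w k)"
    using X T_ge_1[of j] by (subst card_gt_0_iff) (auto simp: lessThan_empty_iff)
  then have \<rho>: "0 < \<rho>" unfolding \<rho>_def by simp
  have sc: "\<bar>u\<bar> \<le> C * (1 / \<rho>)" if "\<bar>\<rho> * u\<bar> \<le> C" for u using that \<rho> by (simp add: abs_mult field_simps)
  have q: "\<bar>u\<bar> \<le> C * v" if "\<bar>u / v\<bar> \<le> C" "0 < v" for u v :: real using that by (simp add: divide_le_eq)
  note pos = rate_bounds(1)[OF rates_pos(1), of j] rate_bounds(1)[OF rates_pos(2), of j] rate_bounds(1)[OF rates_pos(3), of j]
  show "good_fold C (1 / sqrt (real (card (J j w k)))) (q\<^sub>1 j) (q\<^sub>2 j) (q\<^sub>3 j) (J j w k) (transitions S A R w)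
     (Qhat j w k) (\<tau>hat j w k) (\<omega>hat j w k)"
    unfolding good_fold_def \<rho>_def[symmetric]
  proof (intro ballI conjI)
    fix z assume z: "z \<in> F"
    have s: "0 \<le> \<bar>err (Qhat j w k) z / q\<^sub>1 j\<bar>" "0 \<le> \<bar>\<omega>hat j w k (fst z) (snd z)\<bar>"
      "0 \<le> \<bar>(\<omega>hat j w k (fst z) (snd z) - \<omega> z) / q\<^sub>3 j\<bar>" "0 \<le> \<bar>scaled_avg (\<lambda>y. e y z) 0 k j w\<bar>"
      by (rule abs_ge_zero)+
    note W = W1[OF z, unfolded W\<^sub>1_def]
    have "\<bar>err (Qhat j w k) z / q\<^sub>1 j\<bar> \<le> C" using W s by linarith
    then show "\<bar>err (Qhat j w k) z\<bar> \<le> C * q\<^sub>1 j" by (rule q[OF _ pos(1)])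
    show "\<bar>\<omega>hat j w k (fst z) (snd z)\<bar> \<le> C" using W s by linarith
    have "\<bar>(\<omega>hat j w k (fst z) (snd z) - \<omega> z) / q\<^sub>3 j\<bar> \<le> C" using W s by linarith
    then show "\<bar>\<omega>hat j w k (fst z) (snd z) - \<omega> z\<bar> \<le> C * q\<^sub>3 j" by (rule q[OF _ pos(3)])
    have "\<bar>scaled_avg (\<lambda>y. e y z) 0 k j w\<bar> \<le> C" using W s by linarith
    from sc[OF this[folded \<rho>_def]]
    show "\<bar>(\<Sum>ii\<in>J j w k. e (tn (fst ii) (snd ii) w) z) / real (card (J j w k))\<bar> \<le> C * (1 / \<rho>)"
      unfolding fold_avg_def diff_zero .
    fix z' assume z': "z' \<in> F"
    have s: "0 \<le> \<bar>kern (\<tau>hat j w k) z z'\<bar>" "0 \<le> \<bar>(kern (\<tau>hat j w k) z z' - \<tau> z z') / q\<^sub>2 j\<bar>"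
      "0 \<le> \<bar>scaled_avg (\<lambda>y. b y z z') (Bm z z') k j w\<bar>"
      by (rule abs_ge_zero)+
    note W = W2[OF z z', unfolded W\<^sub>2_def]
    show "\<bar>kern (\<tau>hat j w k) z z'\<bar> \<le> C" using W s by linarith
    have "\<bar>(kern (\<tau>hat j w k) z z' - \<tau> z z') / q\<^sub>2 j\<bar> \<le> C" using W s by linarith
    then show "\<bar>kern (\<tau>hat j w k) z z' - \<tau> z z'\<bar> \<le> C * q\<^sub>2 j" by (rule q[OF _ pos(2)])
    have "\<bar>scaled_avg (\<lambda>y. b y z z') (Bm z z') k j w\<bar> \<le> C" using W s by linarith
    from sc[OF this[folded \<rho>_def]]
    show "\<bar>(\<Sum>ii\<in>J j w k. b (tn (fst ii) (snd ii) w) z z') / real (card (J j w k)) - Bm z z'\<bar> \<le> C * (1 / \<rho>)"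
      unfolding fold_avg_def .
  qed
qed

abbreviation psis where
  "psis j w \<equiv> psi \<gamma> pol G (n j) (T j) (f j w) (transitions S A R w) (Qhat j w) (\<tau>hat j w) (\<omega>hat j w) m"

abbreviation s\<^sub>m where "s\<^sub>m j \<equiv> q\<^sub>1 j * q\<^sub>2 j ^ (m - 1)"

text \<open>All rates are powers of N. In the fourth limit the exponent is 1 / 2 - (\<alpha>1 + (m -
  1) * \<alpha>2 + \<alpha>3), negative by the condition on m.\<close>

lemma rate_limits:
  "(\<lambda>j. 1 / sqrt (N j)) \<longlonglongrightarrow> 0" "q\<^sub>3 \<longlonglongrightarrow> 0" "s\<^sub>m \<longlonglongrightarrow> 0"
  "(\<lambda>j. sqrt (N j) * (q\<^sub>3 j * s\<^sub>m j)) \<longlonglongrightarrow> 0" "(\<lambda>j. 1 / N j) \<longlonglongrightarrow> 0"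
proof -
  have lim: "(\<lambda>j. N j powr u) \<longlonglongrightarrow> 0" if "u < 0" for u
    using that N_at_top by (rule tendsto_neg_powr)
  have sm: "s\<^sub>m j = N j powr (- (\<alpha>1 + real (m - 1) * \<alpha>2))" for j
  proof -
    have "q\<^sub>2 j ^ (m - 1) = N j powr (- \<alpha>2 * real (m - 1))"
      using N_pos[of j] by (subst powr_power) (auto simp: mult.commute)
    then show ?thesis using N_ge_1[of j] by (simp add: powr_add[symmetric] algebra_simps)
  qed
  have "0 \<le> real (m - 1) * \<alpha>2" using rates_pos by simp
  then have "- (\<alpha>1 + real (m - 1) * \<alpha>2) < 0" using rates_pos by linarith
  then show "s\<^sub>m \<longlonglongrightarrow> 0" unfolding sm by (rule lim)
  show "q\<^sub>3 \<longlonglongrightarrow> 0" using rates_pos by (intro lim) simp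
  have "sqrt (N j) * (q\<^sub>3 j * s\<^sub>m j) = N j powr (1 / 2 - (\<alpha>1 + real (m - 1) * \<alpha>2 + \<alpha>3))" for j
  proof -
    have "sqrt (N j) = N j powr (1 / 2)" using N_ge_1[of j] by (simp add: powr_half_sqrt)
    then show ?thesis unfolding sm by (simp only: powr_add[symmetric]) (simp add: algebra_simps)
  qed
  then show "(\<lambda>j. sqrt (N j) * (q\<^sub>3 j * s\<^sub>m j)) \<longlonglongrightarrow> 0" using lim order by simp
  show "(\<lambda>j. 1 / sqrt (N j)) \<longlonglongrightarrow> 0"
    by (intro real_tendsto_divide_at_top[OF tendsto_const] filterlim_compose[OF sqrt_at_top N_at_top])
  show "(\<lambda>j. 1 / N j) \<longlonglongrightarrow> 0"
    by (intro real_tendsto_divide_at_top[OF tendsto_const] N_at_top)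
qed

lemma remainder_rate_limit: "(\<lambda>j. remainder_rate C K m (N j) (s\<^sub>m j) (q\<^sub>3 j)) \<longlonglongrightarrow> 0"
proof -
  have "(\<lambda>j. real K * total_bound C (m - 1) * (1 / sqrt (N j) + s\<^sub>m j + 2 * q\<^sub>3 j + sqrt (N j) * (q\<^sub>3 j * s\<^sub>m j)))
     \<longlonglongrightarrow> real K * total_bound C (m - 1) * (0 + 0 + 2 * 0 + 0)"
    by (intro tendsto_mult tendsto_add tendsto_const rate_limits)
  then show ?thesis unfolding remainder_rate_def by simp
qed

lemma variance_rate_limit: "(\<lambda>j. variance_rate C K m (N j) (s\<^sub>m j) (q\<^sub>3 j)) \<longlonglongrightarrow> 0"
proof -
  define \<delta> where "\<delta> j = real K * total_bound C (m - 1) * (q\<^sub>3 j + 1 / sqrt (N j) + s\<^sub>m j)" for j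
  define \<beta> where "\<beta> j = real K * (c * (real (card F) * (C * C))) * (1 / sqrt (N j))" for j
  have "\<delta> \<longlonglongrightarrow> real K * total_bound C (m - 1) * (0 + 0 + 0)"
    unfolding \<delta>_def by (intro tendsto_mult tendsto_add tendsto_const rate_limits)
  then have \<delta>: "\<delta> \<longlonglongrightarrow> 0" by simp
  have "\<beta> \<longlonglongrightarrow> real K * (c * (real (card F) * (C * C))) * 0"
    unfolding \<beta>_def by (intro tendsto_mult tendsto_const rate_limits)
  then have \<beta>: "\<beta> \<longlonglongrightarrow> 0" by simp
  have "(\<lambda>j. 2 * (C * (1 / sqrt (N j)) + (2 * y_bd + total_bound C (m - 1) * 3) * \<delta> j + (\<beta> j + \<delta> j)\<^sup>2) + (2 * \<sigma>2) * (1 / N j))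
     \<longlonglongrightarrow> 2 * (C * 0 + (2 * y_bd + total_bound C (m - 1) * 3) * 0 + (0 + 0)\<^sup>2) + (2 * \<sigma>2) * 0"
    by (intro tendsto_mult tendsto_add tendsto_power tendsto_const rate_limits \<delta> \<beta>)
  then show ?thesis unfolding variance_rate_def Let_def \<delta>_def \<beta>_def by simp
qed

section \<open>Asymptotics of the studentized estimator\<close>

abbreviation score where
  "score j w \<equiv> (\<Sum>i<n j. \<Sum>t<T j. y\<^sub>0 (tn i t w)) / sqrt (N j)"

abbreviation centred where
  "centred j w \<equiv> sqrt (N j) * (sample_mean (n j) (T j) (psis j w) - policy_value \<gamma> p r pol G)"

lemma measurable_score: "score j \<in> borel_measurable M"
  by measurable

lemma measurable_psis: "i < n j \<Longrightarrow> (\<lambda>w. psis j w i t) \<in> borel_measurable M"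
  by (rule measurable_psi[OF measurable_f measurable_Qhat measurable_\<tau>hat measurable_\<omega>hat])

lemma measurable_statistics:
  "(\<lambda>w. sample_mean (n j) (T j) (psis j w)) \<in> borel_measurable M"
  "(\<lambda>w. sample_var (n j) (T j) (psis j w)) \<in> borel_measurable M"
proof -
  show m: "(\<lambda>w. sample_mean (n j) (T j) (psis j w)) \<in> borel_measurable M"
    unfolding sample_mean_def
    by (intro borel_measurable_divide borel_measurable_sum borel_measurable_const measurable_psis) simp
  show "(\<lambda>w. sample_var (n j) (T j) (psis j w)) \<in> borel_measurable M"
    unfolding sample_var_def
    by (intro borel_measurable_divide borel_measurable_sum borel_measurable_const borel_measurable_power
        borel_measurable_diff measurable_psis m) simp
qed

lemma small_remainder:
  assumes \<epsilon>: "0 < \<epsilon>"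
  shows "\<forall>\<^sub>F j in sequentially. \<exists>E\<in>sets M. prob E \<le> \<epsilon> \<and> (\<forall>w\<in>space M - E.
     \<bar>centred j w - score j w\<bar> \<le> \<epsilon> \<and> \<bar>sqrt (sample_var (n j) (T j) (psis j w)) - sqrt \<sigma>2\<bar> \<le> \<epsilon>)"
proof -
  obtain C0 where C0: "\<forall>\<^sub>F j in sequentially. \<exists>E\<in>sets M. prob E \<le> \<epsilon> \<and> (\<forall>w\<in>space M - E. \<bar>W j w\<bar> \<le> C0)"
    using tight_W \<epsilon> unfolding tight_def by blast
  define C where "C = max C0 (max 1 (max e_bd B))"
  have C: "1 \<le> C" "e_bd \<le> C" "B \<le> C" "C0 \<le> C" by (auto simp: C_def)
  \<comment> \<open>A null event outside which all transitions are valid; it is added to the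
    exceptional event of \<open>W\<close>.\<close>
  from AE_E[OF AE_valid] obtain E0 where E0: "{w \<in> space M. \<not> (\<forall>i t. valid (tn i t w))} \<subseteq> E0"
    "emeasure M E0 = 0" "E0 \<in> sets M" .
  have sp: "0 < sqrt \<sigma>2" using sigma2_pos by simp
  have "\<forall>\<^sub>F j in sequentially. remainder_rate C K m (N j) (s\<^sub>m j) (q\<^sub>3 j) < \<epsilon>"
    using remainder_rate_limit \<epsilon> by (rule order_tendstoD(2))
  \<comment> \<open>The factor \<open>sqrt \<sigma>2\<close> anticipates the passage to square
    roots, where the difference of the variances is divided by a sum of roots that is at least
    \<open>sqrt \<sigma>2\<close>.\<close>
  moreover have "\<forall>\<^sub>F j in sequentially. variance_rate C K m (N j) (s\<^sub>m j) (q\<^sub>3 j) < \<epsilon> * sqrt \<sigma>2"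
    using variance_rate_limit \<epsilon> sp by (intro order_tendstoD(2)) auto
  ultimately show ?thesis using C0
  proof eventually_elim
    case (elim j)
    then obtain E where E: "E \<in> sets M" "prob E \<le> \<epsilon>" "\<And>w. w \<in> space M - E \<Longrightarrow> \<bar>W j w\<bar> \<le> C0" by blast
    have "prob (E \<union> E0) \<le> \<epsilon>"
      using measure_Un_le[OF E(1) E0(3)] E(2) E0(2) by (simp add: measure_def)
    moreover have "\<bar>centred j w - score j w\<bar> \<le> \<epsilon> \<and> \<bar>sqrt (sample_var (n j) (T j) (psis j w)) - sqrt \<sigma>2\<bar> \<le> \<epsilon>"
      if w: "w \<in> space M - (E \<union> E0)" for w
    proof -
      have wM: "w \<in> space M" using w by simp
      have valid: "\<And>i t. valid (tn i t w)" using w E0(1) by blast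
      have WC: "W j w \<le> C" using E(3)[of w] w C(4) by simp
      have K0: "0 < K" using folds by simp
      note b = estimator_error_bounds[OF f_in[OF wM] T_ge_1 n_ge_2 valid C(1-3) less_imp_le[OF rate_bounds(1)[OF rates_pos(2)]]
          rate_bounds(2)[OF rates_pos(2)] less_imp_le[OF rate_bounds(1)[OF rates_pos(1)]] rate_bounds(2)[OF rates_pos(1)]
          less_imp_le[OF rate_bounds(1)[OF rates_pos(3)]] rate_bounds(2)[OF rates_pos(3)]
          enough_indices[rule_format, OF wM] W_good(1)[OF wM WC] W_good(2)[OF wM WC K0]]
      have b1: "\<bar>centred j w - score j w\<bar> \<le> remainder_rate C K m (N j) (s\<^sub>m j) (q\<^sub>3 j)"
        by (rule b(1)) auto
      have b2: "\<bar>sample_var (n j) (T j) (psis j w) - \<sigma>2\<bar> \<le> variance_rate C K m (N j) (s\<^sub>m j) (q\<^sub>3 j)"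
        by (rule b(2)) auto
      let ?sv = "sample_var (n j) (T j) (psis j w)"
      have "1 \<le> N j" by (rule N_ge_1)
      then have sv0: "0 \<le> ?sv" unfolding sample_var_def by (intro divide_nonneg_nonneg sum_nonneg) auto
      have eq: "(sqrt ?sv - sqrt \<sigma>2) * (sqrt ?sv + sqrt \<sigma>2) = ?sv - \<sigma>2"
        using sv0 sigma2_pos by (simp add: algebra_simps)
      have "\<bar>sqrt ?sv - sqrt \<sigma>2\<bar> * (sqrt ?sv + sqrt \<sigma>2) = \<bar>?sv - \<sigma>2\<bar>"
      proof -
        have "0 \<le> sqrt ?sv + sqrt \<sigma>2" using sv0 sp by (intro add_nonneg_nonneg) auto
        then have "\<bar>(sqrt ?sv - sqrt \<sigma>2) * (sqrt ?sv + sqrt \<sigma>2)\<bar> = \<bar>sqrt ?sv - sqrt \<sigma>2\<bar> * (sqrt ?sv + sqrt \<sigma>2)"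
          by (simp only: abs_mult abs_of_nonneg)
        then show ?thesis using eq by (simp only:)
      qed
      moreover have "\<bar>sqrt ?sv - sqrt \<sigma>2\<bar> * sqrt \<sigma>2 \<le> \<bar>sqrt ?sv - sqrt \<sigma>2\<bar> * (sqrt ?sv + sqrt \<sigma>2)"
        using sv0 by (intro mult_left_mono) auto
      ultimately have "\<bar>sqrt ?sv - sqrt \<sigma>2\<bar> * sqrt \<sigma>2 \<le> \<epsilon> * sqrt \<sigma>2"
        using b2 elim(2) by linarith
      then have "\<bar>sqrt ?sv - sqrt \<sigma>2\<bar> \<le> \<epsilon>" using sp by simp
      then show ?thesis using b1 elim(1) by linarith
    qed
    ultimately show ?case using E(1) E0(3) by (intro bexI[of _ "E \<union> E0"]) auto
  qed
qed

theorem coverage: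
  assumes level: "0 < \<alpha>" "\<alpha> < 1"
  shows "(\<lambda>j. prob {w \<in> space M. policy_value \<gamma> p r pol G \<in> conf_interval \<alpha> (n j) (T j) (psis j w)}) \<longlonglongrightarrow> 1 - \<alpha>"
proof -
  define z where "z = upper_quantile (\<alpha> / 2)"
  have z: "0 \<le> z" "measure std_normal_distribution {- z..z} = 1 - \<alpha>"
    unfolding z_def using upper_quantile_interval[OF level] by auto
  \<comment> \<open>For z = 0 the interval would be a single point of mass zero, but its mass is 1 -
    \<alpha>.\<close>
  have z0: "0 < z"
  proof (rule ccontr)
    assume "\<not> 0 < z"
    then have "{- z..z} = {0}" using z(1) by auto
    then have "1 - \<alpha> = 0" using z(2) std_normal_singleton[of 0] by (simp only:)
    then show False using level by simp
  qed
  \<comment> \<open>Multiplication by sqrt N turns coverage into a bound on the centred estimator,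
    which is split into the score and a negligible remainder to match
    \<open>slutsky_interval\<close>.\<close>
  have mem: "policy_value \<gamma> p r pol G \<in> conf_interval \<alpha> (n j) (T j) (psis j w)
     \<longleftrightarrow> \<bar>score j w + (centred j w - score j w)\<bar> \<le> z * sqrt (sample_var (n j) (T j) (psis j w))" for j w
  proof -
    define v where "v = sqrt (sample_var (n j) (T j) (psis j w))"
    define u where "u = sample_mean (n j) (T j) (psis j w) - policy_value \<gamma> p r pol G"
    define \<rho> where "\<rho> = sqrt (N j)"
    have \<rho>: "0 < \<rho>" using N_ge_1[of j] by (simp add: \<rho>_def)
    have N: "N j powr (- 1 / 2) = 1 / \<rho>"
    proof -
      have "N j powr (- 1 / 2) = inverse (N j powr (1 / 2))"
        unfolding powr_minus[symmetric] by (simp only: minus_divide_left)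
      also have "N j powr (1 / 2) = \<rho>" unfolding \<rho>_def by (rule powr_half_sqrt) (rule of_nat_0_le_iff)
      finally show ?thesis by (simp only: inverse_eq_divide)
    qed
    have interval: "x \<in> {y - h..y + h} \<longleftrightarrow> \<bar>y - x\<bar> \<le> h" for x y h :: real by auto
    have "policy_value \<gamma> p r pol G \<in> conf_interval \<alpha> (n j) (T j) (psis j w) \<longleftrightarrow> \<bar>u\<bar> \<le> z * (1 / \<rho>) * v"
      unfolding conf_interval_def Let_def z_def[symmetric] v_def[symmetric] u_def N interval ..
    also have "\<dots> \<longleftrightarrow> \<bar>\<rho> * u\<bar> \<le> z * v" using \<rho> by (simp add: abs_mult field_simps)
    finally show ?thesis by (simp add: v_def u_def \<rho>_def)
  qed
  have "(\<lambda>j. prob {w \<in> space M. \<bar>score j w + (centred j w - score j w)\<bar> \<le> z * sqrt (sample_var (n j) (T j) (psis j w))})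
     \<longlonglongrightarrow> measure std_normal_distribution {- z..z}"
  proof (rule slutsky_interval[where \<sigma>="sqrt \<sigma>2"])
    show "score j \<in> borel_measurable M" for j by (rule measurable_score)
    show "weak_conv_m (\<lambda>j. distr M borel (\<lambda>w. score j w / sqrt \<sigma>2)) std_normal_distribution"
      by (rule score_clt[OF N_at_top])
    show "0 < sqrt \<sigma>2" using sigma2_pos by simp
    show "{w \<in> space M. \<bar>score j w + (centred j w - score j w)\<bar> \<le> z * sqrt (sample_var (n j) (T j) (psis j w))} \<in> sets M" for j
      by (intro borel_measurable_le borel_measurable_abs borel_measurable_add borel_measurable_diff borel_measurable_times
          borel_measurable_const measurable_compose[OF measurable_statistics(2) borel_measurable_sqrt] measurable_statistics measurable_score)
  qed (rule z0, rule small_remainder)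
  then show ?thesis unfolding mem z(2) .
qed

end

end

end

theorem theorem3:
  fixes M :: "'w measure"
    and S :: "nat \<Rightarrow> nat \<Rightarrow> 'w \<Rightarrow> 's::countable"
    and A :: "nat \<Rightarrow> nat \<Rightarrow> 'w \<Rightarrow> 'a::countable"
    and R :: "nat \<Rightarrow> nat \<Rightarrow> 'w \<Rightarrow> real"
    and X :: "nat \<Rightarrow> nat \<Rightarrow> 'w \<Rightarrow> ('s, 'a) obs"
    and \<gamma> :: real
    and p :: "'a \<Rightarrow> 's \<Rightarrow> 's pmf"
    and r :: "'a \<Rightarrow> 's \<Rightarrow> real"
    and pol :: "'s \<Rightarrow> 'a pmf"
    and G :: "'s pmf"
    and pinf :: "('a \<times> 's) pmf"
    and K m :: nat
    and n T :: "nat \<Rightarrow> nat"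
    and f :: "nat \<Rightarrow> 'w \<Rightarrow> nat \<Rightarrow> nat"
    and Qest \<omega>est :: "nat \<Rightarrow> nat \<Rightarrow> (nat \<Rightarrow> nat) \<Rightarrow> (nat \<Rightarrow> nat \<Rightarrow> ('s, 'a) transition) \<Rightarrow>
                        'a \<Rightarrow> 's \<Rightarrow> real"
    and \<tau>est :: "nat \<Rightarrow> nat \<Rightarrow> (nat \<Rightarrow> nat) \<Rightarrow> (nat \<Rightarrow> nat \<Rightarrow> ('s, 'a) transition) \<Rightarrow>
                   'a \<Rightarrow> 's \<Rightarrow> 'a \<Rightarrow> 's \<Rightarrow> real"
    and Qhat \<omega>hat :: "nat \<Rightarrow> 'w \<Rightarrow> nat \<Rightarrow> 'a \<Rightarrow> 's \<Rightarrow> real"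
    and \<tau>hat :: "nat \<Rightarrow> 'w \<Rightarrow> nat \<Rightarrow> 'a \<Rightarrow> 's \<Rightarrow> 'a \<Rightarrow> 's \<Rightarrow> real"
    and \<alpha>1 \<alpha>2 \<alpha>3 \<alpha> :: real
  defines "X \<equiv> \<lambda>i t w. (S i t w, A i t w, R i t w)"
    and "Qhat \<equiv> \<lambda>j w k. fitted (n j) (T j) k (Qest j k) (f j w) (transitions S A R w)"
    and "\<tau>hat \<equiv> \<lambda>j w k. fitted (n j) (T j) k (\<tau>est j k) (f j w) (transitions S A R w)"
    and "\<omega>hat \<equiv> \<lambda>j w k. fitted (n j) (T j) k (\<omega>est j k) (f j w) (transitions S A R w)"
  assumes "prob_space M"
    and "0 < \<gamma>" "\<gamma> < 1"
    and mdp: "\<forall>i. mdp_trajectory M p r (S i) (A i) (R i)"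
    and bounded_rewards:
      "\<exists>B. (\<forall>a s. \<bar>r a s\<bar> \<le> B) \<and> (\<forall>i t. AE w in M. \<bar>R i t w\<bar> \<le> B)"
    and iid: "iid_trajectories M X"
    and stationary: "\<forall>i. strictly_stationary M (X i)"
    and mixing: "\<forall>i. exp_beta_mixing M (X i)"
    and limiting_distribution:
      "\<forall>i a s. (\<lambda>t. measure M {w \<in> space M. A i t w = a \<and> S i t w = s})
                 \<longlonglongrightarrow> pmf pinf (a, s)"
    \<comment> \<open>\<open>\<tau>\<close> is used only at \<open>(a0, s0)\<close> in the support of \<open>pinf\<close>\<close>
    and omega_abs_cont: "\<forall>a s. pmf pinf (a, s) = 0 \<longrightarrow> omega_num \<gamma> p pol G a s = 0"
    and tau_abs_cont: "\<forall>(a0, s0)\<in>set_pmf pinf. \<forall>a s.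
      pmf pinf (a, s) = 0 \<longrightarrow> tau_num \<gamma> p pol a s a0 s0 = 0"
    \<comment> \<open>the asymptotic variance does not vanish\<close>
    and nondegenerate:
      "\<not> (AE w in M. omega_ratio \<gamma> p pol G pinf (A 0 0 w) (S 0 0 w) *
             (R 0 0 w - Q_fun \<gamma> p r pol (A 0 0 w) (S 0 0 w)
              + \<gamma> * measure_pmf.expectation (pol (S 0 1 w)) (\<lambda>a. Q_fun \<gamma> p r pol a (S 0 1 w))) = 0)"
    \<comment> \<open>along the sequence of designs \<open>(n j, T j)\<close>, \<open>n\<close> or \<open>T\<close> diverges\<close>
    and sample_size: "\<forall>j. 1 \<le> T j" "filterlim (\<lambda>j. max (n j) (T j)) at_top sequentially"
    and folds: "2 \<le> K" "\<forall>j. random_division M X (n j) K (f j)"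
    and estimators:
      "\<forall>j. \<forall>k<K. \<forall>a s. estimator_measurable (n j) (T j) K k (\<lambda>g D. Qest j k g D a s)"
      "\<forall>j. \<forall>k<K. \<forall>a s a' s'. estimator_measurable (n j) (T j) K k (\<lambda>g D. \<tau>est j k g D a s a' s')"
      "\<forall>j. \<forall>k<K. \<forall>a s. estimator_measurable (n j) (T j) K k (\<lambda>g D. \<omega>est j k g D a s)"
    and rates_pos: "0 < \<alpha>1" "0 < \<alpha>2" "0 < \<alpha>3"
    and rates:
      "\<forall>k<K. (\<lambda>j. L2_error M pinf (\<lambda>w. Qhat j w k) (Q_fun \<gamma> p r pol))
               \<in> O(\<lambda>j. real (n j * T j) powr (- \<alpha>1))"
      "\<forall>k<K. (\<lambda>j. L2_error2 M pinf (\<lambda>w. \<tau>hat j w k) (tau_ratio \<gamma> p pol pinf))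
               \<in> O(\<lambda>j. real (n j * T j) powr (- \<alpha>2))"
      "\<forall>k<K. (\<lambda>j. L2_error M pinf (\<lambda>w. \<omega>hat j w k) (omega_ratio \<gamma> p pol G pinf))
               \<in> O(\<lambda>j. real (n j * T j) powr (- \<alpha>3))"
    and bounded_estimators:
      "\<exists>B. \<forall>j. \<forall>k<K. AE w in M. \<forall>(a, s)\<in>set_pmf pinf.
         \<bar>Qhat j w k a s\<bar> \<le> B \<and> \<bar>\<omega>hat j w k a s\<bar> \<le> B \<and>
         (\<forall>(a', s')\<in>set_pmf pinf. \<bar>\<tau>hat j w k a s a' s'\<bar> \<le> B)"
    and bounded_ratios:
      "\<exists>B. \<forall>(a, s)\<in>set_pmf pinf. \<bar>omega_ratio \<gamma> p pol G pinf a s\<bar> \<le> B \<and>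
         (\<forall>(a', s')\<in>set_pmf pinf. \<bar>tau_ratio \<gamma> p pol pinf a s a' s'\<bar> \<le> B)"
    and order: "1 \<le> m" "1 / 2 < \<alpha>1 + real (m - 1) * \<alpha>2 + \<alpha>3"
    and enough_indices: "\<forall>j. \<forall>w\<in>space M. \<forall>k<K. m - 1 \<le> card (in_fold (n j) (f j w) k) * T j"
    and level: "0 < \<alpha>" "\<alpha> < 1"
  shows "(\<lambda>j. measure M {w \<in> space M. policy_value \<gamma> p r pol G \<in>
             conf_interval \<alpha> (n j) (T j)
               (psi \<gamma> pol G (n j) (T j) (f j w) (transitions S A R w)
                  (Qhat j w) (\<tau>hat j w) (\<omega>hat j w) m)})
           \<longlonglongrightarrow> 1 - \<alpha>"
proof -
  obtain B1 where B1: "\<forall>a s. \<bar>r a s\<bar> \<le> B1" "\<forall>i t. AE w in M. \<bar>R i t w\<bar> \<le> B1"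
    using bounded_rewards by blast
  obtain B2 where B2: "\<forall>(a, s)\<in>set_pmf pinf. \<bar>omega_ratio \<gamma> p pol G pinf a s\<bar> \<le> B2 \<and>
         (\<forall>(a', s')\<in>set_pmf pinf. \<bar>tau_ratio \<gamma> p pol pinf a s a' s'\<bar> \<le> B2)"
    using bounded_ratios by blast
  obtain B3 where B3: "\<forall>j. \<forall>k<K. AE w in M. \<forall>(a, s)\<in>set_pmf pinf.
         \<bar>Qhat j w k a s\<bar> \<le> B3 \<and> \<bar>\<omega>hat j w k a s\<bar> \<le> B3 \<and>
         (\<forall>(a', s')\<in>set_pmf pinf. \<bar>\<tau>hat j w k a s a' s'\<bar> \<le> B3)"
    using bounded_estimators by blast
  \<comment> \<open>The locales use one constant for rewards and ratios; the bound on the estimators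
    stays separate.\<close>
  define B where "B = max B1 B2"
  have B: "B1 \<le> B" "B2 \<le> B" by (auto simp: B_def)
  have R: "\<forall>i t. AE w in M. \<bar>R i t w\<bar> \<le> B"
  proof (intro allI)
    fix i t
    have "AE w in M. \<bar>R i t w\<bar> \<le> B1" using B1 by blast
    then show "AE w in M. \<bar>R i t w\<bar> \<le> B" by eventually_elim (use B in linarith)
  qed
  have r: "\<bar>r a s\<bar> \<le> B" for a s using B1(1) B(1) order.trans by blast
  have ratios: "\<forall>(a, s)\<in>set_pmf pinf. \<bar>omega_ratio \<gamma> p pol G pinf a s\<bar> \<le> B \<and>
         (\<forall>(a', s')\<in>set_pmf pinf. \<bar>tau_ratio \<gamma> p pol pinf a s a' s'\<bar> \<le> B)"
  proof -
    have "\<bar>u\<bar> \<le> B2 \<Longrightarrow> \<bar>u\<bar> \<le> B" for u :: real using B(2) by (rule order.trans[rotated])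
    then show ?thesis using B2 unfolding case_prod_unfold by blast
  qed
  interpret prob_space M by fact
  interpret off_policy_evaluation \<gamma> p r pol G pinf B
    using \<open>0 < \<gamma>\<close> \<open>\<gamma> < 1\<close> r omega_abs_cont tau_abs_cont ratios by (rule off_policy_evaluation.intro)
  interpret ope_data M \<gamma> p r pol G pinf B S A R X
    by unfold_locales
       (rule X_def[THEN meta_eq_to_obj_eq] mdp R iid stationary mixing limiting_distribution nondegenerate)+
  show ?thesis
    unfolding Qhat_def \<tau>hat_def \<omega>hat_def
    by (rule coverage[OF sample_size folds estimators rates_pos
        rates[unfolded Qhat_def \<tau>hat_def \<omega>hat_def] B3[unfolded Qhat_def \<tau>hat_def \<omega>hat_def]
        order(2) enough_indices level])
qed

end
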